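(* Given the equilibrium variance and the correlation time statistics of the true signal $x(t)$, which evolves according to the full linear model, the reduced Mean Stochastic Model (MSM) filter is an optimal filter, in the sense that its posterior mean and covariance estimates, $\tilde x$ and $\tilde s$, differ by an order of $\epsilon^2$ from the true filter estimates, $\hat x$ and $\hat s_{11}$, obtained with the perfect model.
   Context: Let $a_{11},a_{12},a_{21},a_{22}$ be real constants, let $\sigma_x,\sigma_y>0$ be constants of $\mathcal O(1)$, and let $R>0$. The matrix $A=(a_{ij})_{i,j=1,2}$ is assumed negative definite, and $\tilde a=a_{11}-\frac{a_{12}a_{21}}{a_{22}}$ is assumed to satisfy $\tilde a<0$. For $\epsilon>0$ let $$A_\epsilon=\begin{pmatrix}a_{11}&a_{12}\\ a_{21}/\epsilon&a_{22}/\epsilon\end{pmatrix},\qquad Q_\epsilon=\begin{pmatrix}\sigma_x^2&0\\0&\sigma_y^2/\epsilon\end{pmatrix},\qquad H=(1,0).$$ Full (perfect) model and filtering problem, which generates the true signal and the observations $z$: $dx=(a_{11}x+a_{12}y)\,dt+\sigma_x\,dW_x$, $dy=\frac1\epsilon(a_{21}x+a_{22}y)\,dt+\frac{\sigma_y}{\sqrt\epsilon}\,dW_y$, $dz=x\,dt+\sqrt R\,dV$, with $W_x,W_y,V$ independent standard Wiener processes. The equilibrium variance of $x$ is $\mathrm{Var}_x=\lim_{t\to\infty}\mathbb E[x(t)^2]$ and its correlation time is $T_x=\lim_{t\to\infty}\int_0^\infty\frac{\mathbb E[x(t)x(t+\tau)]}{\mathbb E[x(t)^2]}\,d\tau$.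 True filter: the steady state Kalman-Bucy covariance $\hat S=(\hat s_{ij})_{i,j=1,2}$ solves $A_\epsilon\hat S+\hat SA_\epsilon^\top-\hat SH^\top R^{-1}H\hat S+Q_\epsilon=0$, and the mean estimates $(\hat x,\hat y)$ of $(x,y)$ solve $d(\hat x,\hat y)^\top=A_\epsilon(\hat x,\hat y)^\top dt+\hat SH^\top R^{-1}(dz-\hat x\,dt)$. Reduced model and filter: $dX=aX\,dt+\sigma_X\,dW_X$, $dz=X\,dt+\sqrt R\,dV$, with $W_X$ a standard Wiener process. The steady state covariance estimate $\tilde s$ solves $-\frac{\tilde s^2}{R}+2a\tilde s+\sigma_X^2=0$, and the mean estimate $\tilde x$, driven by the observations $z$ of the full model, solves $d\tilde x=a\tilde x\,dt+\frac{\tilde s}{R}(dz-\tilde x\,dt)$. The Mean Stochastic Model (MSM) is the reduced model whose parameters $a,\sigma_X$ are specified by matching the equilibrium variance and the correlation time of $X$ to those of $x$: $$-\frac{\sigma_X^2}{2a}=\mathrm{Var}_x,\qquad-\frac1a=T_x.$$ The reduced MSM filter is the reduced filter with these parameters. *)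

theory Defs
  imports "HOL-Probability.Probability" "HOL-Library.Landau_Symbols"
begin

section \<open>Wiener processes\<close>

text \<open>
  Processes are functions of a time \<open>t :: real\<close> and a sample point; only times \<open>t \<ge> 0\<close> matter.
\<close>

definition continuous_process ::
  "'w measure \<Rightarrow> (real \<Rightarrow> 'w \<Rightarrow> 'b::topological_space) \<Rightarrow> bool" where
  "continuous_process M X \<longleftrightarrow>
     (\<forall>t\<ge>0. X t \<in> borel_measurable M) \<and>
     (AE \<omega> in M. continuous_on {0..} (\<lambda>t. X t \<omega>))"

definition wiener_process :: "'w measure \<Rightarrow> (real \<Rightarrow> 'w \<Rightarrow> real) \<Rightarrow> bool" where
  "wiener_process M W \<longleftrightarrow>
     continuous_process M W \<and>
     (AE \<omega> in M. W 0 \<omega> = 0) \<and>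
     (\<forall>s t. 0 \<le> s \<longrightarrow> s < t \<longrightarrow>
        distributed M lborel (\<lambda>\<omega>. W t \<omega> - W s \<omega>) (normal_density 0 (sqrt (t - s)))) \<and>
     (\<forall>(n::nat) \<tau>. 0 \<le> \<tau> 0 \<longrightarrow> (\<forall>i<n. \<tau> i \<le> \<tau> (Suc i)) \<longrightarrow>
        prob_space.indep_vars M (\<lambda>_. borel)
          (\<lambda>i \<omega>. W (\<tau> (Suc i)) \<omega> - W (\<tau> i) \<omega>) {..<n})"

text \<open>
  Independence of whole processes: each process is regarded as a single random variable with
  values in the product space of real functions on \<open>{0..}\<close>.
\<close>

definition independent_wiener_processes ::
  "'w measure \<Rightarrow> nat \<Rightarrow> (nat \<Rightarrow> real \<Rightarrow> 'w \<Rightarrow> real) \<Rightarrow> bool" where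
  "independent_wiener_processes M n B \<longleftrightarrow>
     (\<forall>i<n. wiener_process M (B i)) \<and>
     prob_space.indep_vars M (\<lambda>_. PiM {0..} (\<lambda>_. borel))
       (\<lambda>i \<omega>. \<lambda>t\<in>{0..}. B i t \<omega>) {..<n}"

section \<open>The full model\<close>

definition matrix22 :: "real \<Rightarrow> real \<Rightarrow> real \<Rightarrow> real \<Rightarrow> real^2^2" where
  "matrix22 a b c d = vector [vector [a, b], vector [c, d]]"

text \<open>\<open>A\<close> is not assumed to be symmetric.\<close>

definition negative_definite :: "real^'n^'n \<Rightarrow> bool" where
  "negative_definite A \<longleftrightarrow> (\<forall>v. v \<noteq> 0 \<longrightarrow> v \<bullet> (A *v v) < 0)"

definition A_eps :: "real^2^2 \<Rightarrow> real \<Rightarrow> real^2^2" where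
  "A_eps A \<epsilon> = matrix22 (A $ 1 $ 1) (A $ 1 $ 2) (A $ 2 $ 1 / \<epsilon>) (A $ 2 $ 2 / \<epsilon>)"

definition Q_eps :: "real \<Rightarrow> real \<Rightarrow> real \<Rightarrow> real^2^2" where
  "Q_eps \<sigma>x \<sigma>y \<epsilon> = matrix22 (\<sigma>x\<^sup>2) 0 0 (\<sigma>y\<^sup>2 / \<epsilon>)"

text \<open>The observation operator is a matrix with one row and two columns.\<close>

definition H_obs :: "real^2^1" where
  "H_obs = vector [vector [1, 0]]"

text \<open>
  Since all noise coefficients are constant, the stochastic differential equations are stated in
  their pathwise integral form, in which the noise integrals are just multiples of the Wiener
  processes.  The initial signal is random, square integrable and independent of the noise.
\<close>

definition full_model ::
  "'w measure \<Rightarrow> real^2^2 \<Rightarrow> real \<Rightarrow> real \<Rightarrow> real \<Rightarrow> real \<Rightarrow>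
   (real \<Rightarrow> 'w \<Rightarrow> real) \<Rightarrow> (real \<Rightarrow> 'w \<Rightarrow> real) \<Rightarrow> (real \<Rightarrow> 'w \<Rightarrow> real) \<Rightarrow>
   (real \<Rightarrow> 'w \<Rightarrow> real) \<Rightarrow> (real \<Rightarrow> 'w \<Rightarrow> real) \<Rightarrow> (real \<Rightarrow> 'w \<Rightarrow> real) \<Rightarrow> bool" where
  "full_model M A \<sigma>x \<sigma>y R \<epsilon> Wx Wy V x y z \<longleftrightarrow>
     prob_space M \<and>
     independent_wiener_processes M 3 (\<lambda>i. [Wx, Wy, V] ! i) \<and>
     continuous_process M x \<and> continuous_process M y \<and> continuous_process M z \<and>
     integrable M (\<lambda>\<omega>. (x 0 \<omega>)\<^sup>2) \<and> integrable M (\<lambda>\<omega>. (y 0 \<omega>)\<^sup>2) \<and>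
     prob_space.indep_set M
       (sets (vimage_algebra (space M) (\<lambda>\<omega>. (x 0 \<omega>, y 0 \<omega>)) borel))
       (sets (vimage_algebra (space M)
          (\<lambda>\<omega>. \<lambda>(i, t)\<in>{..<3} \<times> {0..}. ([Wx, Wy, V] ! i) t \<omega>)
          (PiM ({..<3} \<times> {0..}) (\<lambda>_. borel)))) \<and>
     (AE \<omega> in M. \<forall>t\<ge>0.
        x t \<omega> = x 0 \<omega> + integral {0..t} (\<lambda>s. A $ 1 $ 1 * x s \<omega> + A $ 1 $ 2 * y s \<omega>)
                + \<sigma>x * Wx t \<omega>) \<and>
     (AE \<omega> in M. \<forall>t\<ge>0.
        y t \<omega> = y 0 \<omega> + 1 / \<epsilon> * integral {0..t} (\<lambda>s. A $ 2 $ 1 * x s \<omega> + A $ 2 $ 2 * y s \<omega>)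
                + \<sigma>y / sqrt \<epsilon> * Wy t \<omega>) \<and>
     (AE \<omega> in M. \<forall>t\<ge>0.
        z t \<omega> = z 0 \<omega> + integral {0..t} (\<lambda>s. x s \<omega>) + sqrt R * V t \<omega>)"

definition equilibrium_variance :: "'w measure \<Rightarrow> (real \<Rightarrow> 'w \<Rightarrow> real) \<Rightarrow> real" where
  "equilibrium_variance M x = Lim at_top (\<lambda>t. \<integral>\<omega>. (x t \<omega>)\<^sup>2 \<partial>M)"

definition correlation_time :: "'w measure \<Rightarrow> (real \<Rightarrow> 'w \<Rightarrow> real) \<Rightarrow> real" where
  "correlation_time M x =
     Lim at_top (\<lambda>t. LINT \<tau>:{0..}|lborel.
       (\<integral>\<omega>. x t \<omega> * x (t + \<tau>) \<omega> \<partial>M) / (\<integral>\<omega>. (x t \<omega>)\<^sup>2 \<partial>M))"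

section \<open>The true Kalman-Bucy filter\<close>

text \<open>
  The algebraic Riccati equation also has solutions that are not covariance matrices, hence the
  requirement that \<open>S\<close> be symmetric and positive semidefinite.
\<close>

definition steady_state_covariance ::
  "real^2^2 \<Rightarrow> real \<Rightarrow> real \<Rightarrow> real \<Rightarrow> real \<Rightarrow> real^2^2 \<Rightarrow> bool" where
  "steady_state_covariance A \<sigma>x \<sigma>y R \<epsilon> S \<longleftrightarrow>
     transpose S = S \<and> (\<forall>v. 0 \<le> v \<bullet> (S *v v)) \<and>
     A_eps A \<epsilon> ** S + S ** transpose (A_eps A \<epsilon>)
       - (1 / R) *\<^sub>R (S ** transpose H_obs ** H_obs ** S) + Q_eps \<sigma>x \<sigma>y \<epsilon> = 0"

definition kalman_gain :: "real \<Rightarrow> real^2^2 \<Rightarrow> real^1^2" where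
  "kalman_gain R S = (1 / R) *\<^sub>R (S ** transpose H_obs)"

text \<open>\<open>m\<close> is the pair of mean estimates of the slow and the fast variable.\<close>

definition true_filter_mean ::
  "'w measure \<Rightarrow> real^2^2 \<Rightarrow> real \<Rightarrow> real \<Rightarrow> real^2^2 \<Rightarrow>
   (real \<Rightarrow> 'w \<Rightarrow> real) \<Rightarrow> (real \<Rightarrow> 'w \<Rightarrow> real^2) \<Rightarrow> bool" where
  "true_filter_mean M A R \<epsilon> S z m \<longleftrightarrow>
     continuous_process M m \<and> integrable M (\<lambda>\<omega>. (norm (m 0 \<omega>))\<^sup>2) \<and>
     (AE \<omega> in M. \<forall>t\<ge>0.
        m t \<omega> = m 0 \<omega> + integral {0..t} (\<lambda>s. A_eps A \<epsilon> *v m s \<omega>)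
                + kalman_gain R S *v vec (z t \<omega> - z 0 \<omega> - integral {0..t} (\<lambda>s. m s \<omega> $ 1)))"

section \<open>The reduced filter and the Mean Stochastic Model\<close>

definition reduced_covariance :: "real \<Rightarrow> real \<Rightarrow> real \<Rightarrow> real \<Rightarrow> bool" where
  "reduced_covariance a \<sigma>X R s \<longleftrightarrow> 0 \<le> s \<and> - (s\<^sup>2 / R) + 2 * a * s + \<sigma>X\<^sup>2 = 0"

definition reduced_filter_mean ::
  "'w measure \<Rightarrow> real \<Rightarrow> real \<Rightarrow> real \<Rightarrow>
   (real \<Rightarrow> 'w \<Rightarrow> real) \<Rightarrow> (real \<Rightarrow> 'w \<Rightarrow> real) \<Rightarrow> bool" where
  "reduced_filter_mean M a R s z m \<longleftrightarrow>
     continuous_process M m \<and> integrable M (\<lambda>\<omega>. (m 0 \<omega>)\<^sup>2) \<and>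
     (AE \<omega> in M. \<forall>t\<ge>0.
        m t \<omega> = m 0 \<omega> + integral {0..t} (\<lambda>u. a * m u \<omega>)
                + s / R * (z t \<omega> - z 0 \<omega> - integral {0..t} (\<lambda>u. m u \<omega>)))"

text \<open>
  The left-hand sides are the equilibrium variance and the correlation time of
  \<open>dX = a X dt + \<sigma>X dW\<close>.
\<close>

definition msm_parameters ::
  "'w measure \<Rightarrow> (real \<Rightarrow> 'w \<Rightarrow> real) \<Rightarrow> real \<Rightarrow> real \<Rightarrow> bool" where
  "msm_parameters M x a \<sigma>X \<longleftrightarrow>
     - (\<sigma>X\<^sup>2 / (2 * a)) = equilibrium_variance M x \<and> - (1 / a) = correlation_time M x"

end

theory Submission
  imports Defs "HOL-Real_Asymp.Real_Asymp"
begin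

text \<open>
Both filters are linear systems driven by the same observations.  Since all noise coefficients are
constant, the signal and the two mean estimates form one linear system driven by three independent
Wiener processes, and every observable of it is a linear response
\<open>h 0 * B t + integral {0..t} (\<lambda>s. h' (t - s) * B s)\<close>, which is the stochastic integral of
\<open>s \<mapsto> h (t - s)\<close> after integration by parts, plus a decaying contribution of the initial values.
By the Ito isometry (\<open>noise_response_isometry\<close>) stationary second moments are therefore integrals
over the half line of products of impulse responses (\<open>second_moments_tendsto\<close>).

For the signal these integrals follow from energy identities for the damped oscillator
\<open>u'' + T u' + D u = f\<close> (\<open>second_order_ode_energy\<close>), where \<open>- T\<close> and \<open>D\<close> are the trace and the
determinant of the drift matrix.  This gives the equilibrium variance and the correlation time of
the slow variable in closed form (\<open>planar_signal_statistics\<close>), hence the parameters of the MSM.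
Writing \<open>at\<close> for \<open>a11 - a12 a21 / a22\<close>, their expansion is
\<open>a = at (1 - \<epsilon> a12 a21 / a22\<^sup>2) + O(\<epsilon>\<^sup>2)\<close>, with a matching expansion of the noise strength; and
with these two coefficients the slow entry of the true covariance solves the reduced
Riccati equation up to \<open>O(\<epsilon>\<^sup>2)\<close> (\<open>reduced_riccati_residual\<close>).  The reduced equation is
nondegenerate at its nonnegative root, so the two covariances differ by \<open>O(\<epsilon>\<^sup>2)\<close>.

The difference of the means is the observation increment \<open>dz\<close> convolved with the difference
\<open>g\<close> of the impulse responses of the two filters.  The kernel \<open>g\<close> solves a damped oscillator
equation whose coefficients, minus the trace and the determinant of the filter matrix, are both of
order \<open>1 / \<epsilon>\<close> (\<open>filter_error_kernel\<close>).  The two coefficients of the MSM and the \<open>O(\<epsilon>\<^sup>2)\<close> agreement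
of the gains make \<open>g 0\<close> of order \<open>\<epsilon>\<^sup>2\<close> and the initial slope and the forcing of order \<open>\<epsilon>\<close>.
The energy identities turn this into an \<open>L\<^sup>2\<close> norm of order \<open>\<epsilon>\<^sup>2\<close> for \<open>g\<close>, and, applied once more to
the response of the signal to \<open>g\<close>, into a stationary mean square difference of order \<open>\<epsilon>\<^sup>4\<close>
(\<open>filter_difference_limit\<close>, \<open>err_bound_bigo\<close>).
\<close>

section \<open>Exponentially decaying functions on the half line\<close>

text \<open>
Impulse responses of stable systems belong to this class.  Only nonnegative times matter, so
continuity, and below also differentiability, are one-sided at \<open>0\<close>.
\<close>

definition exp_decaying :: "(real \<Rightarrow> 'a::real_normed_vector) \<Rightarrow> bool" where
  "exp_decaying f \<longleftrightarrow> continuous_on {0..} f \<and>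
     (\<exists>C \<alpha>. \<alpha> > 0 \<and> (\<forall>t\<ge>0. norm (f t) \<le> C * exp (- \<alpha> * t)))"

lemma exp_decayingI:
  assumes "continuous_on {0..} f" "\<alpha> > 0" "\<And>t. t \<ge> 0 \<Longrightarrow> norm (f t) \<le> C * exp (- \<alpha> * t)"
  shows "exp_decaying f"
  using assms unfolding exp_decaying_def by blast

lemma exp_decaying_continuous: "exp_decaying f \<Longrightarrow> continuous_on {0..} f"
  by (simp add: exp_decaying_def)

lemma exp_decayingE:
  assumes "exp_decaying f"
  obtains C \<alpha> where "C \<ge> 0" "\<alpha> > 0" "\<And>t. t \<ge> 0 \<Longrightarrow> norm (f t) \<le> C * exp (- \<alpha> * t)"
proof -
  obtain C \<alpha> where *: "\<alpha> > 0" "\<And>t. t \<ge> 0 \<Longrightarrow> norm (f t) \<le> C * exp (- \<alpha> * t)"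
    using assms unfolding exp_decaying_def by blast
  have "0 \<le> norm (f 0)" by simp
  also have "\<dots> \<le> C" using *(2)[of 0] by simp
  finally show thesis using *(1) *(2) by (rule that)
qed

lemma exp_decaying_linear:
  assumes "bounded_linear L" "exp_decaying f"
  shows "exp_decaying (\<lambda>t. L (f t))"
proof -
  interpret bounded_linear L by fact
  obtain C \<alpha> where *: "C \<ge> 0" "\<alpha> > 0" "\<And>t. t \<ge> 0 \<Longrightarrow> norm (f t) \<le> C * exp (- \<alpha> * t)"
    using exp_decayingE[OF assms(2)] by blast
  obtain K where K: "K > 0" "\<And>x. norm (L x) \<le> norm x * K" using pos_bounded by blast
  show ?thesis
  proof (rule exp_decayingI[where C = "C * K" and \<alpha> = \<alpha>])
    show "continuous_on {0..} (\<lambda>t. L (f t))"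
      using assms(2) by (auto intro: continuous_on exp_decaying_continuous)
    fix t :: real assume "t \<ge> 0"
    have "norm (L (f t)) \<le> norm (f t) * K" by (rule K)
    also have "\<dots> \<le> (C * exp (- \<alpha> * t)) * K"
      using *(3)[OF \<open>t \<ge> 0\<close>] K(1) by (intro mult_right_mono) auto
    finally show "norm (L (f t)) \<le> C * K * exp (- \<alpha> * t)" by (simp add: mult_ac)
  qed fact
qed

lemma exp_decaying_cmult:
  fixes f :: "real \<Rightarrow> 'a::real_normed_algebra"
  shows "exp_decaying f \<Longrightarrow> exp_decaying (\<lambda>t. c * f t)"
  by (rule exp_decaying_linear[OF bounded_linear_mult_right])

lemma exp_decaying_minus: "exp_decaying f \<Longrightarrow> exp_decaying (\<lambda>t. - f t)"
  by (rule exp_decaying_linear[OF bounded_linear_minus[OF bounded_linear_ident]])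

lemma exp_decaying_zero: "exp_decaying (\<lambda>t. 0)"
  by (rule exp_decayingI[where C = 0 and \<alpha> = 1]) auto

lemma exp_decaying_exp:
  assumes "\<kappa> > 0"
  shows "exp_decaying (\<lambda>t. exp (- \<kappa> * t) :: real)"
  using assms by (intro exp_decayingI[where C = 1 and \<alpha> = \<kappa>]) (auto intro!: continuous_intros)

lemma exp_decaying_add:
  assumes "exp_decaying f" "exp_decaying g"
  shows "exp_decaying (\<lambda>t. f t + g t)"
proof -
  obtain C \<alpha> where f: "C \<ge> 0" "\<alpha> > 0" "\<And>t. t \<ge> 0 \<Longrightarrow> norm (f t) \<le> C * exp (- \<alpha> * t)"
    using exp_decayingE[OF assms(1)] by blast
  obtain D \<beta> where g: "D \<ge> 0" "\<beta> > 0" "\<And>t. t \<ge> 0 \<Longrightarrow> norm (g t) \<le> D * exp (- \<beta> * t)"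
    using exp_decayingE[OF assms(2)] by blast
  show ?thesis
  proof (rule exp_decayingI[where C = "C + D" and \<alpha> = "min \<alpha> \<beta>"])
    show "continuous_on {0..} (\<lambda>t. f t + g t)"
      by (intro continuous_on_add assms[THEN exp_decaying_continuous])
    show "min \<alpha> \<beta> > 0" using f g by simp
    fix t :: real assume t: "t \<ge> 0"
    have "norm (f t) \<le> C * exp (- min \<alpha> \<beta> * t)"
      using f(3)[OF t] by (rule order_trans) (use t f in \<open>auto intro!: mult_left_mono mult_right_mono\<close>)
    moreover have "norm (g t) \<le> D * exp (- min \<alpha> \<beta> * t)"
      using g(3)[OF t] by (rule order_trans) (use t g in \<open>auto intro!: mult_left_mono mult_right_mono\<close>)
    ultimately show "norm (f t + g t) \<le> (C + D) * exp (- min \<alpha> \<beta> * t)"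
      using norm_triangle_ineq[of "f t" "g t"] by (simp add: distrib_right)
  qed
qed

lemma exp_decaying_diff:
  assumes "exp_decaying f" "exp_decaying g"
  shows "exp_decaying (\<lambda>t. f t - g t)"
  using exp_decaying_add[OF assms(1) exp_decaying_minus[OF assms(2)]] by simp

lemma exp_decaying_mult:
  fixes f g :: "real \<Rightarrow> 'a::real_normed_algebra"
  assumes "exp_decaying f" "exp_decaying g"
  shows "exp_decaying (\<lambda>t. f t * g t)"
proof -
  obtain C \<alpha> where f: "C \<ge> 0" "\<alpha> > 0" "\<And>t. t \<ge> 0 \<Longrightarrow> norm (f t) \<le> C * exp (- \<alpha> * t)"
    using exp_decayingE[OF assms(1)] by blast
  obtain D \<beta> where g: "D \<ge> 0" "\<beta> > 0" "\<And>t. t \<ge> 0 \<Longrightarrow> norm (g t) \<le> D * exp (- \<beta> * t)"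
    using exp_decayingE[OF assms(2)] by blast
  show ?thesis
  proof (rule exp_decayingI[where C = "C * D" and \<alpha> = "\<alpha> + \<beta>"])
    show "continuous_on {0..} (\<lambda>t. f t * g t)"
      by (intro continuous_on_mult assms[THEN exp_decaying_continuous])
    show "\<alpha> + \<beta> > 0" using f g by simp
    fix t :: real assume t: "t \<ge> 0"
    have "norm (f t * g t) \<le> norm (f t) * norm (g t)" by (rule norm_mult_ineq)
    also have "\<dots> \<le> (C * exp (- \<alpha> * t)) * (D * exp (- \<beta> * t))"
      using f g t by (intro mult_mono) auto
    also have "\<dots> = C * D * exp (- (\<alpha> + \<beta>) * t)"
      by (simp add: exp_add[symmetric] algebra_simps flip: exp_add)
    finally show "norm (f t * g t) \<le> C * D * exp (- (\<alpha> + \<beta>) * t)" .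
  qed
qed

lemma exp_decaying_power2:
  fixes f :: "real \<Rightarrow> real"
  shows "exp_decaying f \<Longrightarrow> exp_decaying (\<lambda>t. (f t)\<^sup>2)"
  using exp_decaying_mult[of f f] by (simp add: power2_eq_square)

lemma exp_decaying_tendsto_0:
  assumes "exp_decaying f"
  shows "(f \<longlongrightarrow> 0) at_top"
proof -
  obtain C \<alpha> where f: "C \<ge> 0" "\<alpha> > 0" "\<And>t. t \<ge> 0 \<Longrightarrow> norm (f t) \<le> C * exp (- \<alpha> * t)"
    using exp_decayingE[OF assms(1)] by blast
  have "((\<lambda>t. C * exp (- \<alpha> * t)) \<longlongrightarrow> 0) at_top" using f(2) by real_asymp
  then show ?thesis
    by (rule Lim_null_comparison[rotated])
       (use f(3) in \<open>auto intro: eventually_mono[OF eventually_ge_at_top[of 0]]\<close>)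
qed

lemma exp_decaying_set_integrable:
  fixes f :: "real \<Rightarrow> real"
  assumes "exp_decaying f"
  shows "set_integrable lborel {0..} f"
proof -
  obtain C \<alpha> where f: "C \<ge> 0" "\<alpha> > 0" "\<And>t. t \<ge> 0 \<Longrightarrow> norm (f t) \<le> C * exp (- \<alpha> * t)"
    using exp_decayingE[OF assms(1)] by blast
  have "set_integrable lborel {0..} (\<lambda>t. C * exp (- \<alpha> * t))"
  proof -
    have "(\<lambda>t. exp (- \<alpha> * t)) absolutely_integrable_on {0..}"
      using integrable_on_exp_minus_to_infinity[OF f(2), of 0]
      by (intro nonnegative_absolutely_integrable_1) auto
    then have "set_integrable lborel {0..} (\<lambda>t. exp (- \<alpha> * t))"
      unfolding set_integrable_def by (subst (asm) integrable_completion) auto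
    then show ?thesis by (rule set_integrable_mult_right) 
  qed
  then show ?thesis
  proof (rule set_integrable_bound)
    show "set_borel_measurable lborel {0..} f"
      using borel_measurable_continuous_on_indicator[OF _ exp_decaying_continuous[OF assms]]
      unfolding set_borel_measurable_def by simp
    show "AE t in lborel. t \<in> {0..} \<longrightarrow> norm (f t) \<le> norm (C * exp (- \<alpha> * t))"
      using f by (auto intro!: AE_I2 order_trans[OF f(3)])
  qed
qed

abbreviation half_line_integral :: "(real \<Rightarrow> real) \<Rightarrow> real" where
  "half_line_integral f \<equiv> (LINT t:{0..}|lborel. f t)"

lemma integral_tendsto_half_line_integral:
  assumes "exp_decaying f"
  shows "((\<lambda>t. integral {0..t} f) \<longlongrightarrow> half_line_integral f) at_top"
proof -
  have "((\<lambda>t. LINT s:{0..t}|lborel. f s) \<longlongrightarrow> half_line_integral f) at_top"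
    by (rule tendsto_set_lebesgue_integral_at_top)
       (use exp_decaying_set_integrable[OF assms] in auto)
  moreover have "(LINT s:{0..t}|lborel. f s) = integral {0..t} f" for t
    by (rule set_borel_integral_eq_integral(2), rule set_integrable_subset[OF exp_decaying_set_integrable[OF assms]]) auto
  ultimately show ?thesis by simp
qed

text \<open>
All improper integrals below are evaluated by exhibiting a decaying primitive.
\<close>

lemma half_line_integral_deriv:
  fixes F :: "real \<Rightarrow> real"
  assumes "exp_decaying F" "exp_decaying f"
    and "\<And>t. t \<ge> 0 \<Longrightarrow> (F has_real_derivative f t) (at t within {0..})"
  shows "half_line_integral f = - F 0"
proof (rule tendsto_unique[OF trivial_limit_at_top_linorder])
  show "((\<lambda>t. integral {0..t} f) \<longlongrightarrow> half_line_integral f) at_top"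
    by (rule integral_tendsto_half_line_integral) fact
  have eq: "integral {0..t} f = F t - F 0" if "t \<ge> 0" for t
  proof (rule integral_unique, rule fundamental_theorem_of_calculus)
    fix x assume "x \<in> {0..t}"
    then show "(F has_vector_derivative f x) (at x within {0..t})"
      using assms(3)[of x] by (auto simp: has_real_derivative_iff_has_vector_derivative
        intro: has_vector_derivative_within_subset)
  qed fact
  have "((\<lambda>t. F t - F 0) \<longlongrightarrow> 0 - F 0) at_top"
    by (intro tendsto_intros exp_decaying_tendsto_0 assms)
  then show "((\<lambda>t. integral {0..t} f) \<longlongrightarrow> - F 0) at_top"
    by (rule Lim_transform_eventually[OF _ eventually_mono[OF eventually_ge_at_top[of 0]], THEN tendsto_eq_rhs])
       (use eq in auto)
qed

lemma half_line_integral_linear: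
  shows "exp_decaying f \<Longrightarrow> exp_decaying g \<Longrightarrow>
      half_line_integral (\<lambda>t. f t + g t) = half_line_integral f + half_line_integral g"
    and "exp_decaying f \<Longrightarrow> exp_decaying g \<Longrightarrow>
      half_line_integral (\<lambda>t. f t - g t) = half_line_integral f - half_line_integral g"
    and "half_line_integral (\<lambda>t. c * f t) = c * half_line_integral f"
  by (simp_all add: exp_decaying_set_integrable)

lemma half_line_integral_mono:
  assumes "exp_decaying f" "exp_decaying g" "\<And>t. t \<ge> 0 \<Longrightarrow> f t \<le> g t"
  shows "half_line_integral f \<le> half_line_integral g"
  using assms by (intro set_integral_mono exp_decaying_set_integrable) auto

lemma half_line_integral_power2_nonneg:
  shows "half_line_integral (\<lambda>t. (f t)\<^sup>2) \<ge> 0"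
  unfolding set_lebesgue_integral_def by (intro Bochner_Integration.integral_nonneg) auto

lemma at_within_atLeast_Icc: "0 \<le> t \<Longrightarrow> t < b \<Longrightarrow> at t within {0..b} = at t within {0..}" for t :: real
  by (rule at_within_nhd[where S = "{..<b}"]) auto

section \<open>Stable linear differential equations\<close>

text \<open>
Variation of constants.  The solution is complex because the roots of the characteristic
polynomial of a second order equation may be.
\<close>

lemma stable_first_order_ode:
  fixes f :: "real \<Rightarrow> complex"
  assumes "Re \<mu> < 0" "exp_decaying f"
  shows "\<exists>w. w 0 = w0 \<and> exp_decaying w \<and>
    (\<forall>t\<ge>0. (w has_vector_derivative (\<mu> * w t + f t)) (at t within {0..}))"
proof -
  define h where "h = (\<lambda>s::real. exp (- (\<mu> * of_real s)) * f s)"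
  define w where "w = (\<lambda>t::real. exp (\<mu> * of_real t) * (w0 + integral {0..t} h))"
  have cf: "continuous_on {0..} f" by (rule exp_decaying_continuous) fact
  have ch: "continuous_on {0..} h" unfolding h_def by (intro continuous_intros cf)
  have ch': "continuous_on {0..b} h" for b by (rule continuous_on_subset[OF ch]) auto
  have dint: "((\<lambda>u. integral {0..u} h) has_vector_derivative h t) (at t within {0..})" if "t \<ge> 0" for t
    using integral_has_vector_derivative[OF ch', of t "t + 1"] that
    by (simp add: at_within_atLeast_Icc)
  have dexp: "((\<lambda>t. exp (\<mu> * of_real t)) has_vector_derivative (\<mu> * exp (\<mu> * of_real t))) (at t within {0..})" for t :: real
  proof -
    have "((\<lambda>z. exp (\<mu> * z)) has_field_derivative (\<mu> * exp (\<mu> * of_real t))) (at (of_real t))"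
      by (auto intro!: derivative_eq_intros simp: mult.commute)
    from has_vector_derivative_real_field[OF this] show ?thesis
      by (rule has_vector_derivative_within_subset) auto
  qed
  have dw: "(w has_vector_derivative (\<mu> * w t + f t)) (at t within {0..})" if t: "t \<ge> 0" for t
  proof -
    have "(w has_vector_derivative
        (exp (\<mu> * of_real t) * h t + \<mu> * exp (\<mu> * of_real t) * (w0 + integral {0..t} h))) (at t within {0..})"
      unfolding w_def
      by (rule has_vector_derivative_mult[OF dexp])
         (use has_vector_derivative_add[OF has_vector_derivative_const dint[OF t], of w0] in simp)
    moreover have "exp (\<mu> * of_real t) * h t = f t"
      unfolding h_def by (simp flip: exp_add mult.assoc)
    ultimately show ?thesis unfolding w_def by (simp add: algebra_simps)
  qed
  obtain C \<alpha> where f: "C \<ge> 0" "\<alpha> > 0" "\<And>t. t \<ge> 0 \<Longrightarrow> norm (f t) \<le> C * exp (- \<alpha> * t)"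
    using exp_decayingE[OF assms(2)] by blast
  (* The solution inherits any rate strictly below both the damping and the rate of the forcing. *)
  define \<beta> where "\<beta> = - Re \<mu>"
  define \<gamma> where "\<gamma> = min \<alpha> \<beta> / 2"
  have \<beta>: "\<beta> > 0" "\<gamma> > 0" "\<gamma> \<le> \<alpha>" "\<gamma> < \<beta>" using assms(1) f unfolding \<beta>_def \<gamma>_def by auto
  have bound: "norm (w t) \<le> (norm w0 + C / (\<beta> - \<gamma>)) * exp (- \<gamma> * t)" if t: "t \<ge> 0" for t
  proof -
    have ne: "norm (exp (\<mu> * of_real s)) = exp (- \<beta> * s)" for s :: real
      by (simp add: \<beta>_def)
    have hs: "norm (h s) \<le> C * exp ((\<beta> - \<gamma>) * s)" if "s \<in> {0..t}" for s
    proof -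
      have "norm (h s) = exp (\<beta> * s) * norm (f s)"
        by (simp add: h_def norm_mult \<beta>_def)
      also have "\<dots> \<le> exp (\<beta> * s) * (C * exp (- \<gamma> * s))"
        using f that \<beta> by (intro mult_left_mono order_trans[OF f(3)] mult_right_mono) (auto intro!: mult_left_mono mult_right_mono)
      also have "\<dots> = C * exp ((\<beta> - \<gamma>) * s)" by (simp add: algebra_simps flip: exp_add)
      finally show ?thesis .
    qed
    have hi: "((\<lambda>s. C * exp ((\<beta> - \<gamma>) * s)) has_integral
        (C / (\<beta> - \<gamma>) * exp ((\<beta> - \<gamma>) * t) - C / (\<beta> - \<gamma>) * exp ((\<beta> - \<gamma>) * 0))) {0..t}"
      using \<beta> t by (intro fundamental_theorem_of_calculus)
        (auto intro!: derivative_eq_intros simp flip: has_real_derivative_iff_has_vector_derivative)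
    have "norm (integral {0..t} h) \<le> integral {0..t} (\<lambda>s. C * exp ((\<beta> - \<gamma>) * s))"
      using hs hi by (intro integral_norm_bound_integral integrable_continuous_interval ch')
        (auto simp: has_integral_iff intro!: continuous_intros)
    also have "\<dots> \<le> C / (\<beta> - \<gamma>) * exp ((\<beta> - \<gamma>) * t)"
      using integral_unique[OF hi] f(1) \<beta> by simp
    finally have "norm (w t) \<le> exp (- \<beta> * t) * (norm w0 + C / (\<beta> - \<gamma>) * exp ((\<beta> - \<gamma>) * t))"
      unfolding w_def norm_mult ne
      by (intro mult_left_mono order_trans[OF norm_triangle_ineq]) auto
    also have "\<dots> = exp (- \<beta> * t) * norm w0 + C / (\<beta> - \<gamma>) * exp (- \<gamma> * t)"
      by (simp add: algebra_simps flip: exp_add)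
    also have "\<dots> \<le> exp (- \<gamma> * t) * norm w0 + C / (\<beta> - \<gamma>) * exp (- \<gamma> * t)"
      using \<beta> t by (intro add_mono mult_right_mono) (auto intro!: mult_right_mono)
    finally show ?thesis by (simp add: algebra_simps)
  qed
  have "continuous_on {0..} w"
    using dw by (intro continuous_on_vector_derivative) auto
  then have "exp_decaying w" using \<beta>(2) bound by (rule exp_decayingI)
  moreover have "w 0 = w0" by (simp add: w_def)
  ultimately show ?thesis using dw by blast
qed

text \<open>
\<open>u'' + T u' + D u = f\<close> with \<open>v = u'\<close>, among decaying functions.
\<close>

definition second_order_ode ::
  "real \<Rightarrow> real \<Rightarrow> (real \<Rightarrow> real) \<Rightarrow> (real \<Rightarrow> real) \<Rightarrow> (real \<Rightarrow> real) \<Rightarrow> bool" where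
  "second_order_ode T D f u v \<longleftrightarrow> exp_decaying f \<and> exp_decaying u \<and> exp_decaying v \<and>
     (\<forall>t\<ge>0. (u has_real_derivative v t) (at t within {0..})) \<and>
     (\<forall>t\<ge>0. (v has_real_derivative (- T * v t - D * u t + f t)) (at t within {0..}))"

lemma stable_quadratic_roots:
  fixes T D :: real
  assumes "T > 0" "D > 0"
  obtains \<mu>1 \<mu>2 :: complex where "Re \<mu>1 < 0" "Re \<mu>2 < 0" "\<mu>1 + \<mu>2 = - of_real T" "\<mu>1 * \<mu>2 = of_real D"
proof (cases "T\<^sup>2 - 4 * D \<ge> 0")
  case True
  define r where "r = sqrt (T\<^sup>2 - 4 * D)"
  have r: "r\<^sup>2 = T\<^sup>2 - 4 * D" "r \<ge> 0" using True by (auto simp: r_def)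
  have "r\<^sup>2 < T\<^sup>2" using r(1) assms(2) by linarith
  then have "r < T" using power2_less_imp_less[of r T] assms(1) by linarith
  have "(- T + r) / 2 * ((- T - r) / 2) = D" using r(1) by (simp add: algebra_simps power2_eq_square)
  then have "complex_of_real ((- T + r) / 2) * complex_of_real ((- T - r) / 2) = complex_of_real D"
    by (metis of_real_mult)
  moreover have "complex_of_real ((- T + r) / 2) + complex_of_real ((- T - r) / 2) = - complex_of_real T"
    by (simp add: complex_eq_iff) argo
  ultimately show thesis
    using that[of "of_real ((- T + r) / 2)" "of_real ((- T - r) / 2)"] \<open>r < T\<close> r(2) assms(1) by simp
next
  case False
  define r where "r = sqrt (4 * D - T\<^sup>2)"
  have r: "r * r = 4 * D - T * T" using False by (simp add: r_def power2_eq_square)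
  have "Complex (- T / 2) (r / 2) * Complex (- T / 2) (- r / 2) = of_real D"
    using r by (simp add: complex_eq_iff field_simps)
  moreover have "Complex (- T / 2) (r / 2) + Complex (- T / 2) (- r / 2) = - of_real T"
    by (simp add: complex_eq_iff)
  ultimately show thesis
    using that[of "Complex (- T / 2) (r / 2)" "Complex (- T / 2) (- r / 2)"] assms(1) by simp
qed

text \<open>
A cascade of two complex first order equations, one for each characteristic root; its real part
is the solution sought.  In contrast to explicit formulas this needs no distinction between real,
double and complex roots, nor between resonant and nonresonant forcing.
\<close>

lemma second_order_ode_exists:
  assumes "T > 0" "D > 0" "exp_decaying f"
  shows "\<exists>u v. u 0 = u0 \<and> v 0 = v0 \<and> second_order_ode T D f u v"
proof -
  obtain \<mu>1 \<mu>2 :: complex where l: "Re \<mu>1 < 0" "Re \<mu>2 < 0" "\<mu>1 + \<mu>2 = - of_real T" "\<mu>1 * \<mu>2 = of_real D"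
    using stable_quadratic_roots[OF assms(1,2)] .
  have "exp_decaying (\<lambda>t. complex_of_real (f t))"
    by (rule exp_decaying_linear[OF bounded_linear_of_real assms(3)])
  from stable_first_order_ode[OF l(1) this, of "of_real v0 - \<mu>2 * of_real u0"]
  obtain w where w: "w 0 = of_real v0 - \<mu>2 * of_real u0" "exp_decaying w"
    "\<And>t. t \<ge> 0 \<Longrightarrow> (w has_vector_derivative (\<mu>1 * w t + of_real (f t))) (at t within {0..})" by blast
  from stable_first_order_ode[OF l(2) w(2), of "of_real u0"]
  obtain z where z: "z 0 = of_real u0" "exp_decaying z"
    "\<And>t. t \<ge> 0 \<Longrightarrow> (z has_vector_derivative (\<mu>2 * z t + w t)) (at t within {0..})" by blast
  define u where "u = (\<lambda>t. Re (z t))"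
  define v where "v = (\<lambda>t. Re (\<mu>2 * z t + w t))"
  have "exp_decaying u" unfolding u_def by (rule exp_decaying_linear[OF bounded_linear_Re z(2)])
  moreover have "exp_decaying v" unfolding v_def
    by (intro exp_decaying_linear[OF bounded_linear_Re] exp_decaying_add exp_decaying_cmult z w)
  moreover have "(u has_real_derivative v t) (at t within {0..})" if "t \<ge> 0" for t
    unfolding u_def v_def has_real_derivative_iff_has_vector_derivative
    by (rule bounded_linear.has_vector_derivative[OF bounded_linear_Re z(3)[OF that]])
  moreover have "(v has_real_derivative (- T * v t - D * u t + f t)) (at t within {0..})" if "t \<ge> 0" for t
  proof -
    have "((\<lambda>t. \<mu>2 * z t + w t) has_vector_derivative
      (\<mu>2 * (\<mu>2 * z t + w t) + (\<mu>1 * w t + of_real (f t)))) (at t within {0..})"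
      by (intro has_vector_derivative_add has_vector_derivative_mult_right z w that)
    from bounded_linear.has_vector_derivative[OF bounded_linear_Re this]
    have "(v has_real_derivative Re (\<mu>2 * (\<mu>2 * z t + w t) + (\<mu>1 * w t + of_real (f t)))) (at t within {0..})"
      unfolding v_def has_real_derivative_iff_has_vector_derivative .
    also have "\<mu>2 * (\<mu>2 * z t + w t) + (\<mu>1 * w t + of_real (f t))
       = (\<mu>1 + \<mu>2) * (\<mu>2 * z t + w t) - (\<mu>1 * \<mu>2) * z t + of_real (f t)"
      by (simp add: algebra_simps)
    also have "Re \<dots> = - T * v t - D * u t + f t"
      unfolding l by (simp add: u_def v_def)
    finally show ?thesis .
  qed
  ultimately have "second_order_ode T D f u v"
    unfolding second_order_ode_def using assms(3) by blast
  moreover have "u 0 = u0" "v 0 = v0" by (simp_all add: u_def v_def w(1) z(1))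
  ultimately show ?thesis by blast
qed

lemmas exp_decaying_intros = exp_decaying_add exp_decaying_diff exp_decaying_cmult exp_decaying_mult
  exp_decaying_minus exp_decaying_power2 exp_decaying_zero

text \<open>
Multiply the equation by \<open>u'\<close> and by \<open>u\<close> and integrate: products with a derivative of \<open>u\<close> or of
\<open>u'\<close> are total derivatives up to the other energy.
\<close>

lemma second_order_ode_energy:
  assumes "second_order_ode T D f u v"
  shows "half_line_integral (\<lambda>t. u t * v t) = - (u 0)\<^sup>2 / 2"
    and "T * half_line_integral (\<lambda>t. (v t)\<^sup>2)
      = (v 0)\<^sup>2 / 2 + D * (u 0)\<^sup>2 / 2 + half_line_integral (\<lambda>t. f t * v t)"
    and "D * half_line_integral (\<lambda>t. (u t)\<^sup>2)
      = u 0 * v 0 + half_line_integral (\<lambda>t. (v t)\<^sup>2) + T * (u 0)\<^sup>2 / 2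
        + half_line_integral (\<lambda>t. f t * u t)"
proof -
  have e: "exp_decaying f" "exp_decaying u" "exp_decaying v"
    and du: "\<And>t. t \<ge> 0 \<Longrightarrow> (u has_real_derivative v t) (at t within {0..})"
    and dv: "\<And>t. t \<ge> 0 \<Longrightarrow> (v has_real_derivative (- T * v t - D * u t + f t)) (at t within {0..})"
    using assms unfolding second_order_ode_def by blast+
  note i = exp_decaying_intros e
  have "half_line_integral (\<lambda>t. u t * v t) = - (1 / 2 * (u 0)\<^sup>2)"
    by (rule half_line_integral_deriv[of "\<lambda>t. 1 / 2 * (u t)\<^sup>2"])
       (intro i, intro i, auto intro!: derivative_eq_intros du)
  then show 1: "half_line_integral (\<lambda>t. u t * v t) = - (u 0)\<^sup>2 / 2" by simp
  have "half_line_integral (\<lambda>t. f t * v t - T * (v t)\<^sup>2 - D * (u t * v t)) = - (1 / 2 * (v 0)\<^sup>2)"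
    by (rule half_line_integral_deriv[of "\<lambda>t. 1 / 2 * (v t)\<^sup>2"])
       (intro i, intro i, auto intro!: derivative_eq_intros dv simp: power2_eq_square field_simps)
  moreover have "half_line_integral (\<lambda>t. f t * v t - T * (v t)\<^sup>2 - D * (u t * v t))
     = half_line_integral (\<lambda>t. f t * v t) - T * half_line_integral (\<lambda>t. (v t)\<^sup>2)
       - D * half_line_integral (\<lambda>t. u t * v t)"
    by (simp add: half_line_integral_linear i)
  ultimately show "T * half_line_integral (\<lambda>t. (v t)\<^sup>2)
      = (v 0)\<^sup>2 / 2 + D * (u 0)\<^sup>2 / 2 + half_line_integral (\<lambda>t. f t * v t)"
    unfolding 1 by (simp add: algebra_simps)
  have "half_line_integral (\<lambda>t. (v t)\<^sup>2 - T * (u t * v t) - D * (u t)\<^sup>2 + f t * u t) = - (u 0 * v 0)"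
    by (rule half_line_integral_deriv[of "\<lambda>t. u t * v t"])
       (intro i, intro i, auto intro!: derivative_eq_intros du dv simp: power2_eq_square field_simps)
  moreover have "half_line_integral (\<lambda>t. (v t)\<^sup>2 - T * (u t * v t) - D * (u t)\<^sup>2 + f t * u t)
     = half_line_integral (\<lambda>t. (v t)\<^sup>2) - T * half_line_integral (\<lambda>t. u t * v t)
       - D * half_line_integral (\<lambda>t. (u t)\<^sup>2) + half_line_integral (\<lambda>t. f t * u t)"
    by (simp add: half_line_integral_linear i)
  ultimately show "D * half_line_integral (\<lambda>t. (u t)\<^sup>2)
      = u 0 * v 0 + half_line_integral (\<lambda>t. (v t)\<^sup>2) + T * (u 0)\<^sup>2 / 2
        + half_line_integral (\<lambda>t. f t * u t)"
    unfolding 1 by (simp add: algebra_simps)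
qed

section \<open>Solutions of linear systems along single paths\<close>

lemma integral_eq_diff_of_deriv:
  fixes F f :: "real \<Rightarrow> real"
  assumes "t \<ge> 0" "\<And>s. s \<in> {0..t} \<Longrightarrow> (F has_real_derivative f s) (at s within {0..t})"
  shows "integral {0..t} f = F t - F 0"
  by (rule integral_unique, rule fundamental_theorem_of_calculus)
     (use assms in \<open>auto simp flip: has_real_derivative_iff_has_vector_derivative\<close>)

lemma has_derivative_reflect:
  fixes h h' :: "real \<Rightarrow> real"
  assumes dh: "\<And>t. t \<ge> 0 \<Longrightarrow> (h has_real_derivative h' t) (at t within {0..})" and s: "s \<in> {0..t}"
  shows "((\<lambda>s. h (t - s)) has_real_derivative - h' (t - s)) (at s within {0..t})"
proof -
  have "(h has_real_derivative h' (t - s)) (at (t - s) within (\<lambda>s. t - s) ` {0..t})"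
    using dh[of "t - s"] s by (auto intro: DERIV_subset)
  moreover have "((\<lambda>s. t - s) has_real_derivative -1) (at s within {0..t})"
    by (auto intro!: derivative_eq_intros)
  ultimately show ?thesis
    using DERIV_image_chain[of h "h' (t - s)" "\<lambda>s. t - s" s "{0..t}" "-1"] by (simp add: o_def)
qed

lemma continuous_on_reflect:
  fixes h :: "real \<Rightarrow> 'a::topological_space"
  assumes "continuous_on {0..} h" "u \<le> t"
  shows "continuous_on {0..u} (\<lambda>s. h (t - s))"
  by (rule continuous_on_compose2[OF assms(1)]) (use assms(2) in \<open>auto intro!: continuous_intros\<close>)

text \<open>
The stochastic integral of \<open>s \<mapsto> h (t - s)\<close> against a path \<open>b\<close> with \<open>b 0 = 0\<close>, in the form that
integration by parts gives it; \<open>h'\<close> is the derivative of \<open>h\<close>.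
\<close>

definition noise_response ::
  "(real \<Rightarrow> real) \<Rightarrow> (real \<Rightarrow> real) \<Rightarrow> (real \<Rightarrow> real) \<Rightarrow> real \<Rightarrow> real" where
  "noise_response h h' b t = h 0 * b t + integral {0..t} (\<lambda>s. h' (t - s) * b s)"

text \<open>
Subtracting the noise from \<open>Y\<close> leaves a differentiable path \<open>U\<close> with \<open>U' = F Y\<close>.  Since
\<open>\<phi>' = \<phi> F\<close>, the derivative of \<open>\<phi> (t - s) U s\<close> with respect to \<open>s\<close> contains the noise only, and
integrating it gives the representation.
\<close>

lemma linear_system_solution:
  fixes Y \<phi> \<phi>' :: "nat \<Rightarrow> real \<Rightarrow> real" and F G :: "nat \<Rightarrow> nat \<Rightarrow> real" and b :: "nat \<Rightarrow> real \<Rightarrow> real"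
  assumes t: "t \<ge> 0"
    and cY: "\<And>k. k < n \<Longrightarrow> continuous_on {0..} (Y k)"
    and cb: "\<And>i. i < m \<Longrightarrow> continuous_on {0..} (b i)"
    and Y: "\<And>k t. k < n \<Longrightarrow> t \<ge> 0 \<Longrightarrow>
      Y k t = Y k 0 + integral {0..t} (\<lambda>s. \<Sum>j<n. F k j * Y j s) + (\<Sum>i<m. G k i * b i t)"
    and d\<phi>: "\<And>k t. k < n \<Longrightarrow> t \<ge> 0 \<Longrightarrow> (\<phi> k has_real_derivative \<phi>' k t) (at t within {0..})"
    and \<phi>': "\<And>j t. j < n \<Longrightarrow> t \<ge> 0 \<Longrightarrow> \<phi>' j t = (\<Sum>k<n. \<phi> k t * F k j)"
    and c\<phi>': "\<And>k. k < n \<Longrightarrow> continuous_on {0..} (\<phi>' k)"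
  shows "(\<Sum>k<n. \<phi> k 0 * Y k t) = (\<Sum>k<n. \<phi> k t * Y k 0)
     + (\<Sum>i<m. noise_response (\<lambda>t. \<Sum>k<n. \<phi> k t * G k i) (\<lambda>t. \<Sum>k<n. \<phi>' k t * G k i) (b i) t)"
proof -
  define U where "U = (\<lambda>k s. Y k s - (\<Sum>i<m. G k i * b i s))"
  define f where "f = (\<lambda>k s. \<Sum>j<n. F k j * Y j s)"
  have cf: "continuous_on {0..} (f k)" for k
    unfolding f_def by (intro continuous_intros cY) auto
  have U: "U k s = Y k 0 + integral {0..s} (f k)" if "k < n" "s \<ge> 0" for k s
    using Y[OF that] by (simp add: U_def f_def)
  have dU: "(U k has_real_derivative f k s) (at s within {0..t})" if k: "k < n" and s: "s \<in> {0..t}" for k s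
  proof -
    have "((\<lambda>s. Y k 0 + integral {0..s} (f k)) has_real_derivative 0 + f k s) (at s within {0..t})"
      unfolding has_real_derivative_iff_has_vector_derivative
      by (intro has_vector_derivative_add has_vector_derivative_const
           integral_has_vector_derivative continuous_on_subset[OF cf] s) auto
    then have "((\<lambda>s. Y k 0 + integral {0..s} (f k)) has_real_derivative f k s) (at s within {0..t})" by simp
    then show ?thesis
      by (rule has_field_derivative_transform_within[OF _ zero_less_one])
         (use U[OF k] s in auto)
  qed
  define W where "W = (\<lambda>s. \<Sum>k<n. \<phi> k (t - s) * U k s)"
  have dW: "(W has_real_derivative (\<Sum>k<n. \<phi>' k (t - s) * (\<Sum>i<m. G k i * b i s))) (at s within {0..t})"
    if s: "s \<in> {0..t}" for s
  proof -
    have "(W has_real_derivative (\<Sum>k<n. - \<phi>' k (t - s) * U k s + f k s * \<phi> k (t - s))) (at s within {0..t})"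
      unfolding W_def
      by (intro DERIV_sum DERIV_mult dU s has_derivative_reflect[OF d\<phi>]) auto
    also have "(\<Sum>k<n. - \<phi>' k (t - s) * U k s + f k s * \<phi> k (t - s))
       = (\<Sum>k<n. \<phi> k (t - s) * f k s) - (\<Sum>k<n. \<phi>' k (t - s) * U k s)"
      by (simp add: sum_subtractf mult.commute)
    also have "(\<Sum>k<n. \<phi> k (t - s) * f k s) = (\<Sum>j<n. (\<Sum>k<n. \<phi> k (t - s) * F k j) * Y j s)"
      unfolding f_def sum_distrib_left sum_distrib_right
      by (subst sum.swap) (simp add: mult_ac)
    also have "\<dots> = (\<Sum>j<n. \<phi>' j (t - s) * Y j s)"
      using s by (intro sum.cong refl) (simp add: \<phi>')
    also have "\<dots> - (\<Sum>k<n. \<phi>' k (t - s) * U k s) = (\<Sum>k<n. \<phi>' k (t - s) * (\<Sum>i<m. G k i * b i s))"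
      unfolding sum_subtractf[symmetric] by (intro sum.cong refl) (simp add: U_def algebra_simps)
    finally show ?thesis .
  qed
  have "W t - W 0 = integral {0..t} (\<lambda>s. \<Sum>k<n. \<phi>' k (t - s) * (\<Sum>i<m. G k i * b i s))"
    using integral_eq_diff_of_deriv[OF t dW] by simp
  also have "\<dots> = integral {0..t} (\<lambda>s. \<Sum>i<m. (\<Sum>k<n. \<phi>' k (t - s) * G k i) * b i s)"
    unfolding sum_distrib_left sum_distrib_right
    by (subst sum.swap) (simp add: mult_ac)
  also have "\<dots> = (\<Sum>i<m. integral {0..t} (\<lambda>s. (\<Sum>k<n. \<phi>' k (t - s) * G k i) * b i s))"
    by (intro integral_sum integrable_continuous_interval continuous_intros
          continuous_on_reflect[OF c\<phi>'] continuous_on_subset[OF cb]) auto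
  finally have 1: "W t - W 0 = (\<Sum>i<m. integral {0..t} (\<lambda>s. (\<Sum>k<n. \<phi>' k (t - s) * G k i) * b i s))" .
  have 2: "(\<Sum>k<n. \<phi> k 0 * Y k s) = W' + (\<Sum>i<m. (\<Sum>k<n. \<phi> k 0 * G k i) * b i s)"
    if "W' = (\<Sum>k<n. \<phi> k 0 * U k s)" for s W'
    unfolding that U_def sum_distrib_left sum_distrib_right
    by (subst sum.swap) (simp add: algebra_simps sum_distrib_left sum_subtractf)
  have 3: "W 0 = (\<Sum>k<n. \<phi> k t * Y k 0)" unfolding W_def using U[of _ 0] by simp
  show ?thesis
    using 2[of "W t" t] 1 unfolding 3 noise_response_def by (simp add: W_def sum.distrib)
qed

section \<open>Square integrable random variables and time integrals\<close>

definition square_integrable :: "'a measure \<Rightarrow> ('a \<Rightarrow> real) \<Rightarrow> bool" where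
  "square_integrable M f \<longleftrightarrow> f \<in> borel_measurable M \<and> integrable M (\<lambda>x. (f x)\<^sup>2)"

lemma square_integrable_measurable: "square_integrable M f \<Longrightarrow> f \<in> borel_measurable M"
  by (simp add: square_integrable_def)

lemma square_integrable_power2: "square_integrable M f \<Longrightarrow> integrable M (\<lambda>x. (f x)\<^sup>2)"
  by (simp add: square_integrable_def)

lemma abs_mult_le_sum_squares: "\<bar>a * b\<bar> \<le> a\<^sup>2 + b\<^sup>2" for a b :: real
proof -
  have "2 * (\<bar>a\<bar> * \<bar>b\<bar>) \<le> a\<^sup>2 + b\<^sup>2" using sum_squares_bound[of "\<bar>a\<bar>" "\<bar>b\<bar>"] by simp
  moreover have "0 \<le> \<bar>a\<bar> * \<bar>b\<bar>" by simp
  ultimately show ?thesis unfolding abs_mult by linarith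
qed

lemma square_integrable_integrable_mult:
  assumes "square_integrable M f" "square_integrable M g"
  shows "integrable M (\<lambda>x. f x * g x)"
proof (rule Bochner_Integration.integrable_bound)
  show "integrable M (\<lambda>x. (f x)\<^sup>2 + (g x)\<^sup>2)"
    using assms by (auto simp: square_integrable_def)
  show "(\<lambda>x. f x * g x) \<in> borel_measurable M"
    using assms by (auto simp: square_integrable_def)
  show "AE x in M. norm (f x * g x) \<le> norm ((f x)\<^sup>2 + (g x)\<^sup>2)"
    using abs_mult_le_sum_squares by simp
qed

lemma square_integrable_add:
  assumes "square_integrable M f" "square_integrable M g"
  shows "square_integrable M (\<lambda>x. f x + g x)"
  using assms square_integrable_integrable_mult[OF assms]
  by (auto simp: square_integrable_def power2_sum mult.assoc)

lemma square_integrable_cmult: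
  "square_integrable M f \<Longrightarrow> square_integrable M (\<lambda>x. c * f x)"
  by (auto simp: square_integrable_def power_mult_distrib)

lemma square_integrable_diff:
  assumes "square_integrable M f" "square_integrable M g"
  shows "square_integrable M (\<lambda>x. f x - g x)"
  using square_integrable_add[OF assms(1) square_integrable_cmult[OF assms(2), of "-1"]] by simp

lemma square_integrable_zero: "square_integrable M (\<lambda>x. 0)"
  by (simp add: square_integrable_def)

lemma square_integrable_sum:
  "(\<And>i. i \<in> I \<Longrightarrow> square_integrable M (f i)) \<Longrightarrow> square_integrable M (\<lambda>x. \<Sum>i\<in>I. f i x)"
  by (induction I rule: infinite_finite_induct) (auto intro: square_integrable_add square_integrable_zero)

lemma square_integrable_cong_AE:
  assumes "square_integrable M f" "AE x in M. g x = f x" "g \<in> borel_measurable M"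
  shows "square_integrable M g"
proof -
  have "integrable M (\<lambda>x. (g x)\<^sup>2) \<longleftrightarrow> integrable M (\<lambda>x. (f x)\<^sup>2)"
    using assms by (intro integrable_cong_AE) (auto simp: square_integrable_def)
  then show ?thesis using assms by (simp add: square_integrable_def)
qed

text \<open>
The square integral of \<open>f + r g\<close> is a nonnegative quadratic polynomial in \<open>r\<close>.
\<close>

lemma Cauchy_Schwarz_integral:
  assumes "square_integrable M f" "square_integrable M g"
  shows "(\<integral>x. f x * g x \<partial>M)\<^sup>2 \<le> (\<integral>x. (f x)\<^sup>2 \<partial>M) * (\<integral>x. (g x)\<^sup>2 \<partial>M)"
proof -
  define a b c where "a = (\<integral>x. (f x)\<^sup>2 \<partial>M)" and "b = (\<integral>x. f x * g x \<partial>M)" and "c = (\<integral>x. (g x)\<^sup>2 \<partial>M)"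
  note i = square_integrable_power2[OF assms(1)] square_integrable_power2[OF assms(2)]
    square_integrable_integrable_mult[OF assms]
  have q: "0 \<le> a + 2 * r * b + r\<^sup>2 * c" for r
  proof -
    have "0 \<le> (\<integral>x. (f x + r * g x)\<^sup>2 \<partial>M)" by simp
    also have "(\<integral>x. (f x + r * g x)\<^sup>2 \<partial>M) = (\<integral>x. (f x)\<^sup>2 + 2 * r * (f x * g x) + r\<^sup>2 * (g x)\<^sup>2 \<partial>M)"
      by (intro Bochner_Integration.integral_cong) (auto simp: power2_eq_square algebra_simps)
    also have "\<dots> = a + 2 * r * b + r\<^sup>2 * c"
      using i by (simp add: a_def b_def c_def)
    finally show ?thesis .
  qed
  have "c \<ge> 0" by (simp add: c_def)
  have "b\<^sup>2 \<le> a * c"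
  proof (cases "c = 0")
    case True
    have "b = 0"
    proof (rule ccontr)
      assume "b \<noteq> 0"
      then show False using q[of "- (a + 1) / (2 * b)"] True by (simp add: field_simps)
    qed
    then show ?thesis using True by simp
  next
    case False
    then have "c > 0" using \<open>c \<ge> 0\<close> by simp
    have "a + 2 * (- b / c) * b + (- b / c)\<^sup>2 * c = a - b\<^sup>2 / c"
      using False by (simp add: field_simps power2_eq_square)
    then have "b\<^sup>2 / c \<le> a" using q[of "- b / c"] by simp
    then show ?thesis using \<open>c > 0\<close> by (simp add: field_simps)
  qed
  then show ?thesis by (simp add: a_def b_def c_def)
qed

text \<open>
Approximate the time argument from below by multiples of \<open>1 / (n + 1)\<close>: the approximations are
countable combinations of measurable functions, and continuity of the paths gives convergence.
\<close>

lemma continuous_process_jointly_measurable: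
  fixes X :: "real \<Rightarrow> 'a \<Rightarrow> real"
  assumes "\<And>s. X s \<in> borel_measurable M" "\<And>\<omega>. continuous_on UNIV (\<lambda>s. X s \<omega>)"
  shows "(\<lambda>(s, \<omega>). X s \<omega>) \<in> borel_measurable (lborel \<Otimes>\<^sub>M M)"
proof -
  define d where "d = (\<lambda>(n::nat) (s::real). real_of_int \<lfloor>real (Suc n) * s\<rfloor> / real (Suc n))"
  have dlim: "(\<lambda>n. d n s) \<longlonglongrightarrow> s" for s
    unfolding d_def by real_asymp
  show ?thesis
  proof (rule borel_measurable_LIMSEQ_real)
    fix p :: "real \<times> 'a"
    obtain s \<omega> where p: "p = (s, \<omega>)" by (cases p)
    have "isCont (\<lambda>s. X s \<omega>) s"
      using assms(2)[of \<omega>] continuous_on_eq_continuous_at[OF open_UNIV] by auto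
    from isCont_tendsto_compose[OF this dlim]
    show "(\<lambda>n. case p of (s, \<omega>) \<Rightarrow> X (d n s) \<omega>) \<longlonglongrightarrow> (case p of (s, \<omega>) \<Rightarrow> X s \<omega>)"
      unfolding p by simp
  next
    fix n
    have "(\<lambda>p. X (real_of_int \<lfloor>real (Suc n) * fst p\<rfloor> / real (Suc n)) (snd p))
      \<in> borel_measurable (lborel \<Otimes>\<^sub>M M)"
    proof (rule measurable_compose_countable[where f = "\<lambda>i p. X (real_of_int i / real (Suc n)) (snd p)"
          and g = "\<lambda>p. \<lfloor>real (Suc n) * fst p\<rfloor>"])
      show "(\<lambda>p. X (real_of_int i / real (Suc n)) (snd p)) \<in> borel_measurable (lborel \<Otimes>\<^sub>M M)" for i
        using assms(1) by (rule measurable_compose[OF measurable_snd])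
      show "(\<lambda>p. \<lfloor>real (Suc n) * fst p\<rfloor>) \<in> (lborel \<Otimes>\<^sub>M M) \<rightarrow>\<^sub>M count_space UNIV"
        by measurable
    qed
    then show "(\<lambda>p. case p of (s, \<omega>) \<Rightarrow> X (d n s) \<omega>) \<in> borel_measurable (lborel \<Otimes>\<^sub>M M)"
      by (simp add: d_def case_prod_beta')
  qed
qed

context prob_space
begin

text \<open>
Square integrability of the time integral is the Cauchy-Schwarz inequality in time; the second
claim is Fubini's theorem, applicable because the second moments of \<open>X\<close> are bounded on the
interval of integration.
\<close>

lemma
  fixes X :: "real \<Rightarrow> 'a \<Rightarrow> real"
  assumes t: "t \<ge> 0"
    and Xsq: "\<And>s. s \<ge> 0 \<Longrightarrow> square_integrable M (X s)"
    and Xc: "\<And>\<omega>. continuous_on {0..} (\<lambda>s. X s \<omega>)"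
    and XC: "\<And>s. 0 \<le> s \<Longrightarrow> s \<le> t \<Longrightarrow> expectation (\<lambda>\<omega>. (X s \<omega>)\<^sup>2) \<le> C"
    and k: "continuous_on {0..t} k"
  shows square_integrable_time_integral:
      "square_integrable M (\<lambda>\<omega>. integral {0..t} (\<lambda>s. k s * X s \<omega>))"
    and expectation_mult_time_integral:
      "square_integrable M U \<Longrightarrow> expectation (\<lambda>\<omega>. U \<omega> * integral {0..t} (\<lambda>s. k s * X s \<omega>))
        = integral {0..t} (\<lambda>s. k s * expectation (\<lambda>\<omega>. U \<omega> * X s \<omega>))"
proof -
  (* Extending by zero in k and by a constant in X makes everything defined for all real times. *)
  define k' where "k' = (\<lambda>s. indicator {0..t} s * k s)"
  define X' where "X' = (\<lambda>s. X (max 0 s))"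
  define f where "f = (\<lambda>(s, \<omega>). k' s * X' s \<omega>)"
  interpret P: pair_sigma_finite lborel M ..
  interpret Q: pair_sigma_finite M lborel ..
  have X'sq: "square_integrable M (X' s)" for s using Xsq by (simp add: X'_def)
  note [measurable] = square_integrable_measurable[OF X'sq]
  have X'c: "continuous_on UNIV (\<lambda>s. X' s \<omega>)" for \<omega>
    unfolding X'_def by (rule continuous_on_compose2[OF Xc]) (auto intro!: continuous_intros)
  have X'm[measurable]: "(\<lambda>(s, \<omega>). X' s \<omega>) \<in> borel_measurable (lborel \<Otimes>\<^sub>M M)"
    using X'c by (intro continuous_process_jointly_measurable) auto
  have k'm[measurable]: "k' \<in> borel_measurable lborel"
    using borel_measurable_continuous_on_indicator[OF _ k] unfolding k'_def by simp
  have fm[measurable]: "f \<in> borel_measurable (lborel \<Otimes>\<^sub>M M)"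
    unfolding f_def by measurable
  have "compact (k ` {0..t})" using k by (intro compact_continuous_image) auto
  then have "bounded (k ` {0..t})" by (rule compact_imp_bounded)
  then obtain K where "\<forall>s\<in>{0..t}. \<bar>k s\<bar> \<le> K" by (auto simp: bounded_iff)
  then have K: "\<bar>k s\<bar> \<le> K" if "s \<in> {0..t}" for s using that by blast
  have K0: "K \<ge> 0" using K[of 0] t by auto
  have C0: "C \<ge> 0" using XC[of 0] t by (smt (verit) Bochner_Integration.integral_nonneg zero_le_power2)
  have k'K: "\<bar>k' s\<bar> \<le> K * indicator {0..t} s" for s
    using K[of s] by (auto simp: k'_def indicator_def)
  have X'C: "s \<in> {0..t} \<Longrightarrow> expectation (\<lambda>\<omega>. (X' s \<omega>)\<^sup>2) \<le> C" for s
    using XC[of s] by (simp add: X'_def)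
  have cpath: "continuous_on {0..t} (\<lambda>s. k s * X s \<omega>)" for \<omega>
    by (intro continuous_intros k continuous_on_subset[OF Xc]) auto
  have fpath: "f (s, \<omega>) = indicator {0..t} s *\<^sub>R (k s * X s \<omega>)" for s \<omega>
    by (auto simp: f_def k'_def X'_def indicator_def)
  have path_int: "integrable lborel (\<lambda>s. f (s, \<omega>))" for \<omega>
    unfolding fpath using borel_integrable_compact[OF compact_Icc cpath] by simp
  have path_int2: "integrable lborel (\<lambda>s. (f (s, \<omega>))\<^sup>2)" for \<omega>
  proof -
    have "(\<lambda>s. (f (s, \<omega>))\<^sup>2) = (\<lambda>s. indicator {0..t} s *\<^sub>R (k s * X s \<omega>)\<^sup>2)"
      by (auto simp: fpath indicator_def)
    then show ?thesis
      using borel_integrable_compact[OF compact_Icc continuous_on_power[OF cpath[of \<omega>], of 2]] by simp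
  qed
  have Z: "integral {0..t} (\<lambda>s. k s * X s \<omega>) = (\<integral>s. f (s, \<omega>) \<partial>lborel)" for \<omega>
    using set_borel_integral_eq_integral(2)[of "{0..t}" "\<lambda>s. k s * X s \<omega>"] path_int[of \<omega>]
    by (simp add: set_integrable_def set_lebesgue_integral_def fpath)
  have f2: "integrable (lborel \<Otimes>\<^sub>M M) (\<lambda>p. (f p)\<^sup>2)"
  proof (rule P.Fubini_integrable)
    show "integrable lborel (\<lambda>s. \<integral>\<omega>. norm ((f (s, \<omega>))\<^sup>2) \<partial>M)"
    proof (rule Bochner_Integration.integrable_bound)
      show "integrable lborel (\<lambda>s. (K\<^sup>2 * C) * indicator {0..t} s :: real)"
        by (intro integrable_mult_right integrable_real_indicator) (use t in auto)
      have "norm (\<integral>\<omega>. norm ((f (s, \<omega>))\<^sup>2) \<partial>M) \<le> norm (K\<^sup>2 * C * indicator {0..t} s)" for s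
      proof (cases "s \<in> {0..t}")
        case True
        have "(\<integral>\<omega>. norm ((f (s, \<omega>))\<^sup>2) \<partial>M) = (k' s)\<^sup>2 * expectation (\<lambda>\<omega>. (X' s \<omega>)\<^sup>2)"
          by (simp add: f_def power_mult_distrib)
        also have "\<dots> \<le> K\<^sup>2 * C"
          using k'K[of s] X'C[OF True] True K0 by (intro mult_mono) (auto simp: abs_le_square_iff[symmetric])
        finally show ?thesis using True by simp
      qed (simp add: f_def k'_def)
      then show "AE s in lborel. norm (\<integral>\<omega>. norm ((f (s, \<omega>))\<^sup>2) \<partial>M) \<le> norm (K\<^sup>2 * C * indicator {0..t} s)"
        by simp
    qed measurable
    show "AE s in lborel. integrable M (\<lambda>\<omega>. (f (s, \<omega>))\<^sup>2)"
      using square_integrable_power2[OF X'sq] by (simp add: f_def power_mult_distrib)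
  qed measurable
  have Zm: "(\<lambda>\<omega>. \<integral>s. f (s, \<omega>) \<partial>lborel) \<in> borel_measurable M"
    by measurable
  show sqZ: "square_integrable M (\<lambda>\<omega>. integral {0..t} (\<lambda>s. k s * X s \<omega>))"
    unfolding Z square_integrable_def
  proof (intro conjI Zm)
    show "integrable M (\<lambda>\<omega>. (\<integral>s. f (s, \<omega>) \<partial>lborel)\<^sup>2)"
    proof (rule Bochner_Integration.integrable_bound)
      have "integrable (M \<Otimes>\<^sub>M lborel) (\<lambda>(\<omega>, s). (f (s, \<omega>))\<^sup>2)"
        using P.integrable_product_swap[OF f2] by simp
      then show "integrable M (\<lambda>\<omega>. t * (\<integral>s. (f (s, \<omega>))\<^sup>2 \<partial>lborel))"
        using Q.integrable_fst'[of "\<lambda>(\<omega>, s). (f (s, \<omega>))\<^sup>2"]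
        by (intro integrable_mult_right) simp
      have "(\<integral>s. f (s, \<omega>) \<partial>lborel)\<^sup>2 \<le> t * (\<integral>s. (f (s, \<omega>))\<^sup>2 \<partial>lborel)" for \<omega>
      proof -
        have ind: "square_integrable lborel (indicator {0..t} :: real \<Rightarrow> real)"
        proof -
          have "(\<lambda>x. (indicator {0..t} x :: real)\<^sup>2) = indicator {0..t}" by (auto simp: indicator_def)
          then show ?thesis using t by (simp add: square_integrable_def integrable_real_indicator)
        qed
        have "square_integrable lborel (\<lambda>s. f (s, \<omega>))"
          using path_int2[of \<omega>] borel_measurable_integrable[OF path_int[of \<omega>]] by (simp add: square_integrable_def)
        from Cauchy_Schwarz_integral[OF ind this]
        have "(\<integral>s. indicator {0..t} s * f (s, \<omega>) \<partial>lborel)\<^sup>2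
          \<le> (\<integral>s. (indicator {0..t} s)\<^sup>2 \<partial>lborel) * (\<integral>s. (f (s, \<omega>))\<^sup>2 \<partial>lborel)" .
        moreover have "(\<lambda>s. indicator {0..t} s * f (s, \<omega>)) = (\<lambda>s. f (s, \<omega>))"
          by (auto simp: fpath indicator_def)
        moreover have "(\<lambda>s. (indicator {0..t} s :: real)\<^sup>2) = indicator {0..t}"
          by (auto simp: indicator_def)
        ultimately show ?thesis using t by simp
      qed
      then show "AE \<omega> in M. norm ((\<integral>s. f (s, \<omega>) \<partial>lborel)\<^sup>2) \<le> norm (t * (\<integral>s. (f (s, \<omega>))\<^sup>2 \<partial>lborel))"
        using t by simp
    qed (use Zm in measurable)
  qed
  assume U: "square_integrable M U"
  note [measurable] = square_integrable_measurable[OF U]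
  define g where "g = (\<lambda>(s, \<omega>). U \<omega> * f (s, \<omega>))"
  have UX: "integrable M (\<lambda>\<omega>. U \<omega> * X' s \<omega>)" for s
    by (rule square_integrable_integrable_mult[OF U X'sq])
  have gi: "integrable (lborel \<Otimes>\<^sub>M M) g"
  proof (rule P.Fubini_integrable)
    define C' where "C' = expectation (\<lambda>\<omega>. (U \<omega>)\<^sup>2) + C"
    have C': "C' \<ge> 0" using C0 by (simp add: C'_def)
    show "integrable lborel (\<lambda>s. \<integral>\<omega>. norm (g (s, \<omega>)) \<partial>M)"
    proof (rule Bochner_Integration.integrable_bound)
      show "integrable lborel (\<lambda>s. (K * C') * indicator {0..t} s :: real)"
        by (intro integrable_mult_right integrable_real_indicator) (use t in auto)
      have "norm (\<integral>\<omega>. norm (g (s, \<omega>)) \<partial>M) \<le> norm (K * C' * indicator {0..t} s)" for s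
      proof (cases "s \<in> {0..t}")
        case True
        have "expectation (\<lambda>\<omega>. \<bar>U \<omega> * X' s \<omega>\<bar>) \<le> expectation (\<lambda>\<omega>. (U \<omega>)\<^sup>2 + (X' s \<omega>)\<^sup>2)"
        proof (intro integral_mono)
          show "integrable M (\<lambda>\<omega>. \<bar>U \<omega> * X' s \<omega>\<bar>)" using UX by simp
          show "integrable M (\<lambda>\<omega>. (U \<omega>)\<^sup>2 + (X' s \<omega>)\<^sup>2)"
            by (intro Bochner_Integration.integrable_add square_integrable_power2 U X'sq)
          show "\<bar>U \<omega> * X' s \<omega>\<bar> \<le> (U \<omega>)\<^sup>2 + (X' s \<omega>)\<^sup>2" for \<omega>
            by (rule abs_mult_le_sum_squares)
        qed
        also have "\<dots> \<le> C'"
          using X'C[OF True] square_integrable_power2[OF U] square_integrable_power2[OF X'sq]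
          by (simp add: C'_def)
        finally have 1: "expectation (\<lambda>\<omega>. \<bar>U \<omega> * X' s \<omega>\<bar>) \<le> C'" .
        have "(\<integral>\<omega>. norm (g (s, \<omega>)) \<partial>M) = (\<integral>\<omega>. \<bar>k' s\<bar> * \<bar>U \<omega> * X' s \<omega>\<bar> \<partial>M)"
          by (intro Bochner_Integration.integral_cong) (auto simp: g_def f_def abs_mult)
        also have "\<dots> = \<bar>k' s\<bar> * expectation (\<lambda>\<omega>. \<bar>U \<omega> * X' s \<omega>\<bar>)" by simp
        also have "\<dots> \<le> K * C'"
          using k'K[of s] 1 True K0 by (intro mult_mono) auto
        finally show ?thesis using True by simp
      qed (simp add: g_def f_def k'_def)
      then show "AE s in lborel. norm (\<integral>\<omega>. norm (g (s, \<omega>)) \<partial>M) \<le> norm (K * C' * indicator {0..t} s)"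
        by simp
    qed (unfold g_def, measurable)
    show "AE s in lborel. integrable M (\<lambda>\<omega>. g (s, \<omega>))"
    proof (rule AE_I2)
      fix s
      have "integrable M (\<lambda>\<omega>. k' s * (U \<omega> * X' s \<omega>))" using UX by (rule integrable_mult_right)
      then show "integrable M (\<lambda>\<omega>. g (s, \<omega>))" by (simp add: g_def f_def mult.left_commute)
    qed
  qed (unfold g_def, measurable)
  have inner: "(\<integral>\<omega>. g (s, \<omega>) \<partial>M) = indicator {0..t} s *\<^sub>R (k s * expectation (\<lambda>\<omega>. U \<omega> * X s \<omega>))" for s
  proof -
    have "(\<integral>\<omega>. g (s, \<omega>) \<partial>M) = (\<integral>\<omega>. k' s * (U \<omega> * X' s \<omega>) \<partial>M)"
      by (intro Bochner_Integration.integral_cong) (auto simp: g_def f_def)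
    then show ?thesis by (auto simp: k'_def X'_def indicator_def)
  qed
  have "expectation (\<lambda>\<omega>. U \<omega> * integral {0..t} (\<lambda>s. k s * X s \<omega>)) = (\<integral>\<omega>. (\<integral>s. g (s, \<omega>) \<partial>lborel) \<partial>M)"
    unfolding Z by (simp add: g_def)
  also have "\<dots> = (\<integral>s. (\<integral>\<omega>. g (s, \<omega>) \<partial>M) \<partial>lborel)"
    using P.Fubini_integral[of "\<lambda>s \<omega>. g (s, \<omega>)"] gi by simp
  also have "\<dots> = integral {0..t} (\<lambda>s. k s * expectation (\<lambda>\<omega>. U \<omega> * X s \<omega>))"
  proof -
    have "integrable lborel (\<lambda>s. \<integral>\<omega>. g (s, \<omega>) \<partial>M)"
      using P.integrable_fst'[OF gi] .
    then show ?thesis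
      unfolding inner
      using set_borel_integral_eq_integral(2)[of "{0..t}" "\<lambda>s. k s * expectation (\<lambda>\<omega>. U \<omega> * X s \<omega>)"]
      by (simp add: set_integrable_def set_lebesgue_integral_def)
  qed
  finally show "expectation (\<lambda>\<omega>. U \<omega> * integral {0..t} (\<lambda>s. k s * X s \<omega>))
        = integral {0..t} (\<lambda>s. k s * expectation (\<lambda>\<omega>. U \<omega> * X s \<omega>))" .
qed

end

section \<open>Wiener noise and the Ito isometry\<close>

definition C1_kernel :: "(real \<Rightarrow> real) \<Rightarrow> (real \<Rightarrow> real) \<Rightarrow> bool" where
  "C1_kernel h h' \<longleftrightarrow> continuous_on {0..} h' \<and>
     (\<forall>t\<ge>0. (h has_real_derivative h' t) (at t within {0..}))"

lemma C1_kernelD: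
  assumes "C1_kernel h h'"
  shows "continuous_on {0..} h'" "t \<ge> 0 \<Longrightarrow> (h has_real_derivative h' t) (at t within {0..})"
    and "continuous_on {0..} h"
  using assms DERIV_continuous_on[of "{0..}" h h'] by (auto simp: C1_kernel_def)

lemma has_derivative_integral_upper:
  fixes f :: "real \<Rightarrow> real"
  assumes "continuous_on {0..t} f" "s \<in> {0..t}"
  shows "((\<lambda>u. integral {0..u} f) has_real_derivative f s) (at s within {0..t})"
  using integral_has_vector_derivative[OF assms]
  by (simp add: has_real_derivative_iff_has_vector_derivative)

lemma integral_reflect_Icc:
  fixes f :: "real \<Rightarrow> real"
  assumes "t \<ge> 0" "continuous_on {0..} f"
  shows "integral {0..t} (\<lambda>s. f (t - s)) = integral {0..t} f"
proof -
  define P where "P = (\<lambda>s. integral {0..s} f)"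
  have "(P has_real_derivative f s) (at s within {0..})" if "s \<ge> 0" for s
    using has_derivative_integral_upper[of "s + 1" f s] continuous_on_subset[OF assms(2)] that
    by (auto simp: P_def at_within_atLeast_Icc)
  from DERIV_minus[OF has_derivative_reflect[OF this]]
  have "integral {0..t} (\<lambda>s. f (t - s)) = - P (t - t) - - P (t - 0)"
    by (intro integral_eq_diff_of_deriv[OF assms(1), of "\<lambda>s. - P (t - s)"]) auto
  then show ?thesis by (simp add: P_def)
qed

text \<open>
Of the Wiener processes only the covariances matter for second moments.  Paths are continuous at
every sample point, which makes pathwise integrals measurable; \<open>wiener_noise_version\<close>
provides such versions.
\<close>

locale wiener_noise = prob_space M for M :: "'w measure" +
  fixes n :: nat and B :: "nat \<Rightarrow> real \<Rightarrow> 'w \<Rightarrow> real"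
  assumes B_square_integrable: "i < n \<Longrightarrow> t \<ge> 0 \<Longrightarrow> square_integrable M (B i t)"
    and B_continuous: "i < n \<Longrightarrow> continuous_on {0..} (\<lambda>t. B i t \<omega>)"
    and B_covariance: "i < n \<Longrightarrow> j < n \<Longrightarrow> s \<ge> 0 \<Longrightarrow> t \<ge> 0 \<Longrightarrow>
      expectation (\<lambda>\<omega>. B i s \<omega> * B j t \<omega>) = (if i = j then min s t else 0)"
begin

definition path :: "nat \<Rightarrow> 'w \<Rightarrow> real \<Rightarrow> real" where
  "path i \<omega> = (\<lambda>t. B i t \<omega>)"

lemma
  assumes h: "C1_kernel h h'" and i: "i < n" and t: "t \<ge> 0"
  shows noise_response_square_integrable:
      "square_integrable M (\<lambda>\<omega>. noise_response h h' (path i \<omega>) t)"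
    and expectation_mult_noise_response: "square_integrable M U \<Longrightarrow>
      expectation (\<lambda>\<omega>. U \<omega> * noise_response h h' (path i \<omega>) t)
       = h 0 * expectation (\<lambda>\<omega>. U \<omega> * B i t \<omega>)
         + integral {0..t} (\<lambda>s. h' (t - s) * expectation (\<lambda>\<omega>. U \<omega> * B i s \<omega>))"
proof -
  have var: "expectation (\<lambda>\<omega>. (B i s \<omega>)\<^sup>2) \<le> t" if "0 \<le> s" "s \<le> t" for s
    using B_covariance[OF i i that(1) that(1)] that(2) by (simp add: power2_eq_square)
  have k: "continuous_on {0..t} (\<lambda>s. h' (t - s))"
    by (rule continuous_on_reflect[OF C1_kernelD(1)[OF h]]) simp
  note sq = square_integrable_time_integral[OF t B_square_integrable[OF i] B_continuous[OF i] var k]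
  show "square_integrable M (\<lambda>\<omega>. noise_response h h' (path i \<omega>) t)"
    unfolding noise_response_def path_def
    by (intro square_integrable_add square_integrable_cmult B_square_integrable i t sq)
  assume U: "square_integrable M U"
  have "expectation (\<lambda>\<omega>. U \<omega> * noise_response h h' (path i \<omega>) t)
      = expectation (\<lambda>\<omega>. h 0 * (U \<omega> * B i t \<omega>) + U \<omega> * integral {0..t} (\<lambda>s. h' (t - s) * B i s \<omega>))"
    unfolding noise_response_def path_def by (simp add: algebra_simps)
  also have "\<dots> = h 0 * expectation (\<lambda>\<omega>. U \<omega> * B i t \<omega>)
      + expectation (\<lambda>\<omega>. U \<omega> * integral {0..t} (\<lambda>s. h' (t - s) * B i s \<omega>))"
    using square_integrable_integrable_mult[OF U B_square_integrable[OF i t]]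
      square_integrable_integrable_mult[OF U sq] by simp
  finally show "expectation (\<lambda>\<omega>. U \<omega> * noise_response h h' (path i \<omega>) t)
       = h 0 * expectation (\<lambda>\<omega>. U \<omega> * B i t \<omega>)
         + integral {0..t} (\<lambda>s. h' (t - s) * expectation (\<lambda>\<omega>. U \<omega> * B i s \<omega>))"
    using expectation_mult_time_integral[OF t B_square_integrable[OF i] B_continuous[OF i] var k U] by simp
qed

text \<open>
The covariance of \<open>B s\<close> with the stochastic integral of \<open>u \<mapsto> g (t - u)\<close> is the integral of that
function over \<open>{0..s}\<close>; after Fubini's theorem this is integration by parts on the two sides of the
kink of \<open>min s u\<close>.
\<close>

lemma covariance_noise_response:
  assumes g: "C1_kernel g g'" and i: "i < n" and j: "j < n" and st: "0 \<le> s" "s \<le> t"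
  shows "expectation (\<lambda>\<omega>. B j s \<omega> * noise_response g g' (path i \<omega>) t)
    = (if i = j then integral {0..s} (\<lambda>u. g (t - u)) else 0)"
proof -
  have t: "t \<ge> 0" using st by simp
  have *: "expectation (\<lambda>\<omega>. B j s \<omega> * noise_response g g' (path i \<omega>) t)
    = g 0 * (if j = i then min s t else 0)
      + integral {0..t} (\<lambda>u. g' (t - u) * (if j = i then min s u else 0))"
    unfolding expectation_mult_noise_response[OF g i t B_square_integrable[OF j st(1)]]
    using B_covariance[OF j i st(1)] t by (auto intro!: integral_cong)
  show ?thesis
  proof (cases "i = j")
    case True
    define \<Gamma> where "\<Gamma> = (\<lambda>u. integral {0..u} (\<lambda>u. g (t - u)))"
    have cg: "continuous_on {0..t} (\<lambda>u. g (t - u))" "continuous_on {0..t} (\<lambda>u. g' (t - u))"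
      by (auto intro!: continuous_on_reflect C1_kernelD[OF g])
    have dg: "((\<lambda>u. g (t - u)) has_real_derivative - g' (t - u)) (at u within {0..t})" if "u \<in> {0..t}" for u
      using has_derivative_reflect[OF C1_kernelD(2)[OF g] that] .
    have d\<Gamma>: "(\<Gamma> has_real_derivative g (t - u)) (at u within {0..t})" if "u \<in> {0..t}" for u
      unfolding \<Gamma>_def by (rule has_derivative_integral_upper[OF cg(1) that])
    have "((\<lambda>u. g' (t - u) * min s u) has_integral (\<Gamma> s - g (t - s) * s) - (\<Gamma> 0 - g (t - 0) * 0)) {0..s}"
    proof (rule fundamental_theorem_of_calculus[OF st(1)])
      fix u assume u: "u \<in> {0..s}"
      then have u': "u \<in> {0..t}" using st by auto
      have "((\<lambda>u. \<Gamma> u - g (t - u) * u) has_real_derivative g' (t - u) * min s u) (at u within {0..t})"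
        using u by (auto intro!: derivative_eq_intros d\<Gamma>[OF u'] dg[OF u'])
      then show "((\<lambda>u. \<Gamma> u - g (t - u) * u) has_vector_derivative g' (t - u) * min s u) (at u within {0..s})"
        unfolding has_real_derivative_iff_has_vector_derivative
        by (rule has_vector_derivative_within_subset) (use st in auto)
    qed
    moreover have "((\<lambda>u. g' (t - u) * min s u) has_integral (- g (t - t) * s) - (- g (t - s) * s)) {s..t}"
    proof (rule fundamental_theorem_of_calculus[OF st(2)])
      fix u assume u: "u \<in> {s..t}"
      then have u': "u \<in> {0..t}" using st by auto
      have "((\<lambda>u. - g (t - u) * s) has_real_derivative g' (t - u) * min s u) (at u within {0..t})"
        using u by (auto intro!: derivative_eq_intros dg[OF u'])
      then show "((\<lambda>u. - g (t - u) * s) has_vector_derivative g' (t - u) * min s u) (at u within {s..t})"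
        unfolding has_real_derivative_iff_has_vector_derivative
        by (rule has_vector_derivative_within_subset) (use st in auto)
    qed
    ultimately have "((\<lambda>u. g' (t - u) * min s u) has_integral
      ((\<Gamma> s - g (t - s) * s) - (\<Gamma> 0 - g (t - 0) * 0) + ((- g (t - t) * s) - (- g (t - s) * s)))) {0..t}"
      by (rule has_integral_combine[OF st])
    then have "integral {0..t} (\<lambda>u. g' (t - u) * min s u) = \<Gamma> s - g 0 * s"
      by (intro integral_unique) (simp add: \<Gamma>_def)
    then show ?thesis unfolding * using True st by (simp add: \<Gamma>_def)
  qed (simp add: *)
qed

text \<open>
One more integration by parts, against the covariance just computed.
\<close>

lemma noise_response_isometry:
  assumes h: "C1_kernel h h'" and g: "C1_kernel g g'" and i: "i < n" and j: "j < n" and t: "t \<ge> 0"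
  shows "expectation (\<lambda>\<omega>. noise_response h h' (path i \<omega>) t * noise_response g g' (path j \<omega>) t)
    = (if i = j then integral {0..t} (\<lambda>s. h s * g s) else 0)"
proof -
  define \<Gamma> where "\<Gamma> = (\<lambda>s. integral {0..s} (\<lambda>u. g (t - u)))"
  have E: "expectation (\<lambda>\<omega>. noise_response g g' (path j \<omega>) t * B i s \<omega>) = (if i = j then \<Gamma> s else 0)"
    if "0 \<le> s" "s \<le> t" for s
    using covariance_noise_response[OF g j i that] by (auto simp: \<Gamma>_def mult.commute)
  have "expectation (\<lambda>\<omega>. noise_response h h' (path i \<omega>) t * noise_response g g' (path j \<omega>) t)
    = h 0 * (if i = j then \<Gamma> t else 0)
      + integral {0..t} (\<lambda>s. h' (t - s) * (if i = j then \<Gamma> s else 0))"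
    using expectation_mult_noise_response[OF h i t noise_response_square_integrable[OF g j t]] E t
    by (auto simp: mult.commute[of "noise_response h h' _ _"] intro!: integral_cong)
  moreover have "h 0 * \<Gamma> t + integral {0..t} (\<lambda>s. h' (t - s) * \<Gamma> s) = integral {0..t} (\<lambda>s. h s * g s)"
  proof -
    have ch: "continuous_on {0..} h" "continuous_on {0..} g" by (rule C1_kernelD[OF h] C1_kernelD[OF g])+
    have cg: "continuous_on {0..t} (\<lambda>u. g (t - u))" "continuous_on {0..t} (\<lambda>u. h (t - u))"
      "continuous_on {0..t} (\<lambda>u. h' (t - u))"
      by (auto intro!: continuous_on_reflect C1_kernelD[OF g] C1_kernelD[OF h])
    have d\<Gamma>: "(\<Gamma> has_real_derivative g (t - s)) (at s within {0..t})" if "s \<in> {0..t}" for s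
      unfolding \<Gamma>_def by (rule has_derivative_integral_upper[OF cg(1) that])
    have c\<Gamma>: "continuous_on {0..t} \<Gamma>" by (rule DERIV_continuous_on[OF d\<Gamma>])
    have "integral {0..t} (\<lambda>s. h (t - s) * g (t - s) - h' (t - s) * \<Gamma> s)
      = h (t - t) * \<Gamma> t - h (t - 0) * \<Gamma> 0"
      by (rule integral_eq_diff_of_deriv[OF t])
        (auto intro!: derivative_eq_intros d\<Gamma> has_derivative_reflect[OF C1_kernelD(2)[OF h]])
    also have "integral {0..t} (\<lambda>s. h (t - s) * g (t - s) - h' (t - s) * \<Gamma> s)
      = integral {0..t} (\<lambda>s. h (t - s) * g (t - s)) - integral {0..t} (\<lambda>s. h' (t - s) * \<Gamma> s)"
      by (intro Henstock_Kurzweil_Integration.integral_diff integrable_continuous_interval continuous_intros cg c\<Gamma>)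
    also have "integral {0..t} (\<lambda>s. h (t - s) * g (t - s)) = integral {0..t} (\<lambda>s. h s * g s)"
      using integral_reflect_Icc[OF t continuous_on_mult[OF ch]] .
    finally show ?thesis by (simp add: \<Gamma>_def)
  qed
  ultimately show ?thesis by auto
qed

definition response :: "(nat \<Rightarrow> real \<Rightarrow> real) \<Rightarrow> (nat \<Rightarrow> real \<Rightarrow> real) \<Rightarrow> real \<Rightarrow> 'w \<Rightarrow> real" where
  "response h h' t \<omega> = (\<Sum>i<n. noise_response (h i) (h' i) (path i \<omega>) t)"

lemma response_square_integrable:
  assumes "\<And>i. i < n \<Longrightarrow> C1_kernel (h i) (h' i)" "t \<ge> 0"
  shows "square_integrable M (response h h' t)"
  unfolding response_def by (intro square_integrable_sum noise_response_square_integrable) (use assms in auto)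

lemma expectation_mult_response:
  assumes "\<And>i. i < n \<Longrightarrow> C1_kernel (h i) (h' i)" "t \<ge> 0" "square_integrable M U"
  shows "expectation (\<lambda>\<omega>. U \<omega> * response h h' t \<omega>)
    = (\<Sum>i<n. expectation (\<lambda>\<omega>. U \<omega> * noise_response (h i) (h' i) (path i \<omega>) t))"
  unfolding response_def sum_distrib_left
  using assms by (intro Bochner_Integration.integral_sum square_integrable_integrable_mult
    noise_response_square_integrable) auto

lemma response_isometry:
  assumes h: "\<And>i. i < n \<Longrightarrow> C1_kernel (h i) (h' i)" and g: "\<And>i. i < n \<Longrightarrow> C1_kernel (g i) (g' i)"
    and t: "t \<ge> 0"
  shows "expectation (\<lambda>\<omega>. response h h' t \<omega> * response g g' t \<omega>) = (\<Sum>i<n. integral {0..t} (\<lambda>s. h i s * g i s))"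
proof -
  have "expectation (\<lambda>\<omega>. response h h' t \<omega> * response g g' t \<omega>)
    = (\<Sum>j<n. \<Sum>i<n. expectation (\<lambda>\<omega>. noise_response (g j) (g' j) (path j \<omega>) t * noise_response (h i) (h' i) (path i \<omega>) t))"
  proof -
    have sqh: "square_integrable M (response h h' t)" by (rule response_square_integrable[OF h t])
    have "expectation (\<lambda>\<omega>. response h h' t \<omega> * response g g' t \<omega>)
      = (\<Sum>j<n. expectation (\<lambda>\<omega>. response h h' t \<omega> * noise_response (g j) (g' j) (path j \<omega>) t))"
      by (rule expectation_mult_response[OF g t sqh])
    also have "\<dots> = (\<Sum>j<n. expectation (\<lambda>\<omega>. noise_response (g j) (g' j) (path j \<omega>) t * response h h' t \<omega>))"
      by (simp add: mult.commute)
    also have "\<dots> = (\<Sum>j<n. \<Sum>i<n. expectation (\<lambda>\<omega>. noise_response (g j) (g' j) (path j \<omega>) t * noise_response (h i) (h' i) (path i \<omega>) t))"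
      by (intro sum.cong refl expectation_mult_response[OF h t] noise_response_square_integrable[OF g _ t]) auto
    finally show ?thesis .
  qed
  also have "\<dots> = (\<Sum>j<n. \<Sum>i<n. if j = i then integral {0..t} (\<lambda>s. h j s * g j s) else 0)"
    by (intro sum.cong refl) (auto simp: noise_response_isometry[OF g h] t mult.commute)
  also have "\<dots> = (\<Sum>j<n. integral {0..t} (\<lambda>s. h j s * g j s))" by simp
  finally show ?thesis .
qed

text \<open>
The contribution of the initial values tends to \<open>0\<close> in mean square, the responses to the noise
have bounded second moments, and so by the Cauchy-Schwarz inequality only the product of the two
responses survives.  The initial values may depend on the noise, as those of the filters may.
\<close>

lemma second_moments_tendsto:
  fixes r q :: "nat \<Rightarrow> real \<Rightarrow> real" and \<zeta> :: "nat \<Rightarrow> 'w \<Rightarrow> real"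
  assumes h: "\<And>i. i < n \<Longrightarrow> C1_kernel (h i) (h' i)" "\<And>i. i < n \<Longrightarrow> exp_decaying (h i)"
    and g: "\<And>i. i < n \<Longrightarrow> C1_kernel (g i) (g' i)" "\<And>i. i < n \<Longrightarrow> exp_decaying (g i)"
    and \<zeta>: "\<And>k. k < m \<Longrightarrow> square_integrable M (\<zeta> k)"
    and r: "\<And>k. k < m \<Longrightarrow> (r k \<longlongrightarrow> 0) at_top" and q: "\<And>k. k < m \<Longrightarrow> (q k \<longlongrightarrow> 0) at_top"
    and X: "\<And>t. t \<ge> 0 \<Longrightarrow> X t \<in> borel_measurable M"
      "\<And>t. t \<ge> 0 \<Longrightarrow> AE \<omega> in M. X t \<omega> = (\<Sum>k<m. r k t * \<zeta> k \<omega>) + response h h' t \<omega>"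
    and Y: "\<And>t. t \<ge> 0 \<Longrightarrow> Y t \<in> borel_measurable M"
      "\<And>t. t \<ge> 0 \<Longrightarrow> AE \<omega> in M. Y t \<omega> = (\<Sum>k<m. q k t * \<zeta> k \<omega>) + response g g' t \<omega>"
  shows "((\<lambda>t. expectation (\<lambda>\<omega>. X t \<omega> * Y t \<omega>)) \<longlongrightarrow> (\<Sum>i<n. half_line_integral (\<lambda>t. h i t * g i t))) at_top"
proof -
  define \<rho> where "\<rho> = (\<lambda>(r::nat \<Rightarrow> real \<Rightarrow> real) t \<omega>. \<Sum>k<m. r k t * \<zeta> k \<omega>)"
  have sq\<rho>: "square_integrable M (\<rho> r t)" for r t
    unfolding \<rho>_def by (intro square_integrable_sum square_integrable_cmult \<zeta>) auto
  have \<rho>0: "((\<lambda>t. expectation (\<lambda>\<omega>. (\<rho> r t \<omega>)\<^sup>2)) \<longlongrightarrow> 0) at_top"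
    if r: "\<And>k. k < m \<Longrightarrow> (r k \<longlongrightarrow> 0) at_top" for r
  proof -
    have "expectation (\<lambda>\<omega>. (\<rho> r t \<omega>)\<^sup>2) = (\<Sum>k<m. \<Sum>l<m. r k t * r l t * expectation (\<lambda>\<omega>. \<zeta> k \<omega> * \<zeta> l \<omega>))" for t
    proof -
      have "expectation (\<lambda>\<omega>. (\<rho> r t \<omega>)\<^sup>2) = expectation (\<lambda>\<omega>. \<Sum>k<m. \<Sum>l<m. r k t * r l t * (\<zeta> k \<omega> * \<zeta> l \<omega>))"
        unfolding \<rho>_def power2_eq_square sum_product by (simp add: mult_ac)
      also have "\<dots> = (\<Sum>k<m. \<Sum>l<m. r k t * r l t * expectation (\<lambda>\<omega>. \<zeta> k \<omega> * \<zeta> l \<omega>))"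
        using \<zeta> by (subst Bochner_Integration.integral_sum)
          (auto intro!: sum.cong Bochner_Integration.integrable_sum integrable_mult_right square_integrable_integrable_mult
            simp: Bochner_Integration.integral_sum square_integrable_integrable_mult)
      finally show ?thesis .
    qed
    moreover have "((\<lambda>t. \<Sum>k<m. \<Sum>l<m. r k t * r l t * expectation (\<lambda>\<omega>. \<zeta> k \<omega> * \<zeta> l \<omega>)) \<longlongrightarrow>
        (\<Sum>k<m. \<Sum>l<m. 0 * 0 * expectation (\<lambda>\<omega>. \<zeta> k \<omega> * \<zeta> l \<omega>))) at_top"
      by (intro tendsto_intros r) auto
    ultimately show ?thesis by simp
  qed
  have N: "((\<lambda>t. expectation (\<lambda>\<omega>. response h h' t \<omega> * response g g' t \<omega>))
      \<longlongrightarrow> (\<Sum>i<n. half_line_integral (\<lambda>t. h i t * g i t))) at_top"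
    if h: "\<And>i. i < n \<Longrightarrow> C1_kernel (h i) (h' i)" "\<And>i. i < n \<Longrightarrow> exp_decaying (h i)"
    and g: "\<And>i. i < n \<Longrightarrow> C1_kernel (g i) (g' i)" "\<And>i. i < n \<Longrightarrow> exp_decaying (g i)" for h h' g g'
  proof -
    have "((\<lambda>t. \<Sum>i<n. integral {0..t} (\<lambda>s. h i s * g i s))
      \<longlongrightarrow> (\<Sum>i<n. half_line_integral (\<lambda>t. h i t * g i t))) at_top"
      by (intro tendsto_sum integral_tendsto_half_line_integral exp_decaying_mult h g) auto
    moreover have "eventually (\<lambda>t. (\<Sum>i<n. integral {0..t} (\<lambda>s. h i s * g i s))
        = expectation (\<lambda>\<omega>. response h h' t \<omega> * response g g' t \<omega>)) at_top"
      using response_isometry[OF h(1) g(1)] by (auto intro: eventually_mono[OF eventually_ge_at_top[of 0]])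
    ultimately show ?thesis by (rule Lim_transform_eventually)
  qed
  have cross: "((\<lambda>t. expectation (\<lambda>\<omega>. \<rho> r t \<omega> * response h h' t \<omega>)) \<longlongrightarrow> 0) at_top"
    if r: "\<And>k. k < m \<Longrightarrow> (r k \<longlongrightarrow> 0) at_top"
    and h: "\<And>i. i < n \<Longrightarrow> C1_kernel (h i) (h' i)" "\<And>i. i < n \<Longrightarrow> exp_decaying (h i)" for r h h'
  proof -
    have "((\<lambda>t. expectation (\<lambda>\<omega>. (\<rho> r t \<omega>)\<^sup>2) * expectation (\<lambda>\<omega>. response h h' t \<omega> * response h h' t \<omega>))
       \<longlongrightarrow> 0 * (\<Sum>i<n. half_line_integral (\<lambda>t. h i t * h i t))) at_top"
      by (intro tendsto_mult \<rho>0 N r h)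
    then have lim: "((\<lambda>t. sqrt (expectation (\<lambda>\<omega>. (\<rho> r t \<omega>)\<^sup>2) * expectation (\<lambda>\<omega>. response h h' t \<omega> * response h h' t \<omega>)))
       \<longlongrightarrow> 0) at_top"
      using tendsto_real_sqrt by fastforce
    show ?thesis
    proof (rule Lim_null_comparison[OF _ lim])
      show "eventually (\<lambda>t. norm (expectation (\<lambda>\<omega>. \<rho> r t \<omega> * response h h' t \<omega>)) \<le>
        sqrt (expectation (\<lambda>\<omega>. (\<rho> r t \<omega>)\<^sup>2) * expectation (\<lambda>\<omega>. response h h' t \<omega> * response h h' t \<omega>))) at_top"
        using eventually_ge_at_top[of 0]
      proof (rule eventually_mono)
        fix t :: real assume t: "0 \<le> t"
        have "(expectation (\<lambda>\<omega>. \<rho> r t \<omega> * response h h' t \<omega>))\<^sup>2 \<le>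
          expectation (\<lambda>\<omega>. (\<rho> r t \<omega>)\<^sup>2) * expectation (\<lambda>\<omega>. response h h' t \<omega> * response h h' t \<omega>)"
          using Cauchy_Schwarz_integral[OF sq\<rho> response_square_integrable[OF h(1) t]]
          by (simp add: power2_eq_square)
        then show "norm (expectation (\<lambda>\<omega>. \<rho> r t \<omega> * response h h' t \<omega>)) \<le>
          sqrt (expectation (\<lambda>\<omega>. (\<rho> r t \<omega>)\<^sup>2) * expectation (\<lambda>\<omega>. response h h' t \<omega> * response h h' t \<omega>))"
          by (simp add: real_le_rsqrt)
      qed
    qed
  qed
  have \<rho>\<rho>: "((\<lambda>t. expectation (\<lambda>\<omega>. \<rho> r t \<omega> * \<rho> q t \<omega>)) \<longlongrightarrow> 0) at_top"
  proof (rule Lim_null_comparison)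
    have "((\<lambda>t. sqrt (expectation (\<lambda>\<omega>. (\<rho> r t \<omega>)\<^sup>2) * expectation (\<lambda>\<omega>. (\<rho> q t \<omega>)\<^sup>2))) \<longlongrightarrow> sqrt (0 * 0)) at_top"
      by (intro tendsto_intros \<rho>0 r q)
    then show "((\<lambda>t. sqrt (expectation (\<lambda>\<omega>. (\<rho> r t \<omega>)\<^sup>2) * expectation (\<lambda>\<omega>. (\<rho> q t \<omega>)\<^sup>2))) \<longlongrightarrow> 0) at_top" by simp
    show "eventually (\<lambda>t. norm (expectation (\<lambda>\<omega>. \<rho> r t \<omega> * \<rho> q t \<omega>)) \<le>
      sqrt (expectation (\<lambda>\<omega>. (\<rho> r t \<omega>)\<^sup>2) * expectation (\<lambda>\<omega>. (\<rho> q t \<omega>)\<^sup>2))) at_top"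
      using Cauchy_Schwarz_integral[OF sq\<rho> sq\<rho>] by (simp add: real_le_rsqrt)
  qed
  have "((\<lambda>t. expectation (\<lambda>\<omega>. \<rho> r t \<omega> * \<rho> q t \<omega>) + expectation (\<lambda>\<omega>. \<rho> r t \<omega> * response g g' t \<omega>)
      + expectation (\<lambda>\<omega>. \<rho> q t \<omega> * response h h' t \<omega>) + expectation (\<lambda>\<omega>. response h h' t \<omega> * response g g' t \<omega>))
     \<longlongrightarrow> 0 + 0 + 0 + (\<Sum>i<n. half_line_integral (\<lambda>t. h i t * g i t))) at_top"
    by (intro tendsto_add \<rho>\<rho> cross N r q h g)
  moreover have "eventually (\<lambda>t. expectation (\<lambda>\<omega>. \<rho> r t \<omega> * \<rho> q t \<omega>) + expectation (\<lambda>\<omega>. \<rho> r t \<omega> * response g g' t \<omega>)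
      + expectation (\<lambda>\<omega>. \<rho> q t \<omega> * response h h' t \<omega>) + expectation (\<lambda>\<omega>. response h h' t \<omega> * response g g' t \<omega>)
      = expectation (\<lambda>\<omega>. X t \<omega> * Y t \<omega>)) at_top"
    using eventually_ge_at_top[of 0]
  proof (rule eventually_mono)
    fix t :: real assume t: "0 \<le> t"
    have sqh: "square_integrable M (response h h' t)" and sqg: "square_integrable M (response g g' t)"
      by (rule response_square_integrable[OF h(1) t], assumption, rule response_square_integrable[OF g(1) t], assumption)
    have i: "integrable M (\<lambda>\<omega>. \<rho> r t \<omega> * \<rho> q t \<omega>)" "integrable M (\<lambda>\<omega>. \<rho> r t \<omega> * response g g' t \<omega>)"
      "integrable M (\<lambda>\<omega>. \<rho> q t \<omega> * response h h' t \<omega>)" "integrable M (\<lambda>\<omega>. response h h' t \<omega> * response g g' t \<omega>)"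
      by (intro square_integrable_integrable_mult sq\<rho> sqh sqg)+
    have "expectation (\<lambda>\<omega>. X t \<omega> * Y t \<omega>) = expectation (\<lambda>\<omega>. \<rho> r t \<omega> * \<rho> q t \<omega> + \<rho> r t \<omega> * response g g' t \<omega>
      + \<rho> q t \<omega> * response h h' t \<omega> + response h h' t \<omega> * response g g' t \<omega>)"
    proof (rule integral_cong_AE)
      show "AE \<omega> in M. X t \<omega> * Y t \<omega> = \<rho> r t \<omega> * \<rho> q t \<omega> + \<rho> r t \<omega> * response g g' t \<omega>
        + \<rho> q t \<omega> * response h h' t \<omega> + response h h' t \<omega> * response g g' t \<omega>"
        using X(2)[OF t] Y(2)[OF t] by eventually_elim (simp add: \<rho>_def algebra_simps)
      show "(\<lambda>\<omega>. X t \<omega> * Y t \<omega>) \<in> borel_measurable M" using X(1)[OF t] Y(1)[OF t] by measurable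
      show "(\<lambda>\<omega>. \<rho> r t \<omega> * \<rho> q t \<omega> + \<rho> r t \<omega> * response g g' t \<omega>
        + \<rho> q t \<omega> * response h h' t \<omega> + response h h' t \<omega> * response g g' t \<omega>) \<in> borel_measurable M"
        using i by measurable
    qed
    then show "expectation (\<lambda>\<omega>. \<rho> r t \<omega> * \<rho> q t \<omega>) + expectation (\<lambda>\<omega>. \<rho> r t \<omega> * response g g' t \<omega>)
      + expectation (\<lambda>\<omega>. \<rho> q t \<omega> * response h h' t \<omega>) + expectation (\<lambda>\<omega>. response h h' t \<omega> * response g g' t \<omega>)
      = expectation (\<lambda>\<omega>. X t \<omega> * Y t \<omega>)"
      using i by simp
  qed
  ultimately show ?thesis by (simp add: Lim_transform_eventually)
qed

end

section \<open>Second moments of Wiener processes\<close>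

lemma (in prob_space) square_integrable_const: "square_integrable M (\<lambda>_. c)"
  by (simp add: square_integrable_def)

lemma (in prob_space) square_integrable_integrable:
  "square_integrable M f \<Longrightarrow> integrable M f"
  using square_integrable_integrable_mult[OF _ square_integrable_const[of 1], of f] by simp

lemma (in prob_space) wiener_process_increment:
  assumes W: "wiener_process M W" and st: "0 \<le> s" "s < t"
  shows "square_integrable M (\<lambda>\<omega>. W t \<omega> - W s \<omega>)"
    and "expectation (\<lambda>\<omega>. W t \<omega> - W s \<omega>) = 0"
    and "expectation (\<lambda>\<omega>. (W t \<omega> - W s \<omega>)\<^sup>2) = t - s"
proof -
  have D: "distributed M lborel (\<lambda>\<omega>. W t \<omega> - W s \<omega>) (normal_density 0 (sqrt (t - s)))"
    using W st unfolding wiener_process_def by blast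
  have pos: "sqrt (t - s) > 0" using st by simp
  have "integrable lborel (\<lambda>x. normal_density 0 (sqrt (t - s)) x * (x - 0) ^ 2)"
    by (rule integrable_normal_moment[OF pos])
  then have "integrable M (\<lambda>\<omega>. (W t \<omega> - W s \<omega>)\<^sup>2)"
    using distributed_integrable[OF D, of "\<lambda>x. x\<^sup>2"] by simp
  then show "square_integrable M (\<lambda>\<omega>. W t \<omega> - W s \<omega>)"
    using distributed_measurable[OF D] by (simp add: square_integrable_def)
  show 0: "expectation (\<lambda>\<omega>. W t \<omega> - W s \<omega>) = 0"
    by (rule normal_distributed_expectation[OF pos D])
  show "expectation (\<lambda>\<omega>. (W t \<omega> - W s \<omega>)\<^sup>2) = t - s"
    using normal_distributed_variance[OF pos D] st unfolding 0 by simp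
qed

lemma (in prob_space) wiener_process_moments:
  assumes W: "wiener_process M W" and s: "0 \<le> s"
  shows "square_integrable M (W s)"
    and "expectation (W s) = 0"
    and "s \<le> t \<Longrightarrow> expectation (\<lambda>\<omega>. W s \<omega> * W t \<omega>) = s"
proof -
  have W0: "AE \<omega> in M. W 0 \<omega> = 0" and Wm: "\<And>t. t \<ge> 0 \<Longrightarrow> W t \<in> borel_measurable M"
    using W unfolding wiener_process_def continuous_process_def by auto
  have sq: "square_integrable M (W t)" and Wt: "expectation (W t) = 0"
    and var: "expectation (\<lambda>\<omega>. (W t \<omega>)\<^sup>2) = t" if "t \<ge> 0" for t
  proof -
    have *: "square_integrable M (W t) \<and> expectation (W t) = 0 \<and> expectation (\<lambda>\<omega>. (W t \<omega>)\<^sup>2) = t"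
    proof (cases "t = 0")
      case True
      have "expectation (W 0) = expectation (\<lambda>_. 0)" "expectation (\<lambda>\<omega>. (W 0 \<omega>)\<^sup>2) = expectation (\<lambda>_. 0)"
        using W0 by (auto intro!: integral_eq_zero_AE)
      moreover have "square_integrable M (W 0)"
        by (rule square_integrable_cong_AE[OF square_integrable_zero W0 Wm]) simp
      ultimately show ?thesis using True by simp
    next
      case False
      then have t: "0 < t" using that by simp
      have ae: "AE \<omega> in M. W t \<omega> = W t \<omega> - W 0 \<omega>" using W0 by eventually_elim simp
      have sq: "square_integrable M (W t)"
        by (rule square_integrable_cong_AE[OF wiener_process_increment(1)[OF W order_refl t] ae Wm[OF that]])
      have "expectation (W t) = expectation (\<lambda>\<omega>. W t \<omega> - W 0 \<omega>)"
        "expectation (\<lambda>\<omega>. (W t \<omega>)\<^sup>2) = expectation (\<lambda>\<omega>. (W t \<omega> - W 0 \<omega>)\<^sup>2)"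
        using ae Wm[OF that] Wm[of 0] by (auto intro!: integral_cong_AE)
      then show ?thesis using sq wiener_process_increment[OF W order_refl t] by simp
    qed
    then show "square_integrable M (W t)" "expectation (W t) = 0" "expectation (\<lambda>\<omega>. (W t \<omega>)\<^sup>2) = t" by auto
  qed
  show "square_integrable M (W s)" "expectation (W s) = 0" using sq Wt s by auto
  show "expectation (\<lambda>\<omega>. W s \<omega> * W t \<omega>) = s" if "s \<le> t"
  proof (cases "s < t")
    case True
    (* Independence of the increments over the two intervals from 0 to s and from s to t. *)
    define \<tau> where "\<tau> = (\<lambda>i::nat. if i = 0 then 0 else if i = 1 then s else t)"
    have "0 \<le> \<tau> 0" "\<forall>i<2. \<tau> i \<le> \<tau> (Suc i)" using s that by (auto simp: \<tau>_def)
    then have ind: "indep_vars (\<lambda>_. borel) (\<lambda>i \<omega>. W (\<tau> (Suc i)) \<omega> - W (\<tau> i) \<omega>) {..<2}"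
      using W unfolding wiener_process_def by blast
    have int: "integrable M (\<lambda>\<omega>. W (\<tau> (Suc i)) \<omega> - W (\<tau> i) \<omega>)" if "i < 2" for i
      using sq s \<open>s \<le> t\<close> by (intro Bochner_Integration.integrable_diff square_integrable_integrable) (auto simp: \<tau>_def)
    have "expectation (\<lambda>\<omega>. \<Prod>i<2. W (\<tau> (Suc i)) \<omega> - W (\<tau> i) \<omega>)
       = (\<Prod>i<2. expectation (\<lambda>\<omega>. W (\<tau> (Suc i)) \<omega> - W (\<tau> i) \<omega>))"
      by (rule indep_vars_lebesgue_integral[OF _ ind]) (use int in auto)
    then have 0: "expectation (\<lambda>\<omega>. (W s \<omega> - W 0 \<omega>) * (W t \<omega> - W s \<omega>)) = 0"
      using wiener_process_increment(2)[OF W s True]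
      by (simp add: numeral_2_eq_2 \<tau>_def lessThan_Suc mult.commute)
    have "expectation (\<lambda>\<omega>. W s \<omega> * W t \<omega>)
      = expectation (\<lambda>\<omega>. (W s \<omega>)\<^sup>2 + (W s \<omega> - W 0 \<omega>) * (W t \<omega> - W s \<omega>))"
    proof (rule integral_cong_AE)
      show "AE \<omega> in M. W s \<omega> * W t \<omega> = (W s \<omega>)\<^sup>2 + (W s \<omega> - W 0 \<omega>) * (W t \<omega> - W s \<omega>)"
        using W0 by eventually_elim (simp add: power2_eq_square algebra_simps)
    next
      have [measurable]: "W s \<in> borel_measurable M" "W t \<in> borel_measurable M" "W 0 \<in> borel_measurable M"
        using Wm s that by auto
      show "(\<lambda>\<omega>. W s \<omega> * W t \<omega>) \<in> borel_measurable M"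
        "(\<lambda>\<omega>. (W s \<omega>)\<^sup>2 + (W s \<omega> - W 0 \<omega>) * (W t \<omega> - W s \<omega>)) \<in> borel_measurable M"
        by measurable
    qed
    also have "\<dots> = expectation (\<lambda>\<omega>. (W s \<omega>)\<^sup>2) + expectation (\<lambda>\<omega>. (W s \<omega> - W 0 \<omega>) * (W t \<omega> - W s \<omega>))"
      using s that
      by (intro Bochner_Integration.integral_add square_integrable_power2 square_integrable_integrable_mult
            square_integrable_diff sq) auto
    finally show ?thesis using 0 var[OF s] by simp
  next
    case False
    then show ?thesis using that var[OF s] by (simp add: power2_eq_square)
  qed
qed

lemma (in prob_space) independent_wiener_covariance:
  assumes B: "independent_wiener_processes M n B" and i: "i < n" and j: "j < n" and s: "0 \<le> s" and t: "0 \<le> t"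
  shows "expectation (\<lambda>\<omega>. B i s \<omega> * B j t \<omega>) = (if i = j then min s t else 0)"
proof (cases "i = j")
  case True
  have W: "wiener_process M (B i)" using B i unfolding independent_wiener_processes_def by blast
  show ?thesis
    using wiener_process_moments(3)[OF W s, of t] wiener_process_moments(3)[OF W t, of s] True
    by (cases "s \<le> t") (auto simp: mult.commute)
next
  case False
  have W: "wiener_process M (B i)" "wiener_process M (B j)"
    using B i j unfolding independent_wiener_processes_def by blast+
  define u where "u = (\<lambda>k. if k = i then s else t)"
  have "indep_vars (\<lambda>_. PiM {0..} (\<lambda>_. borel)) (\<lambda>i \<omega>. \<lambda>t\<in>{0..}. B i t \<omega>) {..<n}"
    using B unfolding independent_wiener_processes_def by blast
  then have "indep_vars (\<lambda>_. borel) (\<lambda>k \<omega>. (\<lambda>t\<in>{0..}. B k t \<omega>) (u k)) {..<n}"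
    by (rule indep_vars_compose2[where Y = "\<lambda>k f. f (u k)"])
       (use s t in \<open>auto simp: u_def intro!: measurable_component_singleton\<close>)
  then have "indep_vars (\<lambda>_. borel) (\<lambda>k \<omega>. (\<lambda>t\<in>{0..}. B k t \<omega>) (u k)) {i, j}"
    by (rule indep_vars_subset) (use i j in auto)
  moreover have "(\<lambda>k \<omega>. (\<lambda>t\<in>{0..}. B k t \<omega>) (u k)) = (\<lambda>k. B k (u k))"
    using s t by (auto simp: u_def fun_eq_iff)
  ultimately have ind: "indep_vars (\<lambda>_. borel) (\<lambda>k. B k (u k)) {i, j}" by simp
  have "expectation (\<lambda>\<omega>. \<Prod>k\<in>{i, j}. B k (u k) \<omega>) = (\<Prod>k\<in>{i, j}. expectation (B k (u k)))"
    by (rule indep_vars_lebesgue_integral[OF _ ind])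
       (use False W s t wiener_process_moments(1) in \<open>auto simp: u_def intro!: square_integrable_integrable\<close>)
  then show ?thesis
    using False wiener_process_moments(2)[OF W(1) s] by (simp add: u_def)
qed

text \<open>
Setting the processes to \<open>0\<close> on a null set that contains all sample points with a
discontinuous path changes no second moment.
\<close>

lemma (in prob_space) wiener_noise_version:
  assumes B: "independent_wiener_processes M n B"
  obtains B' where "wiener_noise M n B'" "AE \<omega> in M. \<forall>i<n. \<forall>t. B' i t \<omega> = B i t \<omega>"
proof -
  have W: "wiener_process M (B i)" if "i < n" for i
    using B that unfolding independent_wiener_processes_def by blast
  have "AE \<omega> in M. \<forall>i\<in>{..<n}. continuous_on {0..} (\<lambda>t. B i t \<omega>)"
    by (rule AE_finite_allI) (use W in \<open>auto simp: wiener_process_def continuous_process_def\<close>)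
  from AE_E[OF this] obtain N where N:
    "{\<omega> \<in> space M. \<not> (\<forall>i\<in>{..<n}. continuous_on {0..} (\<lambda>t. B i t \<omega>))} \<subseteq> N" "emeasure M N = 0" "N \<in> sets M" .
  define B' where "B' = (\<lambda>i t \<omega>. if \<omega> \<in> space M - N then B i t \<omega> else 0)"
  have ae: "AE \<omega> in M. \<forall>i<n. \<forall>t. B' i t \<omega> = B i t \<omega>"
    using AE_not_in[of N M] N AE_space by (auto simp: B'_def null_setsI elim!: eventually_elim2)
  have B'm: "B' i t \<in> borel_measurable M" if "i < n" "t \<ge> 0" for i t
  proof -
    have "B i t \<in> borel_measurable M"
      using W[OF that(1)] that(2) by (auto simp: wiener_process_def continuous_process_def)
    moreover have "{\<omega> \<in> space M. \<omega> \<in> space M - N} \<in> sets M"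
    proof -
      have "{\<omega> \<in> space M. \<omega> \<in> space M - N} = space M - N" by auto
      then show ?thesis using N(3) by simp
    qed
    ultimately show ?thesis unfolding B'_def by (intro measurable_If) auto
  qed
  have "wiener_noise M n B'"
  proof (unfold_locales)
    fix i t assume i: "i < n" and t: "(0::real) \<le> t"
    show "square_integrable M (B' i t)"
      using wiener_process_moments(1)[OF W[OF i] t] by (rule square_integrable_cong_AE) (use ae i B'm t in auto)
  next
    fix i \<omega> assume i: "i < n"
    show "continuous_on {0..} (\<lambda>t. B' i t \<omega>)"
      using N(1) i by (cases "\<omega> \<in> space M - N") (auto simp: B'_def)
  next
    fix i j and s t :: real assume *: "i < n" "j < n" "0 \<le> s" "0 \<le> t"
    have "expectation (\<lambda>\<omega>. B' i s \<omega> * B' j t \<omega>) = expectation (\<lambda>\<omega>. B i s \<omega> * B j t \<omega>)"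
    proof (rule integral_cong_AE)
      show "AE \<omega> in M. B' i s \<omega> * B' j t \<omega> = B i s \<omega> * B j t \<omega>" using ae by eventually_elim (use * in auto)
      show "(\<lambda>\<omega>. B' i s \<omega> * B' j t \<omega>) \<in> borel_measurable M" using * B'm by (intro borel_measurable_times) auto
      show "(\<lambda>\<omega>. B i s \<omega> * B j t \<omega>) \<in> borel_measurable M"
        using * W by (intro borel_measurable_times) (auto simp: wiener_process_def continuous_process_def)
    qed
    then show "expectation (\<lambda>\<omega>. B' i s \<omega> * B' j t \<omega>) = (if i = j then min s t else 0)"
      using independent_wiener_covariance[OF B *] by simp
  qed
  then show thesis using ae that by blast
qed

lemma (in prob_space) expectation_mult_independent_noise:
  fixes u v :: "'a \<Rightarrow> real"
  assumes ind: "indep_set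
       (sets (vimage_algebra (space M) (\<lambda>\<omega>. (u \<omega>, v \<omega>)) borel))
       (sets (vimage_algebra (space M) (\<lambda>\<omega>. \<lambda>(i, t)\<in>I \<times> {0..}. B i t \<omega>) (PiM (I \<times> {0..}) (\<lambda>_. borel))))"
    and i: "i \<in> I" and t: "(0::real) \<le> t"
    and B: "square_integrable M (B i t)" "expectation (B i t) = 0"
    and f: "f \<in> borel_measurable (borel :: (real \<times> real) measure)" "square_integrable M (\<lambda>\<omega>. f (u \<omega>, v \<omega>))"
  shows "expectation (\<lambda>\<omega>. f (u \<omega>, v \<omega>) * B i t \<omega>) = 0"
proof -
  define U where "U = vimage_algebra (space M) (\<lambda>\<omega>. (u \<omega>, v \<omega>)) (borel :: (real \<times> real) measure)"
  define V where "V = vimage_algebra (space M) (\<lambda>\<omega>. \<lambda>(i, t)\<in>I \<times> {0..}. B i t \<omega>) (PiM (I \<times> {0..}) (\<lambda>_. borel))"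
  have [simp]: "space U = space M" "space V = space M" by (simp_all add: U_def V_def)
  have mU: "(\<lambda>\<omega>. f (u \<omega>, v \<omega>)) \<in> borel_measurable U"
    unfolding U_def by (rule measurable_compose[OF measurable_vimage_algebra1 f(1)]) auto
  have mV: "B i t \<in> borel_measurable V"
  proof -
    have "(\<lambda>\<omega>. (\<lambda>(i, t)\<in>I \<times> {0..}. B i t \<omega>) (i, t)) \<in> borel_measurable V"
      unfolding V_def
      by (rule measurable_compose[OF measurable_vimage_algebra1 measurable_component_singleton])
         (use i t in \<open>auto simp: space_PiM PiE_def extensional_def\<close>)
    then show ?thesis using i t by simp
  qed
  have "indep_var borel (\<lambda>\<omega>. f (u \<omega>, v \<omega>)) borel (B i t)"
    unfolding indep_var_eq
  proof (intro conjI)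
    show "random_variable borel (\<lambda>\<omega>. f (u \<omega>, v \<omega>))" "random_variable borel (B i t)"
      using B f by (auto dest: square_integrable_measurable)
    have "sigma_sets (space M) {(\<lambda>\<omega>. f (u \<omega>, v \<omega>)) -` A \<inter> space M |A. A \<in> sets borel} \<subseteq> sets U"
      using sets.sigma_sets_subset[of "{(\<lambda>\<omega>. f (u \<omega>, v \<omega>)) -` A \<inter> space M |A. A \<in> sets borel}" U]
        measurable_sets[OF mU] by auto
    moreover have "sigma_sets (space M) {B i t -` A \<inter> space M |A. A \<in> sets borel} \<subseteq> sets V"
      using sets.sigma_sets_subset[of "{B i t -` A \<inter> space M |A. A \<in> sets borel}" V]
        measurable_sets[OF mV] by auto
    ultimately show "indep_set (sigma_sets (space M) {(\<lambda>\<omega>. f (u \<omega>, v \<omega>)) -` A \<inter> space M |A. A \<in> sets borel})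
       (sigma_sets (space M) {B i t -` A \<inter> space M |A. A \<in> sets borel})"
      using ind unfolding indep_sets2_eq U_def[symmetric] V_def[symmetric] by blast
  qed
  then have "expectation (\<lambda>\<omega>. f (u \<omega>, v \<omega>) * B i t \<omega>) = expectation (\<lambda>\<omega>. f (u \<omega>, v \<omega>)) * expectation (B i t)"
    by (rule indep_var_lebesgue_integral) (use B f in \<open>auto intro: square_integrable_integrable\<close>)
  then show ?thesis using B by simp
qed

section \<open>Second moments of linear stochastic systems\<close>

text \<open>
A row of the matrix exponential of \<open>t F\<close>, up to the choice of its initial value: \<open>\<phi>' = \<phi> F\<close>.  It
evaluates the linear functional \<open>\<phi> 0\<close> of the state.
\<close>

definition decaying_row ::
  "nat \<Rightarrow> (nat \<Rightarrow> nat \<Rightarrow> real) \<Rightarrow> (nat \<Rightarrow> real \<Rightarrow> real) \<Rightarrow> (nat \<Rightarrow> real \<Rightarrow> real) \<Rightarrow> bool" where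
  "decaying_row m F \<phi> \<phi>' \<longleftrightarrow> (\<forall>k<m. exp_decaying (\<phi> k) \<and> C1_kernel (\<phi> k) (\<phi>' k) \<and>
     (\<forall>t\<ge>0. \<phi>' k t = (\<Sum>l<m. \<phi> l t * F l k)))"

lemma decaying_row_kernel:
  assumes "decaying_row m F \<phi> \<phi>'"
  shows "C1_kernel (\<lambda>t. \<Sum>k<m. \<phi> k t * g k) (\<lambda>t. \<Sum>k<m. \<phi>' k t * g k)"
    and "exp_decaying (\<lambda>t. \<Sum>k<m. \<phi> k t * g k)"
proof -
  have \<phi>: "exp_decaying (\<phi> k)" "C1_kernel (\<phi> k) (\<phi>' k)" if "k < m" for k
    using assms that unfolding decaying_row_def by blast+
  show "C1_kernel (\<lambda>t. \<Sum>k<m. \<phi> k t * g k) (\<lambda>t. \<Sum>k<m. \<phi>' k t * g k)"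
    unfolding C1_kernel_def
    by (intro conjI allI impI continuous_intros C1_kernelD(1)[OF \<phi>(2)] DERIV_sum DERIV_cmult_right C1_kernelD(2)[OF \<phi>(2)]) auto
  have "exp_decaying (\<lambda>t. \<Sum>k\<in>I. \<phi> k t * g k)" if "finite I" "I \<subseteq> {..<m}" for I
    using that
  proof (induction I rule: finite_induct)
    case (insert k I)
    then show ?case
      using exp_decaying_add[OF exp_decaying_cmult[OF \<phi>(1), of k "g k"]] by (simp add: mult.commute)
  qed (simp add: exp_decaying_zero)
  then show "exp_decaying (\<lambda>t. \<Sum>k<m. \<phi> k t * g k)" by simp
qed

context wiener_noise
begin

definition linear_sde ::
  "nat \<Rightarrow> (nat \<Rightarrow> nat \<Rightarrow> real) \<Rightarrow> (nat \<Rightarrow> nat \<Rightarrow> real) \<Rightarrow> (nat \<Rightarrow> real \<Rightarrow> 'w \<Rightarrow> real) \<Rightarrow> bool" where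
  "linear_sde m F G Y \<longleftrightarrow>
     (\<forall>k<m. square_integrable M (Y k 0) \<and> (\<forall>t\<ge>0. Y k t \<in> borel_measurable M)) \<and>
     (AE \<omega> in M. \<forall>k<m. continuous_on {0..} (\<lambda>t. Y k t \<omega>) \<and>
        (\<forall>t\<ge>0. Y k t \<omega> = Y k 0 \<omega> + integral {0..t} (\<lambda>s. \<Sum>j<m. F k j * Y j s \<omega>) + (\<Sum>i<n. G k i * B i t \<omega>)))"

lemma linear_sde_observable:
  assumes Y: "linear_sde m F G Y" and \<phi>: "decaying_row m F \<phi> \<phi>'" and t: "t \<ge> 0"
  shows "AE \<omega> in M. (\<Sum>k<m. \<phi> k 0 * Y k t \<omega>) = (\<Sum>k<m. \<phi> k t * Y k 0 \<omega>)
    + response (\<lambda>i t. \<Sum>k<m. \<phi> k t * G k i) (\<lambda>i t. \<Sum>k<m. \<phi>' k t * G k i) t \<omega>"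
proof -
  have "AE \<omega> in M. \<forall>k<m. continuous_on {0..} (\<lambda>t. Y k t \<omega>) \<and>
        (\<forall>t\<ge>0. Y k t \<omega> = Y k 0 \<omega> + integral {0..t} (\<lambda>s. \<Sum>j<m. F k j * Y j s \<omega>) + (\<Sum>i<n. G k i * B i t \<omega>))"
    using Y unfolding linear_sde_def by blast
  then show ?thesis
  proof eventually_elim
    case (elim \<omega>)
    show ?case
      unfolding response_def path_def
    proof (rule linear_system_solution[where Y = "\<lambda>k t. Y k t \<omega>" and b = "\<lambda>i t. B i t \<omega>" and F = F and G = G, OF t])
      show "continuous_on {0..} (\<lambda>t. B i t \<omega>)" if "i < n" for i by (rule B_continuous[OF that])
      fix k assume k: "k < m"
      show "continuous_on {0..} (\<lambda>t. Y k t \<omega>)" using elim k by blast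
      have \<phi>k: "C1_kernel (\<phi> k) (\<phi>' k)" using \<phi> k unfolding decaying_row_def by blast
      show "continuous_on {0..} (\<phi>' k)" by (rule C1_kernelD(1)[OF \<phi>k])
      fix t :: real assume t: "t \<ge> 0"
      show "Y k t \<omega> = Y k 0 \<omega> + integral {0..t} (\<lambda>s. \<Sum>j<m. F k j * Y j s \<omega>) + (\<Sum>i<n. G k i * B i t \<omega>)"
        using elim k t by blast
      show "(\<phi> k has_real_derivative \<phi>' k t) (at t within {0..})" by (rule C1_kernelD(2)[OF \<phi>k t])
      show "\<phi>' k t = (\<Sum>l<m. \<phi> l t * F l k)" using \<phi> k t unfolding decaying_row_def by blast
    qed
  qed
qed

lemma linear_sde_measurable:
  assumes "linear_sde m F G Y" "k < m"
  shows "square_integrable M (Y k 0)" "t \<ge> 0 \<Longrightarrow> Y k t \<in> borel_measurable M"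
  using assms unfolding linear_sde_def by blast+

lemma linear_sde_square_integrable:
  assumes Y: "linear_sde m F G Y" and \<phi>: "decaying_row m F \<phi> \<phi>'" and t: "t \<ge> 0"
  shows "square_integrable M (\<lambda>\<omega>. \<Sum>k<m. \<phi> k 0 * Y k t \<omega>)"
proof (rule square_integrable_cong_AE[OF _ linear_sde_observable[OF Y \<phi> t]])
  show "square_integrable M (\<lambda>\<omega>. (\<Sum>k<m. \<phi> k t * Y k 0 \<omega>)
    + response (\<lambda>i t. \<Sum>k<m. \<phi> k t * G k i) (\<lambda>i t. \<Sum>k<m. \<phi>' k t * G k i) t \<omega>)"
    by (intro square_integrable_add square_integrable_sum square_integrable_cmult
      response_square_integrable decaying_row_kernel[OF \<phi>] t linear_sde_measurable(1)[OF Y]) simp_all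
  show "(\<lambda>\<omega>. \<Sum>k<m. \<phi> k 0 * Y k t \<omega>) \<in> borel_measurable M"
    by (intro borel_measurable_sum borel_measurable_times borel_measurable_const linear_sde_measurable(2)[OF Y] t) simp_all
qed

lemma linear_sde_second_moments_tendsto:
  assumes Y: "linear_sde m F G Y" and \<phi>: "decaying_row m F \<phi> \<phi>'" and \<eta>: "decaying_row m F \<eta> \<eta>'"
  shows "((\<lambda>t. expectation (\<lambda>\<omega>. (\<Sum>k<m. \<phi> k 0 * Y k t \<omega>) * (\<Sum>k<m. \<eta> k 0 * Y k t \<omega>))) \<longlongrightarrow>
    (\<Sum>i<n. half_line_integral (\<lambda>t. (\<Sum>k<m. \<phi> k t * G k i) * (\<Sum>k<m. \<eta> k t * G k i)))) at_top"
proof (rule second_moments_tendsto[where m = m and r = \<phi> and q = \<eta> and \<zeta> = "\<lambda>k. Y k 0"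
    and h = "\<lambda>i t. \<Sum>k<m. \<phi> k t * G k i" and h' = "\<lambda>i t. \<Sum>k<m. \<phi>' k t * G k i"
    and g = "\<lambda>i t. \<Sum>k<m. \<eta> k t * G k i" and g' = "\<lambda>i t. \<Sum>k<m. \<eta>' k t * G k i"])
  fix t :: real assume t: "t \<ge> 0"
  show "AE \<omega> in M. (\<Sum>k<m. \<phi> k 0 * Y k t \<omega>) = (\<Sum>k<m. \<phi> k t * Y k 0 \<omega>)
    + response (\<lambda>i t. \<Sum>k<m. \<phi> k t * G k i) (\<lambda>i t. \<Sum>k<m. \<phi>' k t * G k i) t \<omega>"
    by (rule linear_sde_observable[OF Y \<phi> t])
  show "AE \<omega> in M. (\<Sum>k<m. \<eta> k 0 * Y k t \<omega>) = (\<Sum>k<m. \<eta> k t * Y k 0 \<omega>)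
    + response (\<lambda>i t. \<Sum>k<m. \<eta> k t * G k i) (\<lambda>i t. \<Sum>k<m. \<eta>' k t * G k i) t \<omega>"
    by (rule linear_sde_observable[OF Y \<eta> t])
  show "(\<lambda>\<omega>. \<Sum>k<m. \<phi> k 0 * Y k t \<omega>) \<in> borel_measurable M" "(\<lambda>\<omega>. \<Sum>k<m. \<eta> k 0 * Y k t \<omega>) \<in> borel_measurable M"
    using linear_sde_square_integrable[OF Y _ t] \<phi> \<eta> square_integrable_measurable by blast+
next
  fix k assume k: "k < m"
  show "(\<phi> k \<longlongrightarrow> 0) at_top" "(\<eta> k \<longlongrightarrow> 0) at_top"
    using \<phi> \<eta> k by (auto simp: decaying_row_def intro!: exp_decaying_tendsto_0)
  show "square_integrable M (Y k 0)" by (rule linear_sde_measurable(1)[OF Y k])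
qed (rule decaying_row_kernel[OF \<phi>] decaying_row_kernel[OF \<eta>])+

text \<open>
The noise after a time \<open>a\<close>; it drives the system restarted at \<open>a\<close>.
\<close>

lemma wiener_noise_shift:
  assumes a: "a \<ge> 0"
  shows "wiener_noise M n (\<lambda>i t. \<lambda>\<omega>. B i (a + t) \<omega> - B i a \<omega>)"
proof unfold_locales
  fix i t assume i: "i < n" and t: "(0::real) \<le> t"
  show "square_integrable M (\<lambda>\<omega>. B i (a + t) \<omega> - B i a \<omega>)"
    using i t a by (intro square_integrable_diff B_square_integrable) auto
next
  fix i \<omega> assume i: "i < n"
  show "continuous_on {0..} (\<lambda>t. B i (a + t) \<omega> - B i a \<omega>)"
    using a by (intro continuous_intros continuous_on_compose2[OF B_continuous[OF i, of \<omega>]]) auto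
next
  fix i j and s t :: real assume *: "i < n" "j < n" "0 \<le> s" "0 \<le> t"
  note sq = B_square_integrable[OF *(1)] B_square_integrable[OF *(2)]
  have int: "integrable M (\<lambda>\<omega>. B i u \<omega> * B j v \<omega>)" if "u \<ge> 0" "v \<ge> 0" for u v
    by (rule square_integrable_integrable_mult[OF sq(1)[OF that(1)] sq(2)[OF that(2)]])
  have "expectation (\<lambda>\<omega>. (B i (a + s) \<omega> - B i a \<omega>) * (B j (a + t) \<omega> - B j a \<omega>))
    = expectation (\<lambda>\<omega>. B i (a + s) \<omega> * B j (a + t) \<omega> - B i (a + s) \<omega> * B j a \<omega>
        - B i a \<omega> * B j (a + t) \<omega> + B i a \<omega> * B j a \<omega>)"
    by (simp add: algebra_simps)
  also have "\<dots> = expectation (\<lambda>\<omega>. B i (a + s) \<omega> * B j (a + t) \<omega>) - expectation (\<lambda>\<omega>. B i (a + s) \<omega> * B j a \<omega>)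
        - expectation (\<lambda>\<omega>. B i a \<omega> * B j (a + t) \<omega>) + expectation (\<lambda>\<omega>. B i a \<omega> * B j a \<omega>)"
    using a * by (simp add: int)
  also have "\<dots> = (if i = j then min s t else 0)"
    using a * by (simp add: B_covariance min_def)
  finally show "expectation (\<lambda>\<omega>. (B i (a + s) \<omega> - B i a \<omega>) * (B j (a + t) \<omega> - B j a \<omega>))
    = (if i = j then min s t else 0)" .
qed

text \<open>
An observable at time \<open>t\<close> is a combination of the initial values and of the noise up to \<open>t\<close>, and
increments after \<open>t\<close> are uncorrelated with both.
\<close>

lemma expectation_observable_mult_future_noise:
  assumes Y: "linear_sde m F G Y" and \<phi>: "decaying_row m F \<phi> \<phi>'" and t: "t \<ge> 0" and s: "s \<ge> 0" and j: "j < n"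
    and ortho: "\<And>k i t. k < m \<Longrightarrow> i < n \<Longrightarrow> t \<ge> 0 \<Longrightarrow> expectation (\<lambda>\<omega>. Y k 0 \<omega> * B i t \<omega>) = 0"
  shows "expectation (\<lambda>\<omega>. (\<Sum>k<m. \<phi> k 0 * Y k t \<omega>) * (B j (t + s) \<omega> - B j t \<omega>)) = 0"
proof -
  define U where "U = (\<lambda>\<omega>. B j (t + s) \<omega> - B j t \<omega>)"
  define h where "h = (\<lambda>i t. \<Sum>k<m. \<phi> k t * G k i)"
  define h' where "h' = (\<lambda>i t. \<Sum>k<m. \<phi>' k t * G k i)"
  have h: "C1_kernel (h i) (h' i)" for i unfolding h_def h'_def by (rule decaying_row_kernel[OF \<phi>])
  note Y0 = linear_sde_measurable(1)[OF Y]
  have U: "square_integrable M U"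
    unfolding U_def using t s j by (intro square_integrable_diff B_square_integrable) auto
  have UB: "expectation (\<lambda>\<omega>. U \<omega> * B i u \<omega>) = 0" if "i < n" "0 \<le> u" "u \<le> t" for i u
  proof -
    have "expectation (\<lambda>\<omega>. U \<omega> * B i u \<omega>) = expectation (\<lambda>\<omega>. B j (t + s) \<omega> * B i u \<omega> - B j t \<omega> * B i u \<omega>)"
      by (simp add: U_def algebra_simps)
    also have "\<dots> = expectation (\<lambda>\<omega>. B j (t + s) \<omega> * B i u \<omega>) - expectation (\<lambda>\<omega>. B j t \<omega> * B i u \<omega>)"
      using j t s that by (intro Bochner_Integration.integral_diff square_integrable_integrable_mult B_square_integrable) auto
    finally show ?thesis using j t s that by (simp add: B_covariance min_def)
  qed
  have UY: "expectation (\<lambda>\<omega>. U \<omega> * Y k 0 \<omega>) = 0" if "k < m" for k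
  proof -
    have "expectation (\<lambda>\<omega>. U \<omega> * Y k 0 \<omega>) = expectation (\<lambda>\<omega>. Y k 0 \<omega> * B j (t + s) \<omega> - Y k 0 \<omega> * B j t \<omega>)"
      by (simp add: U_def algebra_simps)
    also have "\<dots> = expectation (\<lambda>\<omega>. Y k 0 \<omega> * B j (t + s) \<omega>) - expectation (\<lambda>\<omega>. Y k 0 \<omega> * B j t \<omega>)"
      using j t s that by (intro Bochner_Integration.integral_diff square_integrable_integrable_mult B_square_integrable Y0) auto
    finally show ?thesis using ortho[OF that j] t s by simp
  qed
  have "expectation (\<lambda>\<omega>. (\<Sum>k<m. \<phi> k 0 * Y k t \<omega>) * U \<omega>)
      = expectation (\<lambda>\<omega>. (\<Sum>k<m. \<phi> k t * (U \<omega> * Y k 0 \<omega>)) + U \<omega> * response h h' t \<omega>)"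
  proof (rule integral_cong_AE)
    show "AE \<omega> in M. (\<Sum>k<m. \<phi> k 0 * Y k t \<omega>) * U \<omega> = (\<Sum>k<m. \<phi> k t * (U \<omega> * Y k 0 \<omega>)) + U \<omega> * response h h' t \<omega>"
      using linear_sde_observable[OF Y \<phi> t] unfolding h_def[symmetric] h'_def[symmetric]
      by eventually_elim (simp add: algebra_simps sum_distrib_left)
    show "(\<lambda>\<omega>. (\<Sum>k<m. \<phi> k 0 * Y k t \<omega>) * U \<omega>) \<in> borel_measurable M"
      using linear_sde_square_integrable[OF Y \<phi> t] U by (intro borel_measurable_times square_integrable_measurable)
    show "(\<lambda>\<omega>. (\<Sum>k<m. \<phi> k t * (U \<omega> * Y k 0 \<omega>)) + U \<omega> * response h h' t \<omega>) \<in> borel_measurable M"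
      using U Y0 response_square_integrable[OF h t]
      by (intro borel_measurable_add borel_measurable_sum borel_measurable_times borel_measurable_const square_integrable_measurable) auto
  qed
  also have "\<dots> = (\<Sum>k<m. \<phi> k t * expectation (\<lambda>\<omega>. U \<omega> * Y k 0 \<omega>)) + expectation (\<lambda>\<omega>. U \<omega> * response h h' t \<omega>)"
  proof -
    have i: "integrable M (\<lambda>\<omega>. U \<omega> * Y k 0 \<omega>)" if "k \<in> {..<m}" for k
      using that by (intro square_integrable_integrable_mult U Y0) simp
    have "integrable M (\<lambda>\<omega>. U \<omega> * response h h' t \<omega>)"
      by (intro square_integrable_integrable_mult U response_square_integrable h t)
    moreover have "integrable M (\<lambda>\<omega>. \<Sum>k<m. \<phi> k t * (U \<omega> * Y k 0 \<omega>))"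
      by (intro Bochner_Integration.integrable_sum integrable_mult_right i)
    moreover have "expectation (\<lambda>\<omega>. \<Sum>k<m. \<phi> k t * (U \<omega> * Y k 0 \<omega>)) = (\<Sum>k<m. \<phi> k t * expectation (\<lambda>\<omega>. U \<omega> * Y k 0 \<omega>))"
      by (subst Bochner_Integration.integral_sum) (auto intro!: integrable_mult_right i)
    ultimately show ?thesis by simp
  qed
  also have "expectation (\<lambda>\<omega>. U \<omega> * response h h' t \<omega>) = (\<Sum>i<n. 0)"
    unfolding expectation_mult_response[OF h t U]
  proof (intro sum.cong refl)
    fix i assume "i \<in> {..<n}"
    then have i: "i < n" by simp
    have "integral {0..t} (\<lambda>u. h' i (t - u) * expectation (\<lambda>\<omega>. U \<omega> * B i u \<omega>)) = integral {0..t} (\<lambda>u. 0)"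
      using UB[OF i] by (intro integral_cong) auto
    then show "expectation (\<lambda>\<omega>. U \<omega> * noise_response (h i) (h' i) (path i \<omega>) t) = 0"
      unfolding expectation_mult_noise_response[OF h i t U] using UB[OF i t] by simp
  qed
  finally show ?thesis using UY by (simp add: U_def)
qed

end

lemma integral_shift_from_zero:
  fixes f :: "real \<Rightarrow> real"
  assumes f: "continuous_on {0..} f" and a: "a \<ge> 0" and t: "t \<ge> 0"
  shows "integral {0..t} (\<lambda>s. f (a + s)) = integral {0..a + t} f - integral {0..a} f"
proof -
  have "integral {0..t} (\<lambda>s. f (a + s)) = integral {0..a + t} f - integral {0..a + 0} f"
  proof (rule integral_eq_diff_of_deriv[OF t])
    fix s assume s: "s \<in> {0..t}"
    have "((\<lambda>u. integral {0..u} f) has_real_derivative f (a + s)) (at (a + s) within {0..a + t})"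
      by (rule has_derivative_integral_upper) (use s a in \<open>auto intro: continuous_on_subset[OF f]\<close>)
    then have "((\<lambda>u. integral {0..u} f) has_real_derivative f (a + s)) (at (a + s) within (\<lambda>s. a + s) ` {0..t})"
      by (rule DERIV_subset) (use a in auto)
    moreover have "((\<lambda>s. a + s) has_real_derivative 1) (at s within {0..t})"
      by (auto intro!: derivative_eq_intros)
    ultimately show "((\<lambda>s. integral {0..a + s} f) has_real_derivative f (a + s)) (at s within {0..t})"
      using DERIV_image_chain[of "\<lambda>u. integral {0..u} f" "f (a + s)" "\<lambda>s. a + s" s "{0..t}" 1] by (simp add: o_def)
  qed
  then show ?thesis by simp
qed

lemma (in wiener_noise) linear_sde_shift:
  assumes Y: "linear_sde m F G Y" and a: "a \<ge> 0" and sq: "\<And>k. k < m \<Longrightarrow> square_integrable M (Y k a)"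
  shows "wiener_noise.linear_sde M n (\<lambda>i t \<omega>. B i (a + t) \<omega> - B i a \<omega>) m F G (\<lambda>k t. Y k (a + t))"
proof -
  interpret S: wiener_noise M n "\<lambda>i t \<omega>. B i (a + t) \<omega> - B i a \<omega>" by (rule wiener_noise_shift[OF a])
  have "AE \<omega> in M. \<forall>k<m. continuous_on {0..} (\<lambda>t. Y k t \<omega>) \<and>
        (\<forall>t\<ge>0. Y k t \<omega> = Y k 0 \<omega> + integral {0..t} (\<lambda>s. \<Sum>j<m. F k j * Y j s \<omega>) + (\<Sum>i<n. G k i * B i t \<omega>))"
    using Y unfolding linear_sde_def by blast
  then have "AE \<omega> in M. \<forall>k<m. continuous_on {0..} (\<lambda>t. Y k (a + t) \<omega>) \<and>
        (\<forall>t\<ge>0. Y k (a + t) \<omega> = Y k (a + 0) \<omega> + integral {0..t} (\<lambda>s. \<Sum>j<m. F k j * Y j (a + s) \<omega>)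
          + (\<Sum>i<n. G k i * (B i (a + t) \<omega> - B i a \<omega>)))"
  proof eventually_elim
    case (elim \<omega>)
    show ?case
    proof (intro allI impI conjI)
      fix k assume k: "k < m"
      show "continuous_on {0..} (\<lambda>t. Y k (a + t) \<omega>)"
        using elim k a by (intro continuous_on_compose2[of "{0..}" "\<lambda>t. Y k t \<omega>" _ "\<lambda>t. a + t"] continuous_intros) auto
      fix t :: real assume t: "0 \<le> t"
      have "continuous_on {0..} (\<lambda>s. \<Sum>j<m. F k j * Y j s \<omega>)"
        using elim by (intro continuous_intros) auto
      from integral_shift_from_zero[OF this a t]
      have 1: "integral {0..t} (\<lambda>s. \<Sum>j<m. F k j * Y j (a + s) \<omega>)
        = integral {0..a + t} (\<lambda>s. \<Sum>j<m. F k j * Y j s \<omega>) - integral {0..a} (\<lambda>s. \<Sum>j<m. F k j * Y j s \<omega>)" .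
      have 2: "Y k u \<omega> = Y k 0 \<omega> + integral {0..u} (\<lambda>s. \<Sum>j<m. F k j * Y j s \<omega>) + (\<Sum>i<n. G k i * B i u \<omega>)"
        if "u \<ge> 0" for u using elim k that by blast
      show "Y k (a + t) \<omega> = Y k (a + 0) \<omega> + integral {0..t} (\<lambda>s. \<Sum>j<m. F k j * Y j (a + s) \<omega>)
          + (\<Sum>i<n. G k i * (B i (a + t) \<omega> - B i a \<omega>))"
        using 2[of "a + t"] 2[of a] a t unfolding 1 by (simp add: right_diff_distrib sum_subtractf)
    qed
  qed
  then show ?thesis
    using linear_sde_measurable(2)[OF Y] a sq unfolding S.linear_sde_def by simp
qed

section \<open>Equilibrium statistics of the signal\<close>

definition planar :: "real \<Rightarrow> real \<Rightarrow> real \<Rightarrow> real \<Rightarrow> nat \<Rightarrow> nat \<Rightarrow> real" where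
  "planar a b c d k j = (if k = 0 then (if j = 0 then a else b) else (if j = 0 then c else d))"

definition diagonal_noise :: "real \<Rightarrow> real \<Rightarrow> nat \<Rightarrow> nat \<Rightarrow> real" where
  "diagonal_noise p q k i = (if i = k then (if k = 0 then p else q) else 0)"

lemma sum_less_2: "(\<Sum>k<2. f k) = f 0 + f (1::nat)" for f :: "nat \<Rightarrow> real"
  by (simp add: numeral_2_eq_2)

lemma sum_less_3: "(\<Sum>k<3. f k) = f 0 + f 1 + f (2::nat)" for f :: "nat \<Rightarrow> real"
  by (simp add: numeral_3_eq_3 numeral_2_eq_2)

lemma second_order_odeD:
  assumes "second_order_ode T D f u v"
  shows "exp_decaying f" "exp_decaying u" "exp_decaying v"
    and "t \<ge> 0 \<Longrightarrow> (u has_real_derivative v t) (at t within {0..})"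
    and "t \<ge> 0 \<Longrightarrow> (v has_real_derivative (- T * v t - D * u t + f t)) (at t within {0..})"
  using assms unfolding second_order_ode_def by blast+

text \<open>
By the Cayley-Hamilton theorem both rows of the matrix exponential are combinations of the
solution \<open>\<psi>\<close> of the characteristic equation with \<open>\<psi> 0 = 0\<close>, \<open>\<psi>' 0 = 1\<close>, and its derivative.
\<close>

lemma planar_rows:
  fixes a b c d :: real
  assumes ode: "second_order_ode (- (a + d)) (a * d - b * c) (\<lambda>_. 0) \<psi> \<psi>'"
  shows "decaying_row 2 (planar a b c d)
      (\<lambda>k t. if k = 0 then \<psi>' t - d * \<psi> t else b * \<psi> t)
      (\<lambda>k t. if k = 0 then (a + d) * \<psi>' t - (a * d - b * c) * \<psi> t - d * \<psi>' t else b * \<psi>' t)"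
    and "decaying_row 2 (planar a b c d)
      (\<lambda>k t. if k = 0 then c * \<psi> t else \<psi>' t - a * \<psi> t)
      (\<lambda>k t. if k = 0 then c * \<psi>' t else (a + d) * \<psi>' t - (a * d - b * c) * \<psi> t - a * \<psi>' t)"
proof -
  note e = second_order_odeD(2,3)[OF ode]
  note d = second_order_odeD(4,5)[OF ode]
  note c = e[THEN exp_decaying_continuous]
  show "decaying_row 2 (planar a b c d)
      (\<lambda>k t. if k = 0 then \<psi>' t - d * \<psi> t else b * \<psi> t)
      (\<lambda>k t. if k = 0 then (a + d) * \<psi>' t - (a * d - b * c) * \<psi> t - d * \<psi>' t else b * \<psi>' t)"
    unfolding decaying_row_def less_2_cases_iff C1_kernel_def
    by (auto simp: sum_less_2 planar_def algebra_simps
        intro!: exp_decaying_diff exp_decaying_cmult e continuous_intros c derivative_eq_intros d)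
  show "decaying_row 2 (planar a b c d)
      (\<lambda>k t. if k = 0 then c * \<psi> t else \<psi>' t - a * \<psi> t)
      (\<lambda>k t. if k = 0 then c * \<psi>' t else (a + d) * \<psi>' t - (a * d - b * c) * \<psi> t - a * \<psi>' t)"
    unfolding decaying_row_def less_2_cases_iff C1_kernel_def
    by (auto simp: sum_less_2 planar_def algebra_simps
        intro!: exp_decaying_diff exp_decaying_cmult e continuous_intros c derivative_eq_intros d)
qed

lemma homogeneous_ode_integrals:
  assumes ode: "second_order_ode T D (\<lambda>_. 0) \<psi> \<psi>'" and init: "\<psi> 0 = 0" "\<psi>' 0 = 1" and TD: "T > 0" "D > 0"
  shows "half_line_integral (\<lambda>t. \<psi> t * \<psi>' t) = 0"
    and "half_line_integral (\<lambda>t. (\<psi>' t)\<^sup>2) = 1 / (2 * T)"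
    and "half_line_integral (\<lambda>t. (\<psi> t)\<^sup>2) = 1 / (2 * T * D)"
    and "half_line_integral \<psi>' = 0"
    and "half_line_integral \<psi> = 1 / D"
proof -
  note E = second_order_ode_energy[OF ode, unfolded init]
  show "half_line_integral (\<lambda>t. \<psi> t * \<psi>' t) = 0" using E(1) by simp
  show 2: "half_line_integral (\<lambda>t. (\<psi>' t)\<^sup>2) = 1 / (2 * T)" using E(2) TD by (simp add: field_simps)
  show "half_line_integral (\<lambda>t. (\<psi> t)\<^sup>2) = 1 / (2 * T * D)" using E(3) TD unfolding 2 by (simp add: field_simps)
  note e = second_order_odeD(2,3)[OF ode]
  note d = second_order_odeD(4,5)[OF ode]
  show 4: "half_line_integral \<psi>' = 0"
    using half_line_integral_deriv[OF e d(1)] init by simp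
  have "half_line_integral (\<lambda>t. - T * \<psi>' t - D * \<psi> t) = - \<psi>' 0"
    by (rule half_line_integral_deriv[OF e(2)])
       (intro exp_decaying_diff exp_decaying_cmult e, use d(2) in simp)
  moreover have "half_line_integral (\<lambda>t. - T * \<psi>' t - D * \<psi> t)
     = - T * half_line_integral \<psi>' - D * half_line_integral \<psi>"
    by (simp only: half_line_integral_linear exp_decaying_cmult e)
  ultimately show "half_line_integral \<psi> = 1 / D"
    unfolding 4 init using TD by (simp add: field_simps)
qed

context wiener_noise
begin

text \<open>
The variance \<open>C\<close> comes from the integrals of \<open>\<psi>\<close>.  For the correlation time, restart the system at
\<open>t\<close>: the noise after \<open>t\<close> is uncorrelated with \<open>x t\<close>, so the correlation function is the
first row of the matrix exponential applied to the second moments at \<open>t\<close>, and its integral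
over the delay involves the integral of that row only.
\<close>

lemma planar_signal_statistics:
  assumes n: "n = 3"
    and stable: "a + d < 0" "a * d - b * c > 0" and p: "p \<noteq> 0"
    and Y: "linear_sde 2 (planar a b c d) (diagonal_noise p q) Y"
    and ortho: "\<And>k i t. k < 2 \<Longrightarrow> i < n \<Longrightarrow> t \<ge> 0 \<Longrightarrow> expectation (\<lambda>\<omega>. Y k 0 \<omega> * B i t \<omega>) = 0"
  defines "T \<equiv> - (a + d)" and "D \<equiv> a * d - b * c"
  defines "C \<equiv> (p\<^sup>2 * (D + d\<^sup>2) + q\<^sup>2 * b\<^sup>2) / (2 * T * D)"
  shows "C > 0" and "equilibrium_variance M (Y 0) = C"
    and "correlation_time M (Y 0) = (p\<^sup>2 * d\<^sup>2 + q\<^sup>2 * b\<^sup>2) / (2 * D\<^sup>2 * C)"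
proof -
  have TD: "T > 0" "D > 0" using stable by (auto simp: T_def D_def)
  show C: "C > 0"
    unfolding C_def using TD p by (intro divide_pos_pos add_pos_nonneg mult_pos_pos) (auto intro: add_pos_nonneg)
  obtain \<psi> \<psi>' where \<psi>: "\<psi> 0 = 0" "\<psi>' 0 = 1" and ode: "second_order_ode T D (\<lambda>_. 0) \<psi> \<psi>'"
    using second_order_ode_exists[OF TD exp_decaying_zero, of 0 1] by blast
  define \<phi> where "\<phi> = (\<lambda>k t. if k = (0::nat) then \<psi>' t - d * \<psi> t else b * \<psi> t)"
  define \<phi>' where "\<phi>' = (\<lambda>k t. if k = (0::nat) then (a + d) * \<psi>' t - (a * d - b * c) * \<psi> t - d * \<psi>' t else b * \<psi>' t)"
  define \<eta> where "\<eta> = (\<lambda>k t. if k = (0::nat) then c * \<psi> t else \<psi>' t - a * \<psi> t)"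
  define \<eta>' where "\<eta>' = (\<lambda>k t. if k = (0::nat) then c * \<psi>' t else (a + d) * \<psi>' t - (a * d - b * c) * \<psi> t - a * \<psi>' t)"
  have \<phi>: "decaying_row 2 (planar a b c d) \<phi> \<phi>'" and \<eta>: "decaying_row 2 (planar a b c d) \<eta> \<eta>'"
    unfolding \<phi>_def \<phi>'_def \<eta>_def \<eta>'_def by (rule planar_rows[OF ode[unfolded T_def D_def]])+
  have obs: "(\<Sum>k<2. \<phi> k 0 * f k) = f 0" "(\<Sum>k<2. \<eta> k 0 * f k) = f 1" for f
    by (simp_all add: sum_less_2 \<phi>_def \<eta>_def \<psi>)
  note e = second_order_odeD(2,3)[OF ode]
  note i = exp_decaying_diff exp_decaying_add exp_decaying_cmult exp_decaying_mult exp_decaying_power2 e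
  note I = homogeneous_ode_integrals[OF ode \<psi> TD]
  have var: "((\<lambda>t. expectation (\<lambda>\<omega>. (Y 0 t \<omega>)\<^sup>2)) \<longlongrightarrow> C) at_top"
  proof -
    have "(\<Sum>i<n. half_line_integral (\<lambda>t. (\<Sum>k<2. \<phi> k t * diagonal_noise p q k i) * (\<Sum>k<2. \<phi> k t * diagonal_noise p q k i)))
      = half_line_integral (\<lambda>t. p\<^sup>2 * (\<psi>' t)\<^sup>2 + (- 2 * p\<^sup>2 * d) * (\<psi> t * \<psi>' t) + (p\<^sup>2 * d\<^sup>2) * (\<psi> t)\<^sup>2)
        + half_line_integral (\<lambda>t. (q\<^sup>2 * b\<^sup>2) * (\<psi> t)\<^sup>2)"
      by (simp add: n sum_less_3 sum_less_2 diagonal_noise_def \<phi>_def algebra_simps power2_eq_square)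
    also have "\<dots> = p\<^sup>2 * (1 / (2 * T)) + p\<^sup>2 * d\<^sup>2 * (1 / (2 * T * D)) + q\<^sup>2 * b\<^sup>2 * (1 / (2 * T * D))"
      by (simp only: half_line_integral_linear i I)
    also have "\<dots> = C" using TD by (simp add: C_def field_simps)
    finally show ?thesis
      using linear_sde_second_moments_tendsto[OF Y \<phi> \<phi>] unfolding obs by (simp add: power2_eq_square)
  qed
  have cov: "((\<lambda>t. expectation (\<lambda>\<omega>. Y 0 t \<omega> * Y 1 t \<omega>)) \<longlongrightarrow> - (p\<^sup>2 * d * c + q\<^sup>2 * a * b) / (2 * T * D)) at_top"
  proof -
    have "(\<Sum>i<n. half_line_integral (\<lambda>t. (\<Sum>k<2. \<phi> k t * diagonal_noise p q k i) * (\<Sum>k<2. \<eta> k t * diagonal_noise p q k i)))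
      = half_line_integral (\<lambda>t. (p\<^sup>2 * c) * (\<psi> t * \<psi>' t) + (- p\<^sup>2 * d * c) * (\<psi> t)\<^sup>2)
        + half_line_integral (\<lambda>t. (q\<^sup>2 * b) * (\<psi> t * \<psi>' t) + (- q\<^sup>2 * a * b) * (\<psi> t)\<^sup>2)"
      by (simp add: n sum_less_3 sum_less_2 diagonal_noise_def \<phi>_def \<eta>_def algebra_simps power2_eq_square)
    also have "\<dots> = - p\<^sup>2 * d * c * (1 / (2 * T * D)) + - q\<^sup>2 * a * b * (1 / (2 * T * D))"
      by (simp only: half_line_integral_linear i I)
    also have "\<dots> = - (p\<^sup>2 * d * c + q\<^sup>2 * a * b) / (2 * T * D)" using TD by (simp add: field_simps)
    finally show ?thesis
      using linear_sde_second_moments_tendsto[OF Y \<phi> \<eta>] unfolding obs by simp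
  qed
  show "equilibrium_variance M (Y 0) = C"
    unfolding equilibrium_variance_def by (rule tendsto_Lim[OF _ var]) simp
  have sq: "square_integrable M (Y k t)" if "t \<ge> 0" "k < 2" for k t
  proof -
    have "square_integrable M (Y 0 t)" "square_integrable M (Y 1 t)"
      using linear_sde_square_integrable[OF Y \<phi> that(1)] linear_sde_square_integrable[OF Y \<eta> that(1)]
      unfolding obs by auto
    then show ?thesis using that(2) by (auto simp: less_2_cases_iff)
  qed
  have corr: "expectation (\<lambda>\<omega>. Y 0 t \<omega> * Y 0 (t + \<tau>) \<omega>)
      = \<phi> 0 \<tau> * expectation (\<lambda>\<omega>. (Y 0 t \<omega>)\<^sup>2) + \<phi> 1 \<tau> * expectation (\<lambda>\<omega>. Y 0 t \<omega> * Y 1 t \<omega>)"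
    if t: "t \<ge> 0" and \<tau>: "\<tau> \<ge> 0" for t \<tau>
  proof -
    interpret S: wiener_noise M n "\<lambda>i s \<omega>. B i (t + s) \<omega> - B i t \<omega>" by (rule wiener_noise_shift[OF t])
    define h where "h = (\<lambda>i t. \<Sum>k<2. \<phi> k t * diagonal_noise p q k i)"
    define h' where "h' = (\<lambda>i t. \<Sum>k<2. \<phi>' k t * diagonal_noise p q k i)"
    have h: "C1_kernel (h i) (h' i)" for i unfolding h_def h'_def by (rule decaying_row_kernel[OF \<phi>])
    have "S.linear_sde 2 (planar a b c d) (diagonal_noise p q) (\<lambda>k s. Y k (t + s))"
      by (rule linear_sde_shift[OF Y t sq[OF t]])
    from S.linear_sde_observable[OF this \<phi> \<tau>]
    have rep: "AE \<omega> in M. Y 0 (t + \<tau>) \<omega> = \<phi> 0 \<tau> * Y 0 t \<omega> + \<phi> 1 \<tau> * Y 1 t \<omega> + S.response h h' \<tau> \<omega>"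
      unfolding obs h_def h'_def by (simp add: sum_less_2)
    have sqr: "square_integrable M (S.response h h' \<tau>)" by (rule S.response_square_integrable[OF h \<tau>])
    have future: "expectation (\<lambda>\<omega>. Y 0 t \<omega> * (B j (t + s) \<omega> - B j t \<omega>)) = 0" if "j < n" "s \<ge> 0" for j s
      using expectation_observable_mult_future_noise[OF Y \<phi> t that(2,1) ortho] unfolding obs by simp
    have 0: "expectation (\<lambda>\<omega>. Y 0 t \<omega> * S.response h h' \<tau> \<omega>) = 0"
    proof -
      have "expectation (\<lambda>\<omega>. Y 0 t \<omega> * S.response h h' \<tau> \<omega>) = (\<Sum>i<n. 0)"
        unfolding S.expectation_mult_response[OF h \<tau> sq[OF t zero_less_numeral]]
      proof (intro sum.cong refl)
        fix i assume "i \<in> {..<n}"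
        then have i: "i < n" by simp
        have "integral {0..\<tau>} (\<lambda>s. h' i (\<tau> - s) * expectation (\<lambda>\<omega>. Y 0 t \<omega> * (B i (t + s) \<omega> - B i t \<omega>)))
          = integral {0..\<tau>} (\<lambda>s. 0)"
          using future[OF i] by (intro integral_cong) auto
        then show "expectation (\<lambda>\<omega>. Y 0 t \<omega> * noise_response (h i) (h' i) (S.path i \<omega>) \<tau>) = 0"
          unfolding S.expectation_mult_noise_response[OF h i \<tau> sq[OF t zero_less_numeral]]
          using future[OF i \<tau>] by simp
      qed
      then show ?thesis by simp
    qed
    have sq0: "square_integrable M (Y 0 t)" and sq1: "square_integrable M (Y 1 t)" using sq t by auto
    note int = square_integrable_integrable_mult[OF sq0 sq0] square_integrable_integrable_mult[OF sq0 sq1]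
      square_integrable_integrable_mult[OF sq0 sqr]
    have "expectation (\<lambda>\<omega>. Y 0 t \<omega> * Y 0 (t + \<tau>) \<omega>)
      = expectation (\<lambda>\<omega>. \<phi> 0 \<tau> * (Y 0 t \<omega> * Y 0 t \<omega>) + \<phi> 1 \<tau> * (Y 0 t \<omega> * Y 1 t \<omega>) + Y 0 t \<omega> * S.response h h' \<tau> \<omega>)"
    proof (rule integral_cong_AE)
      show "AE \<omega> in M. Y 0 t \<omega> * Y 0 (t + \<tau>) \<omega>
        = \<phi> 0 \<tau> * (Y 0 t \<omega> * Y 0 t \<omega>) + \<phi> 1 \<tau> * (Y 0 t \<omega> * Y 1 t \<omega>) + Y 0 t \<omega> * S.response h h' \<tau> \<omega>"
        using rep by eventually_elim (simp add: algebra_simps)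
      have "square_integrable M (Y 0 (t + \<tau>))" using sq t \<tau> by simp
      then show "(\<lambda>\<omega>. Y 0 t \<omega> * Y 0 (t + \<tau>) \<omega>) \<in> borel_measurable M"
        using sq0 by (intro borel_measurable_times square_integrable_measurable)
      show "(\<lambda>\<omega>. \<phi> 0 \<tau> * (Y 0 t \<omega> * Y 0 t \<omega>) + \<phi> 1 \<tau> * (Y 0 t \<omega> * Y 1 t \<omega>) + Y 0 t \<omega> * S.response h h' \<tau> \<omega>) \<in> borel_measurable M"
        using int[THEN borel_measurable_integrable] by measurable
    qed
    also have "\<dots> = \<phi> 0 \<tau> * expectation (\<lambda>\<omega>. Y 0 t \<omega> * Y 0 t \<omega>) + \<phi> 1 \<tau> * expectation (\<lambda>\<omega>. Y 0 t \<omega> * Y 1 t \<omega>)"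
      using int 0 by simp
    finally show ?thesis by (simp add: power2_eq_square)
  qed
  have I\<phi>: "half_line_integral (\<phi> 0) = - d / D" "half_line_integral (\<phi> 1) = b / D"
    unfolding \<phi>_def using I(4,5) by (simp_all add: half_line_integral_linear i)
  have e\<phi>: "exp_decaying (\<phi> 0)" "exp_decaying (\<phi> 1)" using \<phi> unfolding decaying_row_def by auto
  have lint: "(LINT \<tau>:{0..}|lborel. expectation (\<lambda>\<omega>. Y 0 t \<omega> * Y 0 (t + \<tau>) \<omega>) / expectation (\<lambda>\<omega>. (Y 0 t \<omega>)\<^sup>2))
      = (- d / D * expectation (\<lambda>\<omega>. (Y 0 t \<omega>)\<^sup>2) + b / D * expectation (\<lambda>\<omega>. Y 0 t \<omega> * Y 1 t \<omega>)) / expectation (\<lambda>\<omega>. (Y 0 t \<omega>)\<^sup>2)"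
    if t: "t \<ge> 0" for t
  proof -
    define P Q where "P = expectation (\<lambda>\<omega>. (Y 0 t \<omega>)\<^sup>2)" and "Q = expectation (\<lambda>\<omega>. Y 0 t \<omega> * Y 1 t \<omega>)"
    have "(LINT \<tau>:{0..}|lborel. expectation (\<lambda>\<omega>. Y 0 t \<omega> * Y 0 (t + \<tau>) \<omega>) / P)
      = half_line_integral (\<lambda>\<tau>. P / P * \<phi> 0 \<tau> + Q / P * \<phi> 1 \<tau>)"
      using corr[OF t] by (intro set_lebesgue_integral_cong) (auto simp: P_def Q_def add_divide_distrib mult.commute)
    also have "\<dots> = P / P * (- d / D) + Q / P * (b / D)"
      by (simp only: half_line_integral_linear exp_decaying_cmult e\<phi> I\<phi>)
    also have "\<dots> = (- d / D * P + b / D * Q) / P" by (cases "P = 0") (simp_all add: field_simps)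
    finally show ?thesis by (simp add: P_def Q_def)
  qed
  have "((\<lambda>t. (- d / D * expectation (\<lambda>\<omega>. (Y 0 t \<omega>)\<^sup>2) + b / D * expectation (\<lambda>\<omega>. Y 0 t \<omega> * Y 1 t \<omega>)) / expectation (\<lambda>\<omega>. (Y 0 t \<omega>)\<^sup>2))
     \<longlongrightarrow> (- d / D * C + b / D * (- (p\<^sup>2 * d * c + q\<^sup>2 * a * b) / (2 * T * D))) / C) at_top"
    by (intro tendsto_intros var cov) (use C in auto)
  then have "((\<lambda>t. LINT \<tau>:{0..}|lborel. expectation (\<lambda>\<omega>. Y 0 t \<omega> * Y 0 (t + \<tau>) \<omega>) / expectation (\<lambda>\<omega>. (Y 0 t \<omega>)\<^sup>2))
     \<longlongrightarrow> (- d / D * C + b / D * (- (p\<^sup>2 * d * c + q\<^sup>2 * a * b) / (2 * T * D))) / C) at_top"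
    by (rule Lim_transform_eventually)
       (rule eventually_mono[OF eventually_ge_at_top[of 0]], rule lint[symmetric])
  then have "correlation_time M (Y 0) = (- d / D * C + b / D * (- (p\<^sup>2 * d * c + q\<^sup>2 * a * b) / (2 * T * D))) / C"
    unfolding correlation_time_def by (intro tendsto_Lim) simp_all
  also have "- d / D * C + b / D * (- (p\<^sup>2 * d * c + q\<^sup>2 * a * b) / (2 * T * D)) = (p\<^sup>2 * d\<^sup>2 + q\<^sup>2 * b\<^sup>2) / (2 * D\<^sup>2)"
  proof -
    have "- d / D * C + b / D * (- (p\<^sup>2 * d * c + q\<^sup>2 * a * b) / (2 * T * D))
      = (- (d * (p\<^sup>2 * (D + d\<^sup>2) + q\<^sup>2 * b\<^sup>2)) - b * (p\<^sup>2 * d * c + q\<^sup>2 * a * b)) / (T * (2 * D\<^sup>2))"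
      unfolding C_def using TD by (simp add: field_simps power2_eq_square)
    also have "- (d * (p\<^sup>2 * (D + d\<^sup>2) + q\<^sup>2 * b\<^sup>2)) - b * (p\<^sup>2 * d * c + q\<^sup>2 * a * b) = T * (p\<^sup>2 * d\<^sup>2 + q\<^sup>2 * b\<^sup>2)"
      unfolding T_def D_def by (simp add: algebra_simps power2_eq_square)
    finally show ?thesis using TD by simp
  qed
  finally show "correlation_time M (Y 0) = (p\<^sup>2 * d\<^sup>2 + q\<^sup>2 * b\<^sup>2) / (2 * D\<^sup>2 * C)" by simp
qed

end

section \<open>The difference of the two filters\<close>

text \<open>
The energy identities with the work of the forcing estimated by Young's inequality.
\<close>

lemma second_order_ode_bound:
  assumes ode: "second_order_ode T D f u v" and TD: "T > 0" "D > 0"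
  defines "F \<equiv> half_line_integral (\<lambda>t. (f t)\<^sup>2)"
  defines "V \<equiv> ((v 0)\<^sup>2 + D * (u 0)\<^sup>2) / T + F / T\<^sup>2"
  shows "half_line_integral (\<lambda>t. (v t)\<^sup>2) \<le> V"
    and "half_line_integral (\<lambda>t. (u t)\<^sup>2) \<le> (2 * \<bar>u 0 * v 0\<bar> + 2 * V + T * (u 0)\<^sup>2) / D + F / D\<^sup>2"
proof -
  define V' U' where "V' = half_line_integral (\<lambda>t. (v t)\<^sup>2)" and "U' = half_line_integral (\<lambda>t. (u t)\<^sup>2)"
  note e = second_order_odeD(1-3)[OF ode]
  note E = second_order_ode_energy(2,3)[OF ode]
  have young: "half_line_integral (\<lambda>t. f t * w t) \<le> F / (2 * c) + c * half_line_integral (\<lambda>t. (w t)\<^sup>2) / 2"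
    if "exp_decaying w" "c > 0" for w c
  proof -
    have "half_line_integral (\<lambda>t. f t * w t) \<le> half_line_integral (\<lambda>t. 1 / (2 * c) * (f t)\<^sup>2 + c / 2 * (w t)\<^sup>2)"
    proof (rule half_line_integral_mono)
      show "exp_decaying (\<lambda>t. f t * w t)" by (intro exp_decaying_mult e that)
      show "exp_decaying (\<lambda>t. 1 / (2 * c) * (f t)\<^sup>2 + c / 2 * (w t)\<^sup>2)"
        by (intro exp_decaying_add exp_decaying_cmult exp_decaying_power2 e that)
      fix t :: real
      have "0 \<le> (f t - c * w t)\<^sup>2 / (2 * c)" using that by simp
      also have "\<dots> = 1 / (2 * c) * (f t)\<^sup>2 + c / 2 * (w t)\<^sup>2 - f t * w t"
        using that by (simp add: power2_eq_square field_simps)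
      finally show "f t * w t \<le> 1 / (2 * c) * (f t)\<^sup>2 + c / 2 * (w t)\<^sup>2" by simp
    qed
    also have "\<dots> = F / (2 * c) + c * half_line_integral (\<lambda>t. (w t)\<^sup>2) / 2"
      by (simp only: half_line_integral_linear exp_decaying_cmult exp_decaying_power2 e that F_def) simp
    finally show ?thesis .
  qed
  (* The weights T and D are chosen to absorb half of the left-hand side. *)
  have "T * V' \<le> (v 0)\<^sup>2 / 2 + D * (u 0)\<^sup>2 / 2 + F / (2 * T) + T * V' / 2"
    using E(1) young[OF e(3) TD(1)] unfolding V'_def by linarith
  then have "T * V' \<le> (v 0)\<^sup>2 + D * (u 0)\<^sup>2 + F / T" by (simp add: field_simps)
  then have "V' \<le> ((v 0)\<^sup>2 + D * (u 0)\<^sup>2 + F / T) / T" using TD by (simp add: field_simps)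
  also have "\<dots> = V" unfolding V_def by (simp add: add_divide_distrib power2_eq_square)
  finally show V: "half_line_integral (\<lambda>t. (v t)\<^sup>2) \<le> V" unfolding V'_def .
  have "D * U' \<le> \<bar>u 0 * v 0\<bar> + V + T * (u 0)\<^sup>2 / 2 + F / (2 * D) + D * U' / 2"
    using E(2) young[OF e(2) TD(2)] V abs_ge_self[of "u 0 * v 0"] unfolding U'_def by linarith
  then have "D * U' \<le> 2 * \<bar>u 0 * v 0\<bar> + 2 * V + T * (u 0)\<^sup>2 + F / D" by (simp add: field_simps)
  then have "U' \<le> (2 * \<bar>u 0 * v 0\<bar> + 2 * V + T * (u 0)\<^sup>2 + F / D) / D" using TD by (simp add: field_simps)
  also have "\<dots> = (2 * \<bar>u 0 * v 0\<bar> + 2 * V + T * (u 0)\<^sup>2) / D + F / D\<^sup>2"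
    by (simp add: add_divide_distrib power2_eq_square)
  finally show "half_line_integral (\<lambda>t. (u t)\<^sup>2) \<le> (2 * \<bar>u 0 * v 0\<bar> + 2 * V + T * (u 0)\<^sup>2) / D + F / D\<^sup>2"
    unfolding U'_def .
qed

text \<open>
The drift of the state formed by the slow and the fast variable, their two estimates, and the
reduced estimate.  The gains are \<open>k\<close> and \<open>l\<close> for the true filter and \<open>m\<close> for the reduced one,
whose own damping is \<open>\<kappa>\<close>.
\<close>

definition filter_system :: "real \<Rightarrow> real \<Rightarrow> real \<Rightarrow> real \<Rightarrow> real \<Rightarrow> real \<Rightarrow> real \<Rightarrow> real \<Rightarrow> nat \<Rightarrow> nat \<Rightarrow> real" where
  "filter_system a b c d k l m \<kappa> i j =
     [[a, b, 0, 0, 0],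
      [c, d, 0, 0, 0],
      [k, 0, a - k, b, 0],
      [l, 0, c - l, d, 0],
      [m, 0, 0, 0, - \<kappa>]] ! i ! j"

definition filter_noise :: "real \<Rightarrow> real \<Rightarrow> real \<Rightarrow> real \<Rightarrow> real \<Rightarrow> real \<Rightarrow> nat \<Rightarrow> nat \<Rightarrow> real" where
  "filter_noise p q r k l m i j =
     [[p, 0, 0],
      [0, q, 0],
      [0, 0, k * r],
      [0, 0, l * r],
      [0, 0, m * r]] ! i ! j"

lemma less_5_cases: "k < 5 \<longleftrightarrow> k = 0 \<or> k = 1 \<or> k = 2 \<or> k = 3 \<or> k = 4" for k :: nat
  by auto

lemma sum_less_5: "(\<Sum>k<5. f k) = f 0 + f 1 + f 2 + f 3 + f (4::nat)" for f :: "nat \<Rightarrow> real"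
  by (simp add: eval_nat_numeral)

text \<open>
The response of the reduced filter to the observations is \<open>m exp (- \<kappa> t)\<close>, that of the true filter
is a solution of the homogeneous equation.  The forcing is therefore the characteristic polynomial
of the true filter evaluated at minus the rate of the reduced one.
\<close>

lemma filter_error_kernel:
  assumes ode: "second_order_ode T D (\<lambda>_. 0) \<psi> \<psi>'" and init: "\<psi> 0 = 0" "\<psi>' 0 = 1" and \<kappa>: "\<kappa> > 0"
  shows "\<exists>g'. g' 0 = - (\<kappa> * m) + k * T + l \<and>
    second_order_ode T D (\<lambda>t. ((\<kappa>\<^sup>2 - T * \<kappa> + D) * m) * exp (- \<kappa> * t))
      (\<lambda>t. m * exp (- \<kappa> * t) - k * \<psi>' t + l * \<psi> t) g'"
proof -
  define g' where "g' = (\<lambda>t. (- (\<kappa> * m)) * exp (- \<kappa> * t) - k * (- T * \<psi>' t - D * \<psi> t) + l * \<psi>' t)"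
  note e = second_order_odeD(2,3)[OF ode]
  note d = second_order_odeD(4,5)[OF ode]
  have "second_order_ode T D (\<lambda>t. ((\<kappa>\<^sup>2 - T * \<kappa> + D) * m) * exp (- \<kappa> * t))
      (\<lambda>t. m * exp (- \<kappa> * t) - k * \<psi>' t + l * \<psi> t) g'"
    unfolding second_order_ode_def
  proof (intro conjI allI impI)
    show "exp_decaying (\<lambda>t. ((\<kappa>\<^sup>2 - T * \<kappa> + D) * m) * exp (- \<kappa> * t))"
      "exp_decaying (\<lambda>t. m * exp (- \<kappa> * t) - k * \<psi>' t + l * \<psi> t)" "exp_decaying g'"
      unfolding g'_def
      by (intro exp_decaying_add exp_decaying_diff exp_decaying_cmult exp_decaying_exp \<kappa> e)+
    fix t :: real assume t: "0 \<le> t"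
    show "((\<lambda>t. m * exp (- \<kappa> * t) - k * \<psi>' t + l * \<psi> t) has_real_derivative g' t) (at t within {0..})"
      unfolding g'_def by (rule derivative_eq_intros d t refl)+ (simp add: algebra_simps)
    show "(g' has_real_derivative - T * g' t - D * (m * exp (- \<kappa> * t) - k * \<psi>' t + l * \<psi> t)
        + (\<kappa>\<^sup>2 - T * \<kappa> + D) * m * exp (- \<kappa> * t)) (at t within {0..})"
      unfolding g'_def by (rule derivative_eq_intros d t refl)+ (simp add: algebra_simps power2_eq_square)
  qed
  moreover have "g' 0 = - (\<kappa> * m) + k * T + l" by (simp add: g'_def init)
  ultimately show ?thesis by blast
qed

text \<open>
The function \<open>g\<close> is the response of the difference to the observations.  The observation noise
enters through \<open>g\<close> itself, the noise of the signal through the solution \<open>u\<close> of the equation of the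
signal with forcing \<open>g\<close>.  So the limit is at most a multiple of the integral of \<open>g\<^sup>2\<close>, which
in turn is bounded by the initial value \<open>g0\<close>, the initial slope \<open>g1\<close> and the energy \<open>E\<close> of the
forcing.
\<close>

lemma (in wiener_noise) filter_difference_limit:
  fixes a b c d k l m \<kappa> p q r :: real
  assumes n: "n = 3"
    and Y: "linear_sde 5 (filter_system a b c d k l m \<kappa>) (filter_noise p q r k l m) Y"
    and signal_stable: "a + d < 0" "a * d - b * c > 0"
    and filter_stable: "(a - k) + d < 0" "(a - k) * d - b * (c - l) > 0"
    and \<kappa>: "\<kappa> > 0"
  defines "T \<equiv> - (a + d)" and "D \<equiv> a * d - b * c"
    and "Th \<equiv> - ((a - k) + d)" and "Dh \<equiv> (a - k) * d - b * (c - l)"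
  defines "g0 \<equiv> m - k" and "g1 \<equiv> k * (k - a) - b * l - \<kappa> * m"
    and "E \<equiv> ((\<kappa>\<^sup>2 - Th * \<kappa> + Dh) * m)\<^sup>2 / (2 * \<kappa>)"
  shows "(\<forall>t\<ge>0. square_integrable M (\<lambda>\<omega>. Y 4 t \<omega> - Y 2 t \<omega>)) \<and>
    (\<exists>L. ((\<lambda>t. expectation (\<lambda>\<omega>. (Y 4 t \<omega> - Y 2 t \<omega>)\<^sup>2)) \<longlongrightarrow> L) at_top \<and>
      0 \<le> L \<and>
      L \<le> (2 * p\<^sup>2 / T\<^sup>2 + (2 * p\<^sup>2 * d\<^sup>2 + q\<^sup>2 * b\<^sup>2) * (2 / (D * T\<^sup>2) + 1 / D\<^sup>2) + r\<^sup>2)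
        * ((2 * \<bar>g0 * g1\<bar> + 2 * ((g1\<^sup>2 + Dh * g0\<^sup>2) / Th + E / Th\<^sup>2) + Th * g0\<^sup>2) / Dh + E / Dh\<^sup>2))"
proof -
  have pos: "T > 0" "D > 0" "Th > 0" "Dh > 0"
    using signal_stable filter_stable by (auto simp: T_def D_def Th_def Dh_def)
  obtain \<psi> \<psi>' where \<psi>: "\<psi> 0 = 0" "\<psi>' 0 = 1" and ode\<psi>: "second_order_ode Th Dh (\<lambda>_. 0) \<psi> \<psi>'"
    using second_order_ode_exists[OF pos(3,4) exp_decaying_zero, of 0 1] by blast
  define g where "g = (\<lambda>t. m * exp (- \<kappa> * t) - k * \<psi>' t + (d * k - b * l) * \<psi> t)"
  obtain g' where g'0: "g' 0 = - (\<kappa> * m) + k * Th + (d * k - b * l)"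
    and odeg: "second_order_ode Th Dh (\<lambda>t. ((\<kappa>\<^sup>2 - Th * \<kappa> + Dh) * m) * exp (- \<kappa> * t)) g g'"
    unfolding g_def using filter_error_kernel[OF ode\<psi> \<psi> \<kappa>] by blast
  have eg: "exp_decaying g" by (rule second_order_odeD(2)[OF odeg])
  obtain u u' where u: "u 0 = 0" "u' 0 = 0" and odeu: "second_order_ode T D g u u'"
    using second_order_ode_exists[OF pos(1,2) eg, of 0 0] by blast
  note e = second_order_odeD(2,3)[OF ode\<psi>] second_order_odeD(2,3)[OF odeu] exp_decaying_exp[OF \<kappa>] eg
  note de = second_order_odeD(4,5)[OF ode\<psi>] second_order_odeD(4,5)[OF odeu]
  note ce = e[THEN exp_decaying_continuous]
  (* The last three entries are the adjoint responses of the filters; they force the first two. *)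
  define \<phi> where "\<phi> = (\<lambda>i t. [u' t - d * u t, b * u t, d * \<psi> t - \<psi>' t, (- b) * \<psi> t, exp (- \<kappa> * t)] ! i)"
  define \<phi>' where "\<phi>' = (\<lambda>i t. [- T * u' t - D * u t + g t - d * u' t, b * u' t,
    d * \<psi>' t - (- Th * \<psi>' t - Dh * \<psi> t), (- b) * \<psi>' t, (- \<kappa>) * exp (- \<kappa> * t)] ! i)"
  have e\<phi>: "exp_decaying (\<phi> i)" if "i < 5" for i
    using that unfolding less_5_cases \<phi>_def
    by (elim disjE; simp) (intro exp_decaying_diff exp_decaying_minus exp_decaying_cmult e e[simplified])+
  have c\<phi>: "continuous_on {0..} (\<phi>' i)" if "i < 5" for i
    using that unfolding less_5_cases \<phi>'_def
    by (elim disjE; simp) (intro continuous_intros ce ce[simplified])+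
  have d\<phi>: "(\<phi> i has_real_derivative \<phi>' i t) (at t within {0..})" if "i < 5" "t \<ge> 0" for i t
    using that(1) unfolding less_5_cases \<phi>_def \<phi>'_def
    by (elim disjE; simp) (auto intro!: derivative_eq_intros de[OF that(2)] simp: algebra_simps)
  have r\<phi>: "\<phi>' i t = (\<Sum>j<5. \<phi> j t * filter_system a b c d k l m \<kappa> j i)" if "i < 5" for i t
    using that unfolding less_5_cases
    by (elim disjE) (simp_all add: sum_less_5 \<phi>_def \<phi>'_def filter_system_def g_def T_def D_def Th_def Dh_def algebra_simps)
  have \<phi>: "decaying_row 5 (filter_system a b c d k l m \<kappa>) \<phi> \<phi>'"
    unfolding decaying_row_def C1_kernel_def using e\<phi> c\<phi> d\<phi> r\<phi> by blast
  have obs: "(\<Sum>i<5. \<phi> i 0 * f i) = f 4 - f 2" for f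
    by (simp add: sum_less_5 \<phi>_def u \<psi>)
  define U V G2 where "U = half_line_integral (\<lambda>t. (u t)\<^sup>2)" and "V = half_line_integral (\<lambda>t. (u' t)\<^sup>2)"
    and "G2 = half_line_integral (\<lambda>t. (g t)\<^sup>2)"
  define L where "L = p\<^sup>2 * half_line_integral (\<lambda>t. (u' t - d * u t)\<^sup>2) + (q\<^sup>2 * b\<^sup>2) * U + r\<^sup>2 * G2"
  have "(\<Sum>i<n. half_line_integral (\<lambda>t. (\<Sum>j<5. \<phi> j t * filter_noise p q r k l m j i) * (\<Sum>j<5. \<phi> j t * filter_noise p q r k l m j i)))
    = half_line_integral (\<lambda>t. p\<^sup>2 * (u' t - d * u t)\<^sup>2) + half_line_integral (\<lambda>t. (q\<^sup>2 * b\<^sup>2) * (u t)\<^sup>2)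
      + half_line_integral (\<lambda>t. r\<^sup>2 * (g t)\<^sup>2)"
    unfolding n sum_less_3 sum_less_5
    by (intro arg_cong2[where f = "(+)"] arg_cong[where f = "half_line_integral"] ext)
       (simp_all add: filter_noise_def \<phi>_def g_def power2_eq_square algebra_simps)
  also have "\<dots> = L" unfolding L_def U_def G2_def by (simp only: half_line_integral_linear)
  finally have lim: "((\<lambda>t. expectation (\<lambda>\<omega>. (Y 4 t \<omega> - Y 2 t \<omega>)\<^sup>2)) \<longlongrightarrow> L) at_top"
    using linear_sde_second_moments_tendsto[OF Y \<phi> \<phi>] unfolding obs by (simp add: power2_eq_square)
  have sq: "square_integrable M (\<lambda>\<omega>. Y 4 t \<omega> - Y 2 t \<omega>)" if "t \<ge> 0" for t
    using linear_sde_square_integrable[OF Y \<phi> that] unfolding obs .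
  have nonneg: "U \<ge> 0" "V \<ge> 0" "G2 \<ge> 0" "half_line_integral (\<lambda>t. (u' t - d * u t)\<^sup>2) \<ge> 0"
    unfolding U_def V_def G2_def by (rule half_line_integral_power2_nonneg)+
  have L0: "L \<ge> 0" unfolding L_def using nonneg by (intro add_nonneg_nonneg mult_nonneg_nonneg) auto
  have V: "V \<le> G2 / T\<^sup>2"
    using second_order_ode_bound(1)[OF odeu pos(1,2)] unfolding u V_def G2_def by simp
  have U: "U \<le> (2 / (D * T\<^sup>2) + 1 / D\<^sup>2) * G2"
    using second_order_ode_bound(2)[OF odeu pos(1,2)] unfolding u U_def G2_def by (simp add: algebra_simps)
  have "half_line_integral (\<lambda>t. (u' t - d * u t)\<^sup>2) \<le> half_line_integral (\<lambda>t. 2 * (u' t)\<^sup>2 + (2 * d\<^sup>2) * (u t)\<^sup>2)"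
  proof (rule half_line_integral_mono)
    fix t :: real
    have "0 \<le> (u' t + d * u t)\<^sup>2" by simp
    then show "(u' t - d * u t)\<^sup>2 \<le> 2 * (u' t)\<^sup>2 + (2 * d\<^sup>2) * (u t)\<^sup>2"
      by (simp add: power2_eq_square algebra_simps)
  qed (intro exp_decaying_power2 exp_decaying_diff exp_decaying_add exp_decaying_cmult e)+
  also have "\<dots> = 2 * V + 2 * d\<^sup>2 * U"
    unfolding U_def V_def by (simp only: half_line_integral_linear exp_decaying_cmult exp_decaying_power2 e)
  finally have "L \<le> p\<^sup>2 * (2 * V + 2 * d\<^sup>2 * U) + (q\<^sup>2 * b\<^sup>2) * U + r\<^sup>2 * G2"
    unfolding L_def by (intro add_mono mult_left_mono) auto
  also have "\<dots> = 2 * p\<^sup>2 * V + (2 * p\<^sup>2 * d\<^sup>2 + q\<^sup>2 * b\<^sup>2) * U + r\<^sup>2 * G2"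
    by (simp add: algebra_simps)
  also have "\<dots> \<le> 2 * p\<^sup>2 * (G2 / T\<^sup>2) + (2 * p\<^sup>2 * d\<^sup>2 + q\<^sup>2 * b\<^sup>2) * ((2 / (D * T\<^sup>2) + 1 / D\<^sup>2) * G2) + r\<^sup>2 * G2"
    using U V by (intro add_mono mult_left_mono) auto
  also have "\<dots> = (2 * p\<^sup>2 / T\<^sup>2 + (2 * p\<^sup>2 * d\<^sup>2 + q\<^sup>2 * b\<^sup>2) * (2 / (D * T\<^sup>2) + 1 / D\<^sup>2) + r\<^sup>2) * G2"
    by (simp add: algebra_simps)
  also have "\<dots> \<le> (2 * p\<^sup>2 / T\<^sup>2 + (2 * p\<^sup>2 * d\<^sup>2 + q\<^sup>2 * b\<^sup>2) * (2 / (D * T\<^sup>2) + 1 / D\<^sup>2) + r\<^sup>2)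
        * ((2 * \<bar>g0 * g1\<bar> + 2 * ((g1\<^sup>2 + Dh * g0\<^sup>2) / Th + E / Th\<^sup>2) + Th * g0\<^sup>2) / Dh + E / Dh\<^sup>2)"
  proof (rule mult_left_mono)
    have "g 0 = g0" by (simp add: g_def g0_def \<psi>)
    moreover have "g' 0 = g1" unfolding g'0 g1_def Th_def by (simp add: algebra_simps)
    moreover have "half_line_integral (\<lambda>t. (((\<kappa>\<^sup>2 - Th * \<kappa> + Dh) * m) * exp (- \<kappa> * t))\<^sup>2) = E"
    proof -
      have "half_line_integral (\<lambda>t. exp (- (2 * \<kappa>) * t)) = - (- 1 / (2 * \<kappa>) * exp (- (2 * \<kappa>) * 0))"
      proof (rule half_line_integral_deriv[of "\<lambda>t. - 1 / (2 * \<kappa>) * exp (- (2 * \<kappa>) * t)"])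
        show "exp_decaying (\<lambda>t. exp (- (2 * \<kappa>) * t))" by (rule exp_decaying_exp) (use \<kappa> in simp)
        then show "exp_decaying (\<lambda>t. - 1 / (2 * \<kappa>) * exp (- (2 * \<kappa>) * t))" by (rule exp_decaying_cmult)
      qed (use \<kappa> in \<open>auto intro!: derivative_eq_intros\<close>)
      moreover have "(\<lambda>t. (((\<kappa>\<^sup>2 - Th * \<kappa> + Dh) * m) * exp (- \<kappa> * t))\<^sup>2)
        = (\<lambda>t. ((\<kappa>\<^sup>2 - Th * \<kappa> + Dh) * m)\<^sup>2 * exp (- (2 * \<kappa>) * t))"
        by (auto simp: power_mult_distrib exp_double[symmetric] mult.assoc)
      ultimately show ?thesis by (simp add: E_def half_line_integral_linear(3))
    qed
    ultimately show "G2 \<le> (2 * \<bar>g0 * g1\<bar> + 2 * ((g1\<^sup>2 + Dh * g0\<^sup>2) / Th + E / Th\<^sup>2) + Th * g0\<^sup>2) / Dh + E / Dh\<^sup>2"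
      using second_order_ode_bound(2)[OF odeg pos(3,4)] unfolding G2_def by simp
    show "0 \<le> 2 * p\<^sup>2 / T\<^sup>2 + (2 * p\<^sup>2 * d\<^sup>2 + q\<^sup>2 * b\<^sup>2) * (2 / (D * T\<^sup>2) + 1 / D\<^sup>2) + r\<^sup>2"
      using pos by (intro add_nonneg_nonneg mult_nonneg_nonneg divide_nonneg_nonneg) auto
  qed
  finally show ?thesis using sq lim L0 by blast
qed

section \<open>The filtering problem in coordinates\<close>

lemma matrix22_nth [simp]:
  "matrix22 a b c d $ 1 $ 1 = a" "matrix22 a b c d $ 1 $ 2 = b"
  "matrix22 a b c d $ 2 $ 1 = c" "matrix22 a b c d $ 2 $ 2 = d"
  by (simp_all add: matrix22_def)

lemma A_eps_nth [simp]:
  "A_eps A \<epsilon> $ 1 $ 1 = A $ 1 $ 1" "A_eps A \<epsilon> $ 1 $ 2 = A $ 1 $ 2"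
  "A_eps A \<epsilon> $ 2 $ 1 = A $ 2 $ 1 / \<epsilon>" "A_eps A \<epsilon> $ 2 $ 2 = A $ 2 $ 2 / \<epsilon>"
  by (simp_all add: A_eps_def)

lemma H_obs_nth [simp]: "H_obs $ 1 $ 1 = 1" "H_obs $ 1 $ 2 = 0"
  by (simp_all add: H_obs_def)

lemma negative_definite_22:
  fixes A :: "real^2^2"
  assumes "negative_definite A"
  shows "A $ 1 $ 1 < 0" "A $ 2 $ 2 < 0" "A $ 1 $ 1 * A $ 2 $ 2 - A $ 1 $ 2 * A $ 2 $ 1 > 0"
proof -
  have q: "A $ 1 $ 1 * u\<^sup>2 + (A $ 1 $ 2 + A $ 2 $ 1) * (u * w) + A $ 2 $ 2 * w\<^sup>2 < 0" if "u \<noteq> 0 \<or> w \<noteq> 0" for u w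
  proof -
    have "(vector [u, w] :: real^2) \<noteq> 0" using that by (auto simp: vec_eq_iff forall_2)
    then have "(vector [u, w] :: real^2) \<bullet> (A *v vector [u, w]) < 0"
      using assms unfolding negative_definite_def by blast
    then show ?thesis
      by (simp add: inner_vec_def matrix_vector_mult_def sum_2 power2_eq_square algebra_simps)
  qed
  show a: "A $ 1 $ 1 < 0" using q[of 1 0] by simp
  show d: "A $ 2 $ 2 < 0" using q[of 0 1] by simp
  define e where "e = A $ 1 $ 2 + A $ 2 $ 1"
  have "0 > A $ 1 $ 1 * e\<^sup>2 + e * (e * (- 2 * A $ 1 $ 1)) + A $ 2 $ 2 * (- 2 * A $ 1 $ 1)\<^sup>2"
    using q[of e "- 2 * A $ 1 $ 1"] a by (simp add: e_def)
  also have "A $ 1 $ 1 * e\<^sup>2 + e * (e * (- 2 * A $ 1 $ 1)) + A $ 2 $ 2 * (- 2 * A $ 1 $ 1)\<^sup>2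
    = A $ 1 $ 1 * (4 * (A $ 1 $ 1 * A $ 2 $ 2) - e\<^sup>2)"
    by (simp add: power2_eq_square algebra_simps)
  finally have "4 * (A $ 1 $ 1 * A $ 2 $ 2) - e\<^sup>2 > 0" using a by (simp add: mult_less_0_iff)
  moreover have "e\<^sup>2 - 4 * (A $ 1 $ 2 * A $ 2 $ 1) = (A $ 1 $ 2 - A $ 2 $ 1)\<^sup>2"
    by (simp add: e_def power2_eq_square algebra_simps)
  ultimately show "A $ 1 $ 1 * A $ 2 $ 2 - A $ 1 $ 2 * A $ 2 $ 1 > 0"
    using zero_le_power2[of "A $ 1 $ 2 - A $ 2 $ 1"] by linarith
qed

lemma positive_semidefinite_22:
  fixes S :: "real^2^2"
  assumes sym: "S $ 2 $ 1 = S $ 1 $ 2" and psd: "\<forall>v. 0 \<le> v \<bullet> (S *v v)"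
  shows "0 \<le> S $ 1 $ 1" "0 \<le> S $ 2 $ 2" "(S $ 1 $ 2)\<^sup>2 \<le> S $ 1 $ 1 * S $ 2 $ 2"
proof -
  have q: "0 \<le> S $ 1 $ 1 * u\<^sup>2 + 2 * S $ 1 $ 2 * (u * w) + S $ 2 $ 2 * w\<^sup>2" for u w
    using psd[rule_format, of "vector [u, w]"] sym
    by (simp add: inner_vec_def matrix_vector_mult_def sum_2 power2_eq_square algebra_simps)
  show s1: "0 \<le> S $ 1 $ 1" using q[of 1 0] by simp
  show "0 \<le> S $ 2 $ 2" using q[of 0 1] by simp
  show "(S $ 1 $ 2)\<^sup>2 \<le> S $ 1 $ 1 * S $ 2 $ 2"
  proof (cases "S $ 1 $ 1 = 0")
    case True
    have "S $ 1 $ 2 = 0"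
    proof (rule ccontr)
      assume "S $ 1 $ 2 \<noteq> 0"
      then show False using q[of "- (S $ 2 $ 2 + 1) / (2 * S $ 1 $ 2)" 1] True by (simp add: field_simps)
    qed
    then show ?thesis using True by simp
  next
    case False
    have "0 \<le> S $ 1 $ 1 * (S $ 1 $ 1 * S $ 2 $ 2 - (S $ 1 $ 2)\<^sup>2)"
      using q[of "S $ 1 $ 2" "- S $ 1 $ 1"] by (simp add: power2_eq_square algebra_simps)
    then show ?thesis using s1 False by (simp add: zero_le_mult_iff)
  qed
qed

lemma steady_state_covariance_equations:
  assumes "steady_state_covariance A \<sigma>x \<sigma>y R \<epsilon> S"
  shows "S $ 2 $ 1 = S $ 1 $ 2"
    and "2 * (A $ 1 $ 1 * S $ 1 $ 1 + A $ 1 $ 2 * S $ 1 $ 2) - (S $ 1 $ 1)\<^sup>2 / R + \<sigma>x\<^sup>2 = 0"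
    and "A $ 1 $ 1 * S $ 1 $ 2 + A $ 1 $ 2 * S $ 2 $ 2 + A $ 2 $ 1 / \<epsilon> * S $ 1 $ 1 + A $ 2 $ 2 / \<epsilon> * S $ 1 $ 2
      - S $ 1 $ 1 * S $ 1 $ 2 / R = 0"
    and "2 * (A $ 2 $ 1 / \<epsilon> * S $ 1 $ 2 + A $ 2 $ 2 / \<epsilon> * S $ 2 $ 2) - (S $ 1 $ 2)\<^sup>2 / R + \<sigma>y\<^sup>2 / \<epsilon> = 0"
    and "0 \<le> S $ 1 $ 1" "0 \<le> S $ 2 $ 2" "(S $ 1 $ 2)\<^sup>2 \<le> S $ 1 $ 1 * S $ 2 $ 2"
proof -
  have sym: "transpose S = S" and psd: "\<forall>v. 0 \<le> v \<bullet> (S *v v)"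
    and ric: "A_eps A \<epsilon> ** S + S ** transpose (A_eps A \<epsilon>)
       - (1 / R) *\<^sub>R (S ** transpose H_obs ** H_obs ** S) + Q_eps \<sigma>x \<sigma>y \<epsilon> = 0"
    using assms unfolding steady_state_covariance_def by blast+
  have "transpose S $ 1 $ 2 = S $ 1 $ 2" using sym by simp
  then show s: "S $ 2 $ 1 = S $ 1 $ 2" by (simp add: transpose_def)
  show "0 \<le> S $ 1 $ 1" "0 \<le> S $ 2 $ 2" "(S $ 1 $ 2)\<^sup>2 \<le> S $ 1 $ 1 * S $ 2 $ 2"
    by (rule positive_semidefinite_22[OF s psd])+
  have r: "(A_eps A \<epsilon> ** S + S ** transpose (A_eps A \<epsilon>)
       - (1 / R) *\<^sub>R (S ** transpose H_obs ** H_obs ** S) + Q_eps \<sigma>x \<sigma>y \<epsilon>) $ i $ j = 0" for i j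
    using ric by simp
  note m = matrix_matrix_mult_def sum_2 transpose_def s Q_eps_def power2_eq_square
  show "2 * (A $ 1 $ 1 * S $ 1 $ 1 + A $ 1 $ 2 * S $ 1 $ 2) - (S $ 1 $ 1)\<^sup>2 / R + \<sigma>x\<^sup>2 = 0"
    using r[of 1 1] by (simp add: m algebra_simps)
  show "A $ 1 $ 1 * S $ 1 $ 2 + A $ 1 $ 2 * S $ 2 $ 2 + A $ 2 $ 1 / \<epsilon> * S $ 1 $ 1 + A $ 2 $ 2 / \<epsilon> * S $ 1 $ 2
      - S $ 1 $ 1 * S $ 1 $ 2 / R = 0"
    using r[of 1 2] by (simp add: m algebra_simps)
  show "2 * (A $ 2 $ 1 / \<epsilon> * S $ 1 $ 2 + A $ 2 $ 2 / \<epsilon> * S $ 2 $ 2) - (S $ 1 $ 2)\<^sup>2 / R + \<sigma>y\<^sup>2 / \<epsilon> = 0"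
    using r[of 2 2] by (simp add: m algebra_simps)
qed

text \<open>
Stability of the true filter.  The Riccati equation says that \<open>F S\<close> has a negative definite
symmetric part, where \<open>F\<close> is the filter matrix; hence \<open>F S\<close> has positive determinant, and so
has \<open>F\<close>, since the determinant of \<open>S\<close> is nonnegative.
\<close>

lemma filter_determinant_pos:
  fixes a b c d p q R s1 s2 s3 :: real
  assumes R: "R > 0" and p: "p > 0" and q: "q > 0"
    and r1: "2 * (a * s1 + b * s2) - s1\<^sup>2 / R + p = 0"
    and r2: "a * s2 + b * s3 + c * s1 + d * s2 - s1 * s2 / R = 0"
    and r3: "2 * (c * s2 + d * s3) - s2\<^sup>2 / R + q = 0"
    and psd: "s2\<^sup>2 \<le> s1 * s3"
  shows "(a - s1 / R) * d - b * (c - s2 / R) > 0"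
proof -
  (* The entries of F S, row by row. *)
  define X where "X = (a - s1 / R) * s1 + b * s2"
  define Y where "Y = (a - s1 / R) * s2 + b * s3"
  define Z where "Z = (c - s2 / R) * s1 + d * s2"
  define W where "W = (c - s2 / R) * s2 + d * s3"
  have X: "X = - (p + s1\<^sup>2 / R) / 2" using r1 unfolding X_def by (simp add: field_simps power2_eq_square)
  have W: "W = - (q + s2\<^sup>2 / R) / 2" using r3 unfolding W_def by (simp add: field_simps power2_eq_square)
  have YZ: "Y + Z = - (s1 * s2 / R)" using r2 unfolding Y_def Z_def by (simp add: field_simps)
  have "4 * (X * W) = (p + s1\<^sup>2 / R) * (q + s2\<^sup>2 / R)" unfolding X W by (simp add: algebra_simps)
  also have "\<dots> = p * q + p * (s2\<^sup>2 / R) + q * (s1\<^sup>2 / R) + (s1 * s2 / R)\<^sup>2"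
    by (simp add: algebra_simps power2_eq_square)
  also have "\<dots> > (Y + Z)\<^sup>2"
    unfolding YZ using R p q by (simp add: add_pos_nonneg)
  finally have "4 * (X * W) > (Y + Z)\<^sup>2" .
  moreover have "(Y + Z)\<^sup>2 - 4 * (Y * Z) = (Y - Z)\<^sup>2" by (simp add: power2_eq_square algebra_simps)
  ultimately have "X * W - Y * Z > 0" using zero_le_power2[of "Y - Z"] by linarith
  also have "X * W - Y * Z = ((a - s1 / R) * d - b * (c - s2 / R)) * (s1 * s3 - s2\<^sup>2)"
    unfolding X_def Y_def Z_def W_def by (simp add: algebra_simps power2_eq_square)
  finally show ?thesis using psd by (simp add: zero_less_mult_iff)
qed

lemma full_model_signal:
  assumes "full_model M A \<sigma>x \<sigma>y R \<epsilon> Wx Wy V x y z"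
  obtains B where "wiener_noise M 3 B"
    and "AE \<omega> in M. \<forall>t. B 0 t \<omega> = Wx t \<omega> \<and> B 1 t \<omega> = Wy t \<omega> \<and> B 2 t \<omega> = V t \<omega>"
    and "wiener_noise.linear_sde M 3 B 2 (planar (A $ 1 $ 1) (A $ 1 $ 2) (A $ 2 $ 1 / \<epsilon>) (A $ 2 $ 2 / \<epsilon>))
          (diagonal_noise \<sigma>x (\<sigma>y / sqrt \<epsilon>)) (\<lambda>k. [x, y] ! k)"
    and "\<forall>k<2. \<forall>i<3. \<forall>t\<ge>0. (\<integral>\<omega>. ([x, y] ! k) 0 \<omega> * B i t \<omega> \<partial>M) = 0"
proof -
  have "prob_space M" and ind: "independent_wiener_processes M 3 (\<lambda>i. [Wx, Wy, V] ! i)"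
    and c: "continuous_process M x" "continuous_process M y"
    and sq: "integrable M (\<lambda>\<omega>. (x 0 \<omega>)\<^sup>2)" "integrable M (\<lambda>\<omega>. (y 0 \<omega>)\<^sup>2)"
    and init: "prob_space.indep_set M
       (sets (vimage_algebra (space M) (\<lambda>\<omega>. (x 0 \<omega>, y 0 \<omega>)) borel))
       (sets (vimage_algebra (space M)
          (\<lambda>\<omega>. \<lambda>(i, t)\<in>{..<3} \<times> {0..}. ([Wx, Wy, V] ! i) t \<omega>)
          (PiM ({..<3} \<times> {0..}) (\<lambda>_. borel))))"
    and x: "AE \<omega> in M. \<forall>t\<ge>0.
        x t \<omega> = x 0 \<omega> + integral {0..t} (\<lambda>s. A $ 1 $ 1 * x s \<omega> + A $ 1 $ 2 * y s \<omega>) + \<sigma>x * Wx t \<omega>"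
    and y: "AE \<omega> in M. \<forall>t\<ge>0.
        y t \<omega> = y 0 \<omega> + 1 / \<epsilon> * integral {0..t} (\<lambda>s. A $ 2 $ 1 * x s \<omega> + A $ 2 $ 2 * y s \<omega>)
                + \<sigma>y / sqrt \<epsilon> * Wy t \<omega>"
    using assms unfolding full_model_def by blast+
  interpret prob_space M by fact
  obtain B where B: "wiener_noise M 3 B" "AE \<omega> in M. \<forall>i<3. \<forall>t. B i t \<omega> = ([Wx, Wy, V] ! i) t \<omega>"
    by (rule wiener_noise_version[OF ind])
  interpret wiener_noise M 3 B by fact
  have sq': "square_integrable M (x 0)" "square_integrable M (y 0)"
    using c sq by (auto simp: square_integrable_def continuous_process_def)
  have AEB: "AE \<omega> in M. \<forall>t. B 0 t \<omega> = Wx t \<omega> \<and> B 1 t \<omega> = Wy t \<omega> \<and> B 2 t \<omega> = V t \<omega>"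
    using B(2)
  proof eventually_elim
    case (elim \<omega>)
    from elim[rule_format, of 0] elim[rule_format, of 1] elim[rule_format, of 2] show ?case by simp
  qed
  have "AE \<omega> in M. continuous_on {0..} (\<lambda>t. x t \<omega>)" "AE \<omega> in M. continuous_on {0..} (\<lambda>t. y t \<omega>)"
    using c unfolding continuous_process_def by blast+
  then have "AE \<omega> in M. \<forall>k<2. continuous_on {0..} (\<lambda>t. ([x, y] ! k) t \<omega>) \<and>
      (\<forall>t\<ge>0. ([x, y] ! k) t \<omega> = ([x, y] ! k) 0 \<omega>
        + integral {0..t} (\<lambda>s. \<Sum>j<2. planar (A $ 1 $ 1) (A $ 1 $ 2) (A $ 2 $ 1 / \<epsilon>) (A $ 2 $ 2 / \<epsilon>) k j * ([x, y] ! j) s \<omega>)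
        + (\<Sum>i<3. diagonal_noise \<sigma>x (\<sigma>y / sqrt \<epsilon>) k i * B i t \<omega>))"
    using x y AEB
  proof eventually_elim
    case (elim \<omega>)
    have i: "1 / \<epsilon> * integral {0..t} (\<lambda>s. A $ 2 $ 1 * x s \<omega> + A $ 2 $ 2 * y s \<omega>)
      = integral {0..t} (\<lambda>s. A $ 2 $ 1 / \<epsilon> * x s \<omega> + A $ 2 $ 2 / \<epsilon> * y s \<omega>)" for t
      unfolding integral_mult_right[symmetric] by (intro integral_cong) (simp add: distrib_left)
    have e: "x t \<omega> = x 0 \<omega> + integral {0..t} (\<lambda>s. A $ 1 $ 1 * x s \<omega> + A $ 1 $ 2 * y s \<omega>) + \<sigma>x * B 0 t \<omega>"
      "y t \<omega> = y 0 \<omega> + integral {0..t} (\<lambda>s. A $ 2 $ 1 / \<epsilon> * x s \<omega> + A $ 2 $ 2 / \<epsilon> * y s \<omega>)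
        + \<sigma>y / sqrt \<epsilon> * B 1 t \<omega>" if "t \<ge> 0" for t
      using elim(3,4)[rule_format, OF that] unfolding i elim(5)[rule_format, THEN conjunct1]
        elim(5)[rule_format, THEN conjunct2, THEN conjunct1] by blast+
    show ?case
    proof (intro allI impI)
      fix k :: nat assume "k < 2"
      then consider "k = 0" | "k = 1" by linarith
      then show "continuous_on {0..} (\<lambda>t. ([x, y] ! k) t \<omega>) \<and>
      (\<forall>t\<ge>0. ([x, y] ! k) t \<omega> = ([x, y] ! k) 0 \<omega>
        + integral {0..t} (\<lambda>s. \<Sum>j<2. planar (A $ 1 $ 1) (A $ 1 $ 2) (A $ 2 $ 1 / \<epsilon>) (A $ 2 $ 2 / \<epsilon>) k j * ([x, y] ! j) s \<omega>)
        + (\<Sum>i<3. diagonal_noise \<sigma>x (\<sigma>y / sqrt \<epsilon>) k i * B i t \<omega>))"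
      proof cases
        case 1
        show ?thesis
          unfolding 1 by (simp add: sum_less_2 sum_less_3 planar_def diagonal_noise_def) (intro conjI allI impI elim(1) e(1))
      next
        case 2
        show ?thesis
          unfolding 2 by (simp add: sum_less_2 sum_less_3 planar_def diagonal_noise_def) (intro conjI allI impI elim(2) e(2)[simplified])
      qed
    qed
  qed
  then have "linear_sde 2 (planar (A $ 1 $ 1) (A $ 1 $ 2) (A $ 2 $ 1 / \<epsilon>) (A $ 2 $ 2 / \<epsilon>))
          (diagonal_noise \<sigma>x (\<sigma>y / sqrt \<epsilon>)) (\<lambda>k. [x, y] ! k)"
    unfolding linear_sde_def using sq' c by (auto simp: less_2_cases_iff continuous_process_def)
  moreover have "expectation (\<lambda>\<omega>. ([x, y] ! k) 0 \<omega> * B i t \<omega>) = 0" if k: "k < 2" and i: "i < 3" and t: "t \<ge> 0" for k i t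
  proof -
    define W where "W = [Wx, Wy, V] ! i"
    have W: "wiener_process M W" using ind i unfolding independent_wiener_processes_def W_def by blast
    have E: "expectation (\<lambda>\<omega>. f (x 0 \<omega>, y 0 \<omega>) * W t \<omega>) = 0"
      if "f \<in> borel_measurable (borel :: (real \<times> real) measure)" "square_integrable M (\<lambda>\<omega>. f (x 0 \<omega>, y 0 \<omega>))" for f
      unfolding W_def
      by (rule expectation_mult_independent_noise[OF init _ t _ _ that])
         (use i wiener_process_moments(1,2)[OF W t] in \<open>auto simp: W_def\<close>)
    have "expectation (\<lambda>\<omega>. ([x, y] ! k) 0 \<omega> * W t \<omega>) = 0"
      using k E[of fst] E[of snd] sq' by (auto simp: less_2_cases_iff borel_measurable_continuous_onI continuous_on_fst continuous_on_snd)
    moreover have "expectation (\<lambda>\<omega>. ([x, y] ! k) 0 \<omega> * B i t \<omega>) = expectation (\<lambda>\<omega>. ([x, y] ! k) 0 \<omega> * W t \<omega>)"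
    proof (rule integral_cong_AE)
      show "AE \<omega> in M. ([x, y] ! k) 0 \<omega> * B i t \<omega> = ([x, y] ! k) 0 \<omega> * W t \<omega>"
        using B(2) by eventually_elim (use i in \<open>simp add: W_def\<close>)
      have "([x, y] ! k) 0 \<in> borel_measurable M" using k sq' by (auto simp: less_2_cases_iff square_integrable_def)
      then show "(\<lambda>\<omega>. ([x, y] ! k) 0 \<omega> * B i t \<omega>) \<in> borel_measurable M" "(\<lambda>\<omega>. ([x, y] ! k) 0 \<omega> * W t \<omega>) \<in> borel_measurable M"
        using B_square_integrable[OF i t] wiener_process_moments(1)[OF W t]
        by (auto intro!: borel_measurable_times simp: square_integrable_def)
    qed
    ultimately show ?thesis by simp
  qed
  ultimately show thesis using that[OF B(1) AEB] by blast
qed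

text \<open>
The quantities \<open>T / \<epsilon>\<close> and \<open>\<Delta> / \<epsilon>\<close> are minus the trace and the determinant of the drift of the signal;
clearing the powers of \<open>\<epsilon>\<close> leaves expressions that are regular at \<open>\<epsilon> = 0\<close>.
\<close>

lemma msm_parameters_full_model:
  assumes model: "full_model M A \<sigma>x \<sigma>y R \<epsilon> Wx Wy V x y z" and msm: "msm_parameters M x ar \<sigma>X"
    and A: "negative_definite A" and \<epsilon>: "\<epsilon> > 0" and \<sigma>: "\<sigma>x > 0"
  defines "T \<equiv> - (\<epsilon> * A $ 1 $ 1 + A $ 2 $ 2)" and "\<Delta> \<equiv> A $ 1 $ 1 * A $ 2 $ 2 - A $ 1 $ 2 * A $ 2 $ 1"
    and "N \<equiv> \<sigma>x\<^sup>2 * (A $ 2 $ 2)\<^sup>2 + \<epsilon> * \<sigma>y\<^sup>2 * (A $ 1 $ 2)\<^sup>2"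
  shows "ar = - (\<Delta> * (N + \<epsilon> * \<sigma>x\<^sup>2 * \<Delta>)) / (N * T)"
    and "\<sigma>X\<^sup>2 = - ar * (N + \<epsilon> * \<sigma>x\<^sup>2 * \<Delta>) / (T * \<Delta>)"
proof -
  define a b c d where "a = A $ 1 $ 1" and "b = A $ 1 $ 2" and "c = A $ 2 $ 1" and "d = A $ 2 $ 2"
  note abcd = a_def[symmetric] b_def[symmetric] c_def[symmetric] d_def[symmetric]
  obtain B where B: "wiener_noise M 3 B"
    and "AE \<omega> in M. \<forall>t. B 0 t \<omega> = Wx t \<omega> \<and> B 1 t \<omega> = Wy t \<omega> \<and> B 2 t \<omega> = V t \<omega>"
    and Y: "wiener_noise.linear_sde M 3 B 2 (planar a b (c / \<epsilon>) (d / \<epsilon>)) (diagonal_noise \<sigma>x (\<sigma>y / sqrt \<epsilon>)) (\<lambda>k. [x, y] ! k)"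
    and ortho: "\<forall>k<2. \<forall>i<3. \<forall>t\<ge>0. (\<integral>\<omega>. ([x, y] ! k) 0 \<omega> * B i t \<omega> \<partial>M) = 0"
    by (rule full_model_signal[OF model, unfolded abcd])
  have neg: "a < 0" "d < 0" "\<Delta> > 0"
    using negative_definite_22[OF A] by (simp_all add: abcd \<Delta>_def)
  have T: "T > 0" unfolding T_def abcd using neg mult_pos_neg[OF \<epsilon> neg(1)] by linarith
  have \<Delta>: "\<Delta> = a * d - b * c" by (simp add: \<Delta>_def abcd)
  have N: "N > 0" unfolding N_def abcd using \<sigma> neg \<epsilon> by (intro add_pos_nonneg) auto
  have eqT: "- (a + d / \<epsilon>) = T / \<epsilon>" and eqD: "a * (d / \<epsilon>) - b * (c / \<epsilon>) = \<Delta> / \<epsilon>"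
    using \<epsilon> by (simp_all add: T_def \<Delta> abcd field_simps)
  have "T / \<epsilon> > 0" "\<Delta> / \<epsilon> > 0" using T neg(3) \<epsilon> by simp_all
  then have st: "a + d / \<epsilon> < 0" "a * (d / \<epsilon>) - b * (c / \<epsilon>) > 0" using eqT eqD by linarith+
  define C where "C = (N + \<epsilon> * \<sigma>x\<^sup>2 * \<Delta>) / (2 * T * \<Delta>)"
  have C: "C > 0" unfolding C_def using N T neg \<epsilon> by (auto intro!: divide_pos_pos add_pos_nonneg)
  have q: "(\<sigma>y / sqrt \<epsilon>)\<^sup>2 = \<sigma>y\<^sup>2 / \<epsilon>" using \<epsilon> by (simp add: power_divide)
  have C_eq: "(\<sigma>x\<^sup>2 * (\<Delta> / \<epsilon> + (d / \<epsilon>)\<^sup>2) + (\<sigma>y / sqrt \<epsilon>)\<^sup>2 * b\<^sup>2) / (2 * (T / \<epsilon>) * (\<Delta> / \<epsilon>)) = C"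
    unfolding C_def q N_def abcd using \<epsilon> T neg(3) by (simp add: field_simps power2_eq_square)
  note st' = wiener_noise.planar_signal_statistics(2,3)[OF B refl st _ Y ortho[rule_format], unfolded eqT eqD C_eq, of]
  have var: "equilibrium_variance M x = C" using st'(1) \<sigma> by simp
  have "correlation_time M x = (\<sigma>x\<^sup>2 * (d / \<epsilon>)\<^sup>2 + (\<sigma>y / sqrt \<epsilon>)\<^sup>2 * b\<^sup>2) / (2 * (\<Delta> / \<epsilon>)\<^sup>2 * C)"
    using st'(2) \<sigma> by simp
  also have "\<dots> = N / (2 * \<Delta>\<^sup>2 * C)"
    unfolding q N_def abcd using \<epsilon> neg(3) C by (simp add: field_simps power2_eq_square)
  finally have corr: "correlation_time M x = N / (2 * \<Delta>\<^sup>2 * C)" .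
  have "- (1 / ar) = N / (2 * \<Delta>\<^sup>2 * C)" and v: "- (\<sigma>X\<^sup>2 / (2 * ar)) = C"
    using msm unfolding msm_parameters_def var corr by auto
  moreover have pos: "N / (2 * \<Delta>\<^sup>2 * C) > 0" using N C neg by simp
  ultimately have "ar \<noteq> 0" by auto
  have "ar = - 1 / (- (1 / ar))" by simp
  also have "\<dots> = - 1 / (N / (2 * \<Delta>\<^sup>2 * C))" unfolding \<open>- (1 / ar) = N / (2 * \<Delta>\<^sup>2 * C)\<close> ..
  also have "\<dots> = - (2 * \<Delta>\<^sup>2 * C) / N" by simp
  also have "\<dots> = - (\<Delta> * (N + \<epsilon> * \<sigma>x\<^sup>2 * \<Delta>)) / (N * T)"
    unfolding C_def using N T neg by (simp add: field_simps power2_eq_square)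
  finally show "ar = - (\<Delta> * (N + \<epsilon> * \<sigma>x\<^sup>2 * \<Delta>)) / (N * T)" .
  have "\<sigma>X\<^sup>2 = - 2 * ar * C" using v \<open>ar \<noteq> 0\<close> by (simp add: field_simps)
  also have "\<dots> = - ar * (N + \<epsilon> * \<sigma>x\<^sup>2 * \<Delta>) / (T * \<Delta>)" unfolding C_def using T neg by simp
  finally show "\<sigma>X\<^sup>2 = - ar * (N + \<epsilon> * \<sigma>x\<^sup>2 * \<Delta>) / (T * \<Delta>)" .
qed

lemma innovation_integral:
  fixes w x m :: "real \<Rightarrow> real"
  assumes "continuous_on {0..} w" "continuous_on {0..} x" "continuous_on {0..} m"
  shows "integral {0..t} w + k * (integral {0..t} x + v - integral {0..t} m)
    = integral {0..t} (\<lambda>s. w s + k * x s - k * m s) + k * v"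
proof -
  have i: "w integrable_on {0..t}" "x integrable_on {0..t}" "m integrable_on {0..t}"
    using assms by (auto intro!: integrable_continuous_interval intro: continuous_on_subset)
  have "integral {0..t} (\<lambda>s. w s + k * x s - k * m s)
    = integral {0..t} w + k * integral {0..t} x - k * integral {0..t} m"
    by (subst Henstock_Kurzweil_Integration.integral_diff Henstock_Kurzweil_Integration.integral_add,
        (intro integrable_add integrable_on_mult_right i)+)+ simp
  then show ?thesis by (simp add: algebra_simps)
qed

text \<open>
Substituting the observation equation into the two filters makes signal and filters a single
linear system driven by the noise.
\<close>

lemma filters_linear_sde:
  assumes model: "full_model M A \<sigma>x \<sigma>y R \<epsilon> Wx Wy V x y z"
    and filter: "true_filter_mean M A R \<epsilon> S z m"
    and reduced: "reduced_filter_mean M ar R s z xt"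
    and sym: "S $ 2 $ 1 = S $ 1 $ 2"
  obtains B where "wiener_noise M 3 B"
    and "wiener_noise.linear_sde M 3 B 5
      (filter_system (A $ 1 $ 1) (A $ 1 $ 2) (A $ 2 $ 1 / \<epsilon>) (A $ 2 $ 2 / \<epsilon>) (S $ 1 $ 1 / R) (S $ 1 $ 2 / R) (s / R) (s / R - ar))
      (filter_noise \<sigma>x (\<sigma>y / sqrt \<epsilon>) (sqrt R) (S $ 1 $ 1 / R) (S $ 1 $ 2 / R) (s / R))
      (\<lambda>k. [x, y, \<lambda>t \<omega>. m t \<omega> $ 1, \<lambda>t \<omega>. m t \<omega> $ 2, xt] ! k)"
proof -
  obtain B where B: "wiener_noise M 3 B"
    and AEB: "AE \<omega> in M. \<forall>t. B 0 t \<omega> = Wx t \<omega> \<and> B 1 t \<omega> = Wy t \<omega> \<and> B 2 t \<omega> = V t \<omega>"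
    and Y2: "wiener_noise.linear_sde M 3 B 2 (planar (A $ 1 $ 1) (A $ 1 $ 2) (A $ 2 $ 1 / \<epsilon>) (A $ 2 $ 2 / \<epsilon>))
          (diagonal_noise \<sigma>x (\<sigma>y / sqrt \<epsilon>)) (\<lambda>k. [x, y] ! k)"
    by (rule full_model_signal[OF model])
  interpret wiener_noise M 3 B by fact
  define a b c d k l \<mu> where "a = A $ 1 $ 1" and "b = A $ 1 $ 2" and "c = A $ 2 $ 1 / \<epsilon>" and "d = A $ 2 $ 2 / \<epsilon>"
    and "k = S $ 1 $ 1 / R" and "l = S $ 1 $ 2 / R" and "\<mu> = s / R"
  note abcd = a_def[symmetric] b_def[symmetric] c_def[symmetric] d_def[symmetric]
    k_def[symmetric] l_def[symmetric] \<mu>_def[symmetric]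
  define Y where "Y = (\<lambda>k. [x, y, \<lambda>t \<omega>. m t \<omega> $ 1, \<lambda>t \<omega>. m t \<omega> $ 2, xt] ! k)"
  have Ynth: "Y 0 = x" "Y 1 = y" "Y 2 = (\<lambda>t \<omega>. m t \<omega> $ 1)" "Y 3 = (\<lambda>t \<omega>. m t \<omega> $ 2)" "Y 4 = xt"
    by (simp_all add: Y_def)
  have mproc: "continuous_process M m" "integrable M (\<lambda>\<omega>. (norm (m 0 \<omega>))\<^sup>2)"
    and meq: "AE \<omega> in M. \<forall>t\<ge>0.
        m t \<omega> = m 0 \<omega> + integral {0..t} (\<lambda>s. A_eps A \<epsilon> *v m s \<omega>)
                + kalman_gain R S *v vec (z t \<omega> - z 0 \<omega> - integral {0..t} (\<lambda>s. m s \<omega> $ 1))"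
    using filter unfolding true_filter_mean_def by blast+
  have xtproc: "continuous_process M xt" "integrable M (\<lambda>\<omega>. (xt 0 \<omega>)\<^sup>2)"
    and xteq: "AE \<omega> in M. \<forall>t\<ge>0.
        xt t \<omega> = xt 0 \<omega> + integral {0..t} (\<lambda>u. ar * xt u \<omega>)
                + s / R * (z t \<omega> - z 0 \<omega> - integral {0..t} (\<lambda>u. xt u \<omega>))"
    using reduced unfolding reduced_filter_mean_def by blast+
  have zeq: "AE \<omega> in M. \<forall>t\<ge>0. z t \<omega> = z 0 \<omega> + integral {0..t} (\<lambda>s. x s \<omega>) + sqrt R * V t \<omega>"
    using model unfolding full_model_def by blast
  have mmeas: "(\<lambda>\<omega>. m t \<omega> $ i) \<in> borel_measurable M" if "t \<ge> 0" for t i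
    using mproc(1) that unfolding continuous_process_def
    by (intro measurable_compose[OF _ borel_measurable_continuous_onI[OF continuous_on_component[OF continuous_on_id]]]) auto
  have "square_integrable M (\<lambda>\<omega>. m 0 \<omega> $ i)" for i
    unfolding square_integrable_def
  proof (intro conjI mmeas order_refl Bochner_Integration.integrable_bound[OF mproc(2)])
    show "(\<lambda>\<omega>. (m 0 \<omega> $ i)\<^sup>2) \<in> borel_measurable M" using mmeas[of 0 i] by simp
    have "\<bar>v $ i\<bar>\<^sup>2 \<le> (norm v)\<^sup>2" for v :: "real^2" by (intro power_mono component_le_norm_cart) simp
    then show "AE \<omega> in M. norm ((m 0 \<omega> $ i)\<^sup>2) \<le> norm ((norm (m 0 \<omega>))\<^sup>2)" by simp
  qed
  moreover have "square_integrable M (xt 0)"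
    using xtproc unfolding square_integrable_def continuous_process_def by simp
  moreover have "square_integrable M (x 0)" "square_integrable M (y 0)"
    using linear_sde_measurable(1)[OF Y2, of 0] linear_sde_measurable(1)[OF Y2, of 1] by simp_all
  ultimately have sq: "square_integrable M (Y i 0)" if "i < 5" for i
    using that unfolding less_5_cases by (elim disjE) (simp_all only: Ynth)
  have "x t \<in> borel_measurable M" "y t \<in> borel_measurable M" "xt t \<in> borel_measurable M" if "t \<ge> 0" for t
    using linear_sde_measurable(2)[OF Y2, of 0] linear_sde_measurable(2)[OF Y2, of 1] xtproc that
    unfolding continuous_process_def by simp_all
  then have meas: "Y i t \<in> borel_measurable M" if "i < 5" "t \<ge> 0" for i t
    using that mmeas unfolding less_5_cases by (elim disjE) (simp_all only: Ynth)
  have "AE \<omega> in M. continuous_on {0..} (\<lambda>t. m t \<omega>)" "AE \<omega> in M. continuous_on {0..} (\<lambda>t. xt t \<omega>)"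
    using mproc xtproc unfolding continuous_process_def by blast+
  moreover have "AE \<omega> in M. \<forall>k<2. continuous_on {0..} (\<lambda>t. ([x, y] ! k) t \<omega>) \<and>
        (\<forall>t\<ge>0. ([x, y] ! k) t \<omega> = ([x, y] ! k) 0 \<omega>
          + integral {0..t} (\<lambda>s. \<Sum>j<2. planar a b c d k j * ([x, y] ! j) s \<omega>)
          + (\<Sum>i<3. diagonal_noise \<sigma>x (\<sigma>y / sqrt \<epsilon>) k i * B i t \<omega>))"
    using Y2 unfolding linear_sde_def abcd by blast
  ultimately have "AE \<omega> in M. \<forall>i<5. continuous_on {0..} (\<lambda>t. Y i t \<omega>) \<and>
      (\<forall>t\<ge>0. Y i t \<omega> = Y i 0 \<omega> + integral {0..t} (\<lambda>s. \<Sum>j<5. filter_system a b c d k l \<mu> (\<mu> - ar) i j * Y j s \<omega>)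
        + (\<Sum>j<3. filter_noise \<sigma>x (\<sigma>y / sqrt \<epsilon>) (sqrt R) k l \<mu> i j * B j t \<omega>))"
    using AEB meq xteq zeq
  proof eventually_elim
    case (elim \<omega>)
    define m1 m2 where "m1 = (\<lambda>t. m t \<omega> $ 1)" and "m2 = (\<lambda>t. m t \<omega> $ 2)"
    have cx: "continuous_on {0..} (\<lambda>t. x t \<omega>)" and cy: "continuous_on {0..} (\<lambda>t. y t \<omega>)"
      using elim(3)[rule_format, of 0, THEN conjunct1] elim(3)[rule_format, of 1, THEN conjunct1] by simp_all
    have cm: "continuous_on {0..} m1" "continuous_on {0..} m2"
      unfolding m1_def m2_def by (intro continuous_intros elim(1))+
    have cxt: "continuous_on {0..} (\<lambda>t. xt t \<omega>)" by (rule elim(2))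
    have innov: "z t \<omega> - z 0 \<omega> = integral {0..t} (\<lambda>s. x s \<omega>) + sqrt R * B 2 t \<omega>" if "t \<ge> 0" for t
      using elim(7)[rule_format, OF that] elim(4) by simp
    have e0: "x t \<omega> = x 0 \<omega> + integral {0..t} (\<lambda>s. a * x s \<omega> + b * y s \<omega>) + \<sigma>x * B 0 t \<omega>" if "t \<ge> 0" for t
      using elim(3)[rule_format, of 0, THEN conjunct2, rule_format, OF _ that]
      by (simp add: sum_less_2 sum_less_3 planar_def diagonal_noise_def)
    have e1: "y t \<omega> = y 0 \<omega> + integral {0..t} (\<lambda>s. c * x s \<omega> + d * y s \<omega>) + \<sigma>y / sqrt \<epsilon> * B 1 t \<omega>" if "t \<ge> 0" for t
      using elim(3)[rule_format, of 1, THEN conjunct2, rule_format, OF _ that]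
      by (simp add: sum_less_2 sum_less_3 planar_def diagonal_noise_def)
    have em: "m t \<omega> $ i = m 0 \<omega> $ i + integral {0..t} (\<lambda>s. (A_eps A \<epsilon> $ i $ 1) * m1 s + (A_eps A \<epsilon> $ i $ 2) * m2 s)
       + S $ i $ 1 / R * (integral {0..t} (\<lambda>s. x s \<omega>) + sqrt R * B 2 t \<omega> - integral {0..t} m1)" if t: "t \<ge> 0" for t i
    proof -
      have "continuous_on {0..t} (\<lambda>s. A_eps A \<epsilon> *v m s \<omega>)"
        by (intro continuous_on_subset[OF linear_continuous_on_compose[OF elim(1) matrix_vector_mul_linear]]) auto
      then have "(\<lambda>s. A_eps A \<epsilon> *v m s \<omega>) integrable_on {0..t}" by (rule integrable_continuous_interval)
      from integral_component_eq_cart[OF this, of i]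
      have "integral {0..t} (\<lambda>s. A_eps A \<epsilon> *v m s \<omega>) $ i
        = integral {0..t} (\<lambda>s. (A_eps A \<epsilon> $ i $ 1) * m1 s + (A_eps A \<epsilon> $ i $ 2) * m2 s)"
        by (simp add: matrix_vector_mult_def sum_2 m1_def m2_def)
      moreover have "(kalman_gain R S *v vec q) $ i = S $ i $ 1 / R * q" for q
        by (simp add: kalman_gain_def matrix_vector_mult_def matrix_matrix_mult_def transpose_def sum_2)
      ultimately show ?thesis
        using arg_cong[OF elim(5)[rule_format, OF t], of "\<lambda>v. v $ i"] innov[OF t]
        by (simp add: m1_def)
    qed
    have e2: "m1 t = m1 0 + integral {0..t} (\<lambda>s. k * x s \<omega> + (a - k) * m1 s + b * m2 s) + k * sqrt R * B 2 t \<omega>"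
      if "t \<ge> 0" for t
    proof -
      have "(\<lambda>s. k * x s \<omega> + (a - k) * m1 s + b * m2 s) = (\<lambda>s. (a * m1 s + b * m2 s) + k * x s \<omega> - k * m1 s)"
        by (auto simp: algebra_simps)
      then show ?thesis
        using em[OF that, of 1] innovation_integral[of "\<lambda>s. a * m1 s + b * m2 s" "\<lambda>s. x s \<omega>" m1 t k "sqrt R * B 2 t \<omega>"] cx cm
        by (simp add: abcd m1_def[symmetric] continuous_intros) (simp add: m1_def)
    qed
    have e3: "m2 t = m2 0 + integral {0..t} (\<lambda>s. l * x s \<omega> + (c - l) * m1 s + d * m2 s) + l * sqrt R * B 2 t \<omega>"
      if "t \<ge> 0" for t
    proof -
      have "(\<lambda>s. l * x s \<omega> + (c - l) * m1 s + d * m2 s) = (\<lambda>s. (c * m1 s + d * m2 s) + l * x s \<omega> - l * m1 s)"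
        by (auto simp: algebra_simps)
      then show ?thesis
        using em[OF that, of 2] innovation_integral[of "\<lambda>s. c * m1 s + d * m2 s" "\<lambda>s. x s \<omega>" m1 t l "sqrt R * B 2 t \<omega>"] cx cm
        by (simp add: abcd sym continuous_intros) (simp add: m2_def)
    qed
    have e4: "xt t \<omega> = xt 0 \<omega> + integral {0..t} (\<lambda>s. \<mu> * x s \<omega> + - (\<mu> - ar) * xt s \<omega>) + \<mu> * sqrt R * B 2 t \<omega>"
      if "t \<ge> 0" for t
    proof -
      have "(\<lambda>s. \<mu> * x s \<omega> + - (\<mu> - ar) * xt s \<omega>) = (\<lambda>s. ar * xt s \<omega> + \<mu> * x s \<omega> - \<mu> * xt s \<omega>)"
        by (auto simp: algebra_simps)
      then show ?thesis
        using elim(6)[rule_format, OF that] innov[OF that]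
          innovation_integral[of "\<lambda>s. ar * xt s \<omega>" "\<lambda>s. x s \<omega>" "\<lambda>s. xt s \<omega>" t \<mu> "sqrt R * B 2 t \<omega>"] cx cxt
        by (simp add: abcd continuous_intros)
    qed
    note row = sum_less_5 sum_less_3 Ynth filter_system_def filter_noise_def
    show ?case
    proof (intro allI impI)
      fix i :: nat assume "i < 5"
      then consider "i = 0" | "i = 1" | "i = 2" | "i = 3" | "i = 4" unfolding less_5_cases by blast
      then show "continuous_on {0..} (\<lambda>t. Y i t \<omega>) \<and>
        (\<forall>t\<ge>0. Y i t \<omega> = Y i 0 \<omega> + integral {0..t} (\<lambda>s. \<Sum>j<5. filter_system a b c d k l \<mu> (\<mu> - ar) i j * Y j s \<omega>)
        + (\<Sum>j<3. filter_noise \<sigma>x (\<sigma>y / sqrt \<epsilon>) (sqrt R) k l \<mu> i j * B j t \<omega>))"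
      proof cases
        case 1 show ?thesis unfolding 1 row by (simp, intro conjI allI impI cx e0[simplified])
      next
        case 2 show ?thesis unfolding 2 row by (simp, intro conjI allI impI cy e1[simplified])
      next
        case 3 show ?thesis unfolding 3 row
          by (simp flip: m1_def[THEN fun_cong] m2_def[THEN fun_cong], intro conjI allI impI cm e2[simplified])
      next
        case 4 show ?thesis unfolding 4 row
          by (simp flip: m1_def[THEN fun_cong] m2_def[THEN fun_cong], intro conjI allI impI cm e3[simplified])
      next
        case 5 show ?thesis unfolding 5 row by (simp, intro conjI allI impI cxt e4[simplified])
      qed
    qed
  qed
  then have "linear_sde 5 (filter_system a b c d k l \<mu> (\<mu> - ar)) (filter_noise \<sigma>x (\<sigma>y / sqrt \<epsilon>) (sqrt R) k l \<mu>) Y"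
    unfolding linear_sde_def using sq meas by blast
  then show thesis using that[OF B] unfolding abcd Y_def by blast
qed

section \<open>Expansion in the scale separation\<close>

abbreviation bounded_at_0 :: "(real \<Rightarrow> real) \<Rightarrow> bool" where
  "bounded_at_0 f \<equiv> f \<in> O[at_right 0](\<lambda>_. 1)"

lemma bounded_at_0_tendsto: "(f \<longlongrightarrow> l) (at_right 0) \<Longrightarrow> bounded_at_0 f"
  by (rule bigoI_tendsto[where c = l]) simp_all

lemma bounded_at_0_mult: "bounded_at_0 f \<Longrightarrow> bounded_at_0 g \<Longrightarrow> bounded_at_0 (\<lambda>\<epsilon>. f \<epsilon> * g \<epsilon>)"
  using landau_o.big.mult[of f "at_right 0" "\<lambda>_. 1" g "\<lambda>_. 1"] by simp

lemma bounded_at_0_ident: "bounded_at_0 (\<lambda>\<epsilon>. \<epsilon>)"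
  by (rule bounded_at_0_tendsto[where l = 0]) (rule tendsto_ident_at)

lemma bounded_at_0_const: "bounded_at_0 (\<lambda>_. c)"
  by simp

lemma bounded_at_0_power: "bounded_at_0 f \<Longrightarrow> bounded_at_0 (\<lambda>\<epsilon>. f \<epsilon> ^ k)"
  by (induction k) (auto intro: bounded_at_0_mult)

lemma bounded_at_0_abs: "bounded_at_0 f \<Longrightarrow> bounded_at_0 (\<lambda>\<epsilon>. \<bar>f \<epsilon>\<bar>)"
  by (simp add: landau_o.big.abs_in_iff)

lemma bounded_at_0_divide:
  assumes "bounded_at_0 f" "c > 0" "eventually (\<lambda>\<epsilon>. c \<le> g \<epsilon>) (at_right 0)"
  shows "bounded_at_0 (\<lambda>\<epsilon>. f \<epsilon> / g \<epsilon>)"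
proof -
  have "bounded_at_0 (\<lambda>\<epsilon>. 1 / g \<epsilon>)"
  proof (rule bigoI[where c = "1 / c"])
    show "eventually (\<lambda>\<epsilon>. norm (1 / g \<epsilon>) \<le> 1 / c * norm (1::real)) (at_right 0)"
      using assms(3) by eventually_elim (use assms(2) in \<open>simp add: frac_le\<close>)
  qed
  from bounded_at_0_mult[OF assms(1) this] show ?thesis by simp
qed

lemma bounded_at_0_divide_const: "bounded_at_0 f \<Longrightarrow> bounded_at_0 (\<lambda>\<epsilon>. f \<epsilon> / c)"
  using bounded_at_0_mult[of f "\<lambda>_. 1 / c"] by simp

lemma bounded_at_0_minus: "bounded_at_0 f \<Longrightarrow> bounded_at_0 (\<lambda>\<epsilon>. - f \<epsilon>)"
  by simp

lemma bounded_at_0_cong: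
  assumes "bounded_at_0 f" "\<And>\<epsilon>. \<epsilon> > 0 \<Longrightarrow> g \<epsilon> = f \<epsilon>"
  shows "bounded_at_0 g"
  using landau_o.big.in_cong[of g f "at_right 0" "\<lambda>_. 1"] assms
    eventually_mono[OF eventually_at_right_less[of 0], of "\<lambda>\<epsilon>. g \<epsilon> = f \<epsilon>"] by blast

lemma bounded_at_0I:
  assumes "\<And>\<epsilon>. \<epsilon> > 0 \<Longrightarrow> \<bar>f \<epsilon>\<bar> \<le> c"
  shows "bounded_at_0 f"
  by (rule bigoI[where c = c], rule eventually_mono[OF eventually_at_right_less[of 0]]) (use assms in simp)

lemma bounded_at_0_add: "bounded_at_0 f \<Longrightarrow> bounded_at_0 g \<Longrightarrow> bounded_at_0 (\<lambda>\<epsilon>. f \<epsilon> + g \<epsilon>)"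
  by (rule sum_in_bigo(1))

lemma bounded_at_0_diff: "bounded_at_0 f \<Longrightarrow> bounded_at_0 g \<Longrightarrow> bounded_at_0 (\<lambda>\<epsilon>. f \<epsilon> - g \<epsilon>)"
  by (rule sum_in_bigo(2))

lemmas bounded_at_0_intros = bounded_at_0_add bounded_at_0_diff bounded_at_0_mult bounded_at_0_ident
  bounded_at_0_const bounded_at_0_power bounded_at_0_abs bounded_at_0_divide_const bounded_at_0_minus

lemma power_at_0_mult: "bounded_at_0 f \<Longrightarrow> (\<lambda>\<epsilon>. \<epsilon> ^ k * f \<epsilon>) \<in> O[at_right 0](\<lambda>\<epsilon>. \<epsilon> ^ k)"
  using landau_o.big.mult[of "\<lambda>\<epsilon>. \<epsilon> ^ k" "at_right 0" "\<lambda>\<epsilon>. \<epsilon> ^ k" f "\<lambda>_. 1"] by simp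

text \<open>
The first two bounds on the diagonal entries grow like the square root of \<open>\<bar>s2\<bar>\<close> and like \<open>\<bar>s2\<bar>\<close>, so their product
grows more slowly than \<open>s2\<^sup>2\<close>.
\<close>

lemma off_diagonal_bound:
  fixes s1 s2 s3 C1 C2 :: real
  assumes "s1 \<ge> 0" "s3 \<ge> 0" "C1 \<ge> 0" "C2 \<ge> 0"
    and "s1\<^sup>2 \<le> C2 * (1 + \<bar>s2\<bar>)" and "s3 \<le> C1 * (1 + \<bar>s2\<bar>)" and "s2\<^sup>2 \<le> s1 * s3"
  shows "\<bar>s2\<bar> \<le> 1 + 8 * (C2 * C1\<^sup>2)"
proof (cases "\<bar>s2\<bar> \<le> 1")
  case True
  then show ?thesis using assms by (simp add: add_increasing2)
next
  case False
  define w where "w = \<bar>s2\<bar>"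
  have w: "w > 1" using False by (simp add: w_def)
  have "w ^ 4 = (s2\<^sup>2)\<^sup>2" by (simp add: w_def power_even_abs flip: power_mult)
  also have "\<dots> \<le> (s1 * s3)\<^sup>2" using assms(7) by (intro power_mono) auto
  also have "\<dots> = s1\<^sup>2 * s3\<^sup>2" by (simp add: power_mult_distrib)
  also have "\<dots> \<le> (C2 * (1 + w)) * (C1 * (1 + w))\<^sup>2"
    using assms w by (intro mult_mono power_mono) (auto simp: w_def)
  also have "\<dots> = (C2 * C1\<^sup>2) * (1 + w) ^ 3" by (simp add: power2_eq_square power3_eq_cube algebra_simps)
  also have "\<dots> \<le> (C2 * C1\<^sup>2) * (2 * w) ^ 3" using w assms by (intro mult_left_mono power_mono) auto
  also have "\<dots> = 8 * (C2 * C1\<^sup>2) * w ^ 3" by (simp add: power_mult_distrib)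
  finally have "w * w ^ 3 \<le> 8 * (C2 * C1\<^sup>2) * w ^ 3" by (simp add: eval_nat_numeral mult_ac)
  then have "w \<le> 8 * (C2 * C1\<^sup>2)" using w by (simp add: mult_le_cancel_right)
  then show ?thesis by (simp add: w_def)
qed

text \<open>
The entries \<open>s1\<close>, \<open>s2\<close>, \<open>s3\<close> of the true covariance, the MSM parameters \<open>a\<close> and \<open>sX\<close> (the square of
the noise strength), and the reduced covariance \<open>s\<close>, as functions of \<open>\<epsilon>\<close>.  The constants \<open>X\<close> and
\<open>Y\<close> are the squared noise coefficients of the signal.
\<close>

locale slow_fast_riccati =
  fixes \<alpha> \<beta> \<gamma> \<delta> X Y R :: real and s1 s2 s3 s a sX :: "real \<Rightarrow> real"
  assumes \<alpha>: "\<alpha> < 0" and \<delta>: "\<delta> < 0" and det: "\<alpha> * \<delta> - \<beta> * \<gamma> > 0" and X: "X > 0" and Y: "Y > 0" and R: "R > 0"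
    and r1: "\<epsilon> > 0 \<Longrightarrow> 2 * (\<alpha> * s1 \<epsilon> + \<beta> * s2 \<epsilon>) - (s1 \<epsilon>)\<^sup>2 / R + X = 0"
    and r2: "\<epsilon> > 0 \<Longrightarrow> \<alpha> * s2 \<epsilon> + \<beta> * s3 \<epsilon> + \<gamma> / \<epsilon> * s1 \<epsilon> + \<delta> / \<epsilon> * s2 \<epsilon> - s1 \<epsilon> * s2 \<epsilon> / R = 0"
    and r3: "\<epsilon> > 0 \<Longrightarrow> 2 * (\<gamma> / \<epsilon> * s2 \<epsilon> + \<delta> / \<epsilon> * s3 \<epsilon>) - (s2 \<epsilon>)\<^sup>2 / R + Y / \<epsilon> = 0"
    and psd: "\<epsilon> > 0 \<Longrightarrow> 0 \<le> s1 \<epsilon>" "\<epsilon> > 0 \<Longrightarrow> 0 \<le> s3 \<epsilon>" "\<epsilon> > 0 \<Longrightarrow> (s2 \<epsilon>)\<^sup>2 \<le> s1 \<epsilon> * s3 \<epsilon>"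
    and a: "\<epsilon> > 0 \<Longrightarrow> a \<epsilon> = - ((\<alpha> * \<delta> - \<beta> * \<gamma>) * (X * \<delta>\<^sup>2 + \<epsilon> * Y * \<beta>\<^sup>2 + \<epsilon> * X * (\<alpha> * \<delta> - \<beta> * \<gamma>)))
        / ((X * \<delta>\<^sup>2 + \<epsilon> * Y * \<beta>\<^sup>2) * - (\<epsilon> * \<alpha> + \<delta>))"
    and sX: "\<epsilon> > 0 \<Longrightarrow> sX \<epsilon> = - a \<epsilon> * (X * \<delta>\<^sup>2 + \<epsilon> * Y * \<beta>\<^sup>2 + \<epsilon> * X * (\<alpha> * \<delta> - \<beta> * \<gamma>))
        / (- (\<epsilon> * \<alpha> + \<delta>) * (\<alpha> * \<delta> - \<beta> * \<gamma>))"
    and s: "\<epsilon> > 0 \<Longrightarrow> 0 \<le> s \<epsilon>" "\<epsilon> > 0 \<Longrightarrow> - ((s \<epsilon>)\<^sup>2 / R) + 2 * a \<epsilon> * s \<epsilon> + sX \<epsilon> = 0"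
begin

text \<open>
At leading order \<open>- \<rho>\<close> is the slope of the slow manifold and \<open>a0\<close> the drift on it.
\<close>

definition "\<rho> = \<gamma> / \<delta>"
definition "a0 = \<alpha> - \<beta> * \<rho>"
definition "fast_noise = Y * \<beta>\<^sup>2 / \<delta>\<^sup>2"
definition "noise_level \<epsilon> = X + \<epsilon> * fast_noise"
definition "relaxation \<epsilon> = 1 + \<epsilon> * (\<alpha> / \<delta>)"

lemma a0_neg: "a0 < 0"
proof -
  have "a0 = (\<alpha> * \<delta> - \<beta> * \<gamma>) / \<delta>" using \<delta> by (simp add: a0_def \<rho>_def field_simps)
  then show ?thesis using det \<delta> by (simp add: divide_pos_neg)
qed

lemma det_eq: "\<alpha> * \<delta> - \<beta> * \<gamma> = \<delta> * a0"
  using \<delta> by (simp add: a0_def \<rho>_def field_simps)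

lemma noise_level_pos: "\<epsilon> \<ge> 0 \<Longrightarrow> noise_level \<epsilon> \<ge> X"
  unfolding noise_level_def fast_noise_def using Y by simp

lemma relaxation_pos: "\<epsilon> \<ge> 0 \<Longrightarrow> relaxation \<epsilon> \<ge> 1"
  unfolding relaxation_def using mult_nonneg_nonneg[of \<epsilon> "\<alpha> / \<delta>"] divide_neg_neg[OF \<alpha> \<delta>] by linarith

lemma a_eq:
  assumes \<epsilon>: "\<epsilon> > 0"
  shows "a \<epsilon> = a0 * (noise_level \<epsilon> + \<epsilon> * X * (a0 / \<delta>)) / (noise_level \<epsilon> * relaxation \<epsilon>)"
    and "sX \<epsilon> = (noise_level \<epsilon> + \<epsilon> * X * (a0 / \<delta>))\<^sup>2 / (noise_level \<epsilon> * (relaxation \<epsilon>)\<^sup>2)"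
proof -
  have N: "X * \<delta>\<^sup>2 + \<epsilon> * Y * \<beta>\<^sup>2 = \<delta>\<^sup>2 * noise_level \<epsilon>" using \<delta> by (simp add: noise_level_def fast_noise_def field_simps)
  have M: "X * \<delta>\<^sup>2 + \<epsilon> * Y * \<beta>\<^sup>2 + \<epsilon> * X * (\<alpha> * \<delta> - \<beta> * \<gamma>) = \<delta>\<^sup>2 * (noise_level \<epsilon> + \<epsilon> * X * (a0 / \<delta>))"
    unfolding N det_eq using \<delta> by (simp add: field_simps power2_eq_square)
  have T: "- (\<epsilon> * \<alpha> + \<delta>) = - (\<delta> * relaxation \<epsilon>)" using \<delta> by (simp add: relaxation_def field_simps)
  have nz: "noise_level \<epsilon> > 0" "relaxation \<epsilon> > 0" using noise_level_pos[of \<epsilon>] relaxation_pos[of \<epsilon>] X \<epsilon> by auto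
  show 1: "a \<epsilon> = a0 * (noise_level \<epsilon> + \<epsilon> * X * (a0 / \<delta>)) / (noise_level \<epsilon> * relaxation \<epsilon>)"
    unfolding a[OF \<epsilon>] M unfolding N T det_eq using nz \<delta> by (simp add: divide_simps)
  show "sX \<epsilon> = (noise_level \<epsilon> + \<epsilon> * X * (a0 / \<delta>))\<^sup>2 / (noise_level \<epsilon> * (relaxation \<epsilon>)\<^sup>2)"
    unfolding sX[OF \<epsilon>] M unfolding T det_eq 1 using nz \<delta> a0_neg by (simp add: divide_simps power2_eq_square)
qed

text \<open>
Coefficients and exact remainders of \<open>a = a0 - \<epsilon> a0 a_corr + \<epsilon>\<^sup>2 a2\<close> and \<open>sX = X + \<epsilon> sX1 + \<epsilon>\<^sup>2 sX2\<close>.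
Keeping the remainders as functions of \<open>\<epsilon>\<close> makes every expansion an identity, and only their
boundedness is left to show.
\<close>

definition "a_corr = \<beta> * \<rho> / \<delta>"
definition "a2 \<epsilon> = a0 * (\<alpha> / \<delta> * a_corr * noise_level \<epsilon> - fast_noise * (a0 / \<delta>)) / (noise_level \<epsilon> * relaxation \<epsilon>)"
definition "sX1 = fast_noise - 2 * a_corr * X"
definition "sX2 \<epsilon> = ((fast_noise + X * (a0 / \<delta>))\<^sup>2 - (fast_noise * sX1 + 2 * (\<alpha> / \<delta>) * (X * sX1 + fast_noise * X) + (\<alpha> / \<delta>)\<^sup>2 * X\<^sup>2
   + \<epsilon> * (2 * (\<alpha> / \<delta>) * fast_noise * sX1 + (\<alpha> / \<delta>)\<^sup>2 * (X * sX1 + fast_noise * X)) + \<epsilon>\<^sup>2 * (\<alpha> / \<delta>)\<^sup>2 * fast_noise * sX1)) / (noise_level \<epsilon> * (relaxation \<epsilon>)\<^sup>2)"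

lemma a_corr_eq: "a_corr = \<alpha> / \<delta> - a0 / \<delta>"
  using \<delta> by (simp add: a_corr_def a0_def field_simps)

lemma a_expansion:
  assumes \<epsilon>: "\<epsilon> > 0"
  shows "a \<epsilon> = a0 - \<epsilon> * (a0 * a_corr) + \<epsilon>\<^sup>2 * a2 \<epsilon>"
    and "sX \<epsilon> = X + \<epsilon> * sX1 + \<epsilon>\<^sup>2 * sX2 \<epsilon>"
proof -
  define e f where "e = \<alpha> / \<delta>" and "f = a0 / \<delta>"
  have nz: "noise_level \<epsilon> \<noteq> 0" "relaxation \<epsilon> \<noteq> 0" using noise_level_pos[of \<epsilon>] relaxation_pos[of \<epsilon>] X \<epsilon> by auto
  have a_corr: "a_corr = e - f" by (simp add: a_corr_eq e_def f_def)
  have "(a0 - \<epsilon> * (a0 * a_corr)) * (noise_level \<epsilon> * relaxation \<epsilon>) + \<epsilon>\<^sup>2 * (a0 * (e * a_corr * noise_level \<epsilon> - fast_noise * f)) = a0 * (noise_level \<epsilon> + \<epsilon> * X * f)"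
    unfolding a_corr relaxation_def noise_level_def e_def[symmetric] by (simp add: algebra_simps power2_eq_square)
  then show "a \<epsilon> = a0 - \<epsilon> * (a0 * a_corr) + \<epsilon>\<^sup>2 * a2 \<epsilon>"
    unfolding a_eq(1)[OF \<epsilon>] a2_def e_def[symmetric] f_def[symmetric] using nz by (simp add: divide_simps)
  have "(X + \<epsilon> * sX1) * (noise_level \<epsilon> * (relaxation \<epsilon>)\<^sup>2) + \<epsilon>\<^sup>2 * ((fast_noise + X * f)\<^sup>2 - (fast_noise * sX1 + 2 * e * (X * sX1 + fast_noise * X) + e\<^sup>2 * X\<^sup>2
     + \<epsilon> * (2 * e * fast_noise * sX1 + e\<^sup>2 * (X * sX1 + fast_noise * X)) + \<epsilon>\<^sup>2 * e\<^sup>2 * fast_noise * sX1)) = (noise_level \<epsilon> + \<epsilon> * X * f)\<^sup>2"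
    unfolding sX1_def a_corr relaxation_def noise_level_def e_def[symmetric] by (simp add: algebra_simps power2_eq_square)
  then show "sX \<epsilon> = X + \<epsilon> * sX1 + \<epsilon>\<^sup>2 * sX2 \<epsilon>"
    unfolding a_eq(2)[OF \<epsilon>] sX2_def e_def[symmetric] f_def[symmetric] using nz by (simp add: divide_simps)
qed

text \<open>
\<open>U\<close> is the correction in \<open>s2 = - \<rho> s1 + \<epsilon> U\<close>, and \<open>U = U0 + \<epsilon> U1\<close> separates its leading order, which
is an affine function of \<open>s1\<close>.
\<close>

definition "U \<epsilon> = (s1 \<epsilon> * s2 \<epsilon> / R - \<alpha> * s2 \<epsilon> - \<beta> * s3 \<epsilon>) / \<delta>"
definition "U0 \<epsilon> = - (\<rho> / \<delta>) * (a0 * s1 \<epsilon> + X) + \<beta> * Y / (2 * \<delta>\<^sup>2)"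
definition "U1 \<epsilon> = (U \<epsilon> * s1 \<epsilon> / R - a0 * U \<epsilon> - \<beta> * (s2 \<epsilon>)\<^sup>2 / (2 * \<delta> * R) - 2 * \<rho> * \<beta> * U \<epsilon>) / \<delta>"

lemma s2_eq: "\<epsilon> > 0 \<Longrightarrow> s2 \<epsilon> = - \<rho> * s1 \<epsilon> + \<epsilon> * U \<epsilon>"
proof -
  assume \<epsilon>: "\<epsilon> > 0"
  have "\<delta> * (\<epsilon> * U \<epsilon>) = \<epsilon> * (s1 \<epsilon> * s2 \<epsilon> / R - \<alpha> * s2 \<epsilon> - \<beta> * s3 \<epsilon>)" using \<delta> by (simp add: U_def)
  also have "s1 \<epsilon> * s2 \<epsilon> / R - \<alpha> * s2 \<epsilon> - \<beta> * s3 \<epsilon> = (\<gamma> * s1 \<epsilon> + \<delta> * s2 \<epsilon>) / \<epsilon>"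
    using r2[OF \<epsilon>] by (simp add: add_divide_distrib)
  finally have "\<delta> * (\<epsilon> * U \<epsilon>) = \<gamma> * s1 \<epsilon> + \<delta> * s2 \<epsilon>" using \<epsilon> by simp
  then have "\<epsilon> * U \<epsilon> = (\<gamma> * s1 \<epsilon> + \<delta> * s2 \<epsilon>) / \<delta>" using \<delta> by (simp add: field_simps)
  then show ?thesis using \<delta> by (simp add: \<rho>_def field_simps)
qed

lemma s1_eq: "\<epsilon> > 0 \<Longrightarrow> (s1 \<epsilon>)\<^sup>2 / R = 2 * a0 * s1 \<epsilon> + X + 2 * \<beta> * (\<epsilon> * U \<epsilon>)"
  using r1[of \<epsilon>] s2_eq[of \<epsilon>] by (simp add: a0_def algebra_simps)

lemma U_expansion:
  assumes \<epsilon>: "\<epsilon> > 0"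
  shows "U \<epsilon> = U0 \<epsilon> + \<epsilon> * U1 \<epsilon>"
proof -
  have "\<epsilon> * (2 * (\<gamma> / \<epsilon> * s2 \<epsilon> + \<delta> / \<epsilon> * s3 \<epsilon>) - (s2 \<epsilon>)\<^sup>2 / R + Y / \<epsilon>)
    = 2 * (\<gamma> * s2 \<epsilon> + \<delta> * s3 \<epsilon>) - \<epsilon> * (s2 \<epsilon>)\<^sup>2 / R + Y"
    using \<epsilon> R by (simp add: field_simps)
  then have "2 * \<delta> * s3 \<epsilon> = \<epsilon> * (s2 \<epsilon>)\<^sup>2 / R - Y - 2 * \<gamma> * s2 \<epsilon>" unfolding r3[OF \<epsilon>] by simp
  then have "s3 \<epsilon> = (\<epsilon> * (s2 \<epsilon>)\<^sup>2 / R - Y - 2 * \<gamma> * s2 \<epsilon>) / (2 * \<delta>)" using \<delta> by (simp add: field_simps)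
  then have s3: "s3 \<epsilon> = \<epsilon> * (s2 \<epsilon>)\<^sup>2 / (2 * \<delta> * R) - Y / (2 * \<delta>) - \<rho> * s2 \<epsilon>"
    by (simp add: \<rho>_def diff_divide_distrib mult_ac)
  have "\<delta> * U \<epsilon> = s1 \<epsilon> * s2 \<epsilon> / R - a0 * s2 \<epsilon> - \<beta> * (\<epsilon> * (s2 \<epsilon>)\<^sup>2 / (2 * \<delta> * R) - Y / (2 * \<delta>))"
  proof -
    have "\<delta> * U \<epsilon> = s1 \<epsilon> * s2 \<epsilon> / R - \<alpha> * s2 \<epsilon> - \<beta> * s3 \<epsilon>" using \<delta> by (simp add: U_def)
    then show ?thesis unfolding s3 a0_def by (simp add: algebra_simps)
  qed
  also have "s1 \<epsilon> * s2 \<epsilon> / R = - \<rho> * ((s1 \<epsilon>)\<^sup>2 / R) + \<epsilon> * (U \<epsilon> * s1 \<epsilon> / R)"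
    unfolding s2_eq[OF \<epsilon>] using R by (simp add: field_simps power2_eq_square)
  also have "\<dots> = - \<rho> * (2 * a0 * s1 \<epsilon> + X + 2 * \<beta> * (\<epsilon> * U \<epsilon>)) + \<epsilon> * (U \<epsilon> * s1 \<epsilon> / R)"
    unfolding s1_eq[OF \<epsilon>] ..
  also have "a0 * s2 \<epsilon> = - (a0 * \<rho> * s1 \<epsilon>) + \<epsilon> * (a0 * U \<epsilon>)" unfolding s2_eq[OF \<epsilon>] by (simp add: algebra_simps)
  finally have "\<delta> * U \<epsilon> = (- \<rho> * (a0 * s1 \<epsilon> + X) + \<beta> * (Y / (2 * \<delta>)))
     + \<epsilon> * (U \<epsilon> * s1 \<epsilon> / R - a0 * U \<epsilon> - \<beta> * (s2 \<epsilon>)\<^sup>2 / (2 * \<delta> * R) - 2 * \<rho> * \<beta> * U \<epsilon>)"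
    by (simp add: algebra_simps)
  moreover have "\<delta> * U0 \<epsilon> = - \<rho> * (a0 * s1 \<epsilon> + X) + \<beta> * (Y / (2 * \<delta>))"
    using \<delta> by (simp add: U0_def field_simps power2_eq_square)
  moreover have "\<delta> * U1 \<epsilon> = U \<epsilon> * s1 \<epsilon> / R - a0 * U \<epsilon> - \<beta> * (s2 \<epsilon>)\<^sup>2 / (2 * \<delta> * R) - 2 * \<rho> * \<beta> * U \<epsilon>"
    using \<delta> by (simp add: U1_def)
  ultimately have "\<delta> * U \<epsilon> = \<delta> * U0 \<epsilon> + \<epsilon> * (\<delta> * U1 \<epsilon>)" by (simp only:)
  then have "\<delta> * U \<epsilon> = \<delta> * (U0 \<epsilon> + \<epsilon> * U1 \<epsilon>)" by (simp add: algebra_simps)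
  then show ?thesis using \<delta> by simp
qed

definition "residual \<epsilon> = 2 * a2 \<epsilon> * s1 \<epsilon> + sX2 \<epsilon> - 2 * \<beta> * U1 \<epsilon>"

text \<open>
The heart of the matter: the terms of order \<open>\<epsilon>\<close> that \<open>U0\<close> brings into the equation for \<open>s1\<close> are
exactly those that the first order coefficients of \<open>a\<close> and \<open>sX\<close> bring into the reduced equation.
\<close>

lemma reduced_riccati_residual:
  assumes \<epsilon>: "\<epsilon> > 0"
  shows "- ((s1 \<epsilon>)\<^sup>2 / R) + 2 * a \<epsilon> * s1 \<epsilon> + sX \<epsilon> = \<epsilon>\<^sup>2 * residual \<epsilon>"
proof -
  have "2 * \<beta> * U0 \<epsilon> = - (2 * a_corr * (a0 * s1 \<epsilon> + X)) + fast_noise"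
    unfolding U0_def a_corr_def fast_noise_def using \<delta> by (simp add: field_simps power2_eq_square)
  then have "\<epsilon> * (2 * \<beta> * U0 \<epsilon>) = \<epsilon> * (- (2 * a_corr * (a0 * s1 \<epsilon> + X)) + fast_noise)" by simp
  then show ?thesis
    unfolding s1_eq[OF \<epsilon>] a_expansion[OF \<epsilon>] U_expansion[OF \<epsilon>] residual_def sX1_def
    by (simp add: algebra_simps power2_eq_square)
qed

definition "gap \<epsilon> = residual \<epsilon> / ((s \<epsilon> + s1 \<epsilon>) / R - 2 * a \<epsilon>)"

lemma tendsto_a: "(a \<longlongrightarrow> a0) (at_right 0)"
proof -
  have "((\<lambda>\<epsilon>. a0 * (noise_level \<epsilon> + \<epsilon> * X * (a0 / \<delta>)) / (noise_level \<epsilon> * relaxation \<epsilon>)) \<longlongrightarrow>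
     a0 * (X + 0 * fast_noise + 0 * X * (a0 / \<delta>)) / ((X + 0 * fast_noise) * (1 + 0 * (\<alpha> / \<delta>)))) (at_right 0)"
    unfolding noise_level_def relaxation_def by (intro tendsto_intros) (use X in auto)
  then have "((\<lambda>\<epsilon>. a0 * (noise_level \<epsilon> + \<epsilon> * X * (a0 / \<delta>)) / (noise_level \<epsilon> * relaxation \<epsilon>)) \<longlongrightarrow> a0) (at_right 0)"
    using X by simp
  then show ?thesis
    by (rule Lim_transform_eventually)
       (use a_eq(1) in \<open>auto intro: eventually_mono[OF eventually_at_right_less]\<close>)
qed

lemma a_negative: "\<epsilon> > 0 \<Longrightarrow> a \<epsilon> < 0"
proof -
  assume \<epsilon>: "\<epsilon> > 0"
  have "a0 / \<delta> > 0" using a0_neg \<delta> by (simp add: divide_neg_neg)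
  then have "\<epsilon> * X * (a0 / \<delta>) > 0" using X \<epsilon> by (intro mult_pos_pos)
  then have "noise_level \<epsilon> + \<epsilon> * X * (a0 / \<delta>) > 0" "noise_level \<epsilon> > 0" "relaxation \<epsilon> > 0"
    using noise_level_pos[of \<epsilon>] relaxation_pos[of \<epsilon>] X \<epsilon> by linarith+
  then show ?thesis unfolding a_eq(1)[OF \<epsilon>] using a0_neg by (simp add: divide_neg_pos mult_neg_pos)
qed

text \<open>
The reduced Riccati polynomial vanishes at \<open>s\<close> and is \<open>\<epsilon>\<^sup>2 residual\<close> at \<open>s1\<close>; the denominator of
\<open>gap\<close> is its difference quotient, which stays positive because \<open>a < 0\<close>.
\<close>

lemma s_difference:
  assumes \<epsilon>: "\<epsilon> > 0"
  shows "s \<epsilon> - s1 \<epsilon> = \<epsilon>\<^sup>2 * gap \<epsilon>"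
proof -
  define q where "q = (s \<epsilon> + s1 \<epsilon>) / R - 2 * a \<epsilon>"
  have "(s \<epsilon> + s1 \<epsilon>) / R \<ge> 0" using s(1)[OF \<epsilon>] psd(1)[OF \<epsilon>] R by simp
  then have q: "q > 0" unfolding q_def using a_negative[OF \<epsilon>] by linarith
  have "(s \<epsilon> - s1 \<epsilon>) * q = (s \<epsilon>)\<^sup>2 / R - (s1 \<epsilon>)\<^sup>2 / R - 2 * a \<epsilon> * s \<epsilon> + 2 * a \<epsilon> * s1 \<epsilon>"
    unfolding q_def by (simp add: algebra_simps power2_eq_square add_divide_distrib diff_divide_distrib)
  also have "\<dots> = \<epsilon>\<^sup>2 * residual \<epsilon>"
    using reduced_riccati_residual[OF \<epsilon>] s(2)[OF \<epsilon>] by linarith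
  finally have "(s \<epsilon> - s1 \<epsilon>) * q = \<epsilon>\<^sup>2 * residual \<epsilon>" .
  then show ?thesis using q unfolding gap_def q_def[symmetric] by (simp add: field_simps)
qed

text \<open>
The first and the third Riccati equation, in which \<open>\<alpha>\<close> and \<open>\<delta>\<close> are negative, bound the diagonal
entries in terms of \<open>\<bar>s2\<bar>\<close>.
\<close>

lemma bounded_covariance: "bounded_at_0 s1" "bounded_at_0 s2" "bounded_at_0 s3"
proof -
  define C1 C2 where "C1 = (Y + 2 * \<bar>\<gamma>\<bar>) / (- 2 * \<delta>)" and "C2 = R * (X + 2 * \<bar>\<beta>\<bar>)"
  have "Y + 2 * \<bar>\<gamma>\<bar> \<ge> 0" "- 2 * \<delta> \<ge> 0" "X + 2 * \<bar>\<beta>\<bar> \<ge> 0" "R \<ge> 0" using X Y R \<delta> by simp_all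
  then have C: "C1 \<ge> 0" "C2 \<ge> 0" unfolding C1_def C2_def
    by (simp_all only: divide_nonneg_nonneg mult_nonneg_nonneg)
  have 1: "(s1 \<epsilon>)\<^sup>2 \<le> C2 * (1 + \<bar>s2 \<epsilon>\<bar>)" if \<epsilon>: "\<epsilon> > 0" for \<epsilon>
  proof -
    have "\<alpha> * s1 \<epsilon> \<le> 0" using \<alpha> psd(1)[OF \<epsilon>] by (simp add: mult_nonpos_nonneg)
    moreover have "\<beta> * s2 \<epsilon> \<le> \<bar>\<beta>\<bar> * \<bar>s2 \<epsilon>\<bar>"
      using abs_ge_self[of "\<beta> * s2 \<epsilon>"] unfolding abs_mult .
    moreover have "(s1 \<epsilon>)\<^sup>2 / R = X + 2 * (\<alpha> * s1 \<epsilon>) + 2 * (\<beta> * s2 \<epsilon>)" using r1[OF \<epsilon>] by simp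
    ultimately have "(s1 \<epsilon>)\<^sup>2 / R \<le> X + 2 * (\<bar>\<beta>\<bar> * \<bar>s2 \<epsilon>\<bar>)" by simp
    also have "\<dots> \<le> (X + 2 * \<bar>\<beta>\<bar>) * (1 + \<bar>s2 \<epsilon>\<bar>)" using X by (simp add: distrib_left distrib_right)
    finally show ?thesis using R by (simp add: C2_def field_simps)
  qed
  have 3: "s3 \<epsilon> \<le> C1 * (1 + \<bar>s2 \<epsilon>\<bar>)" if \<epsilon>: "\<epsilon> > 0" for \<epsilon>
  proof -
    have "\<epsilon> * (2 * (\<gamma> / \<epsilon> * s2 \<epsilon> + \<delta> / \<epsilon> * s3 \<epsilon>) - (s2 \<epsilon>)\<^sup>2 / R + Y / \<epsilon>)
      = 2 * (\<gamma> * s2 \<epsilon>) + 2 * \<delta> * s3 \<epsilon> - \<epsilon> * (s2 \<epsilon>)\<^sup>2 / R + Y"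
      using \<epsilon> R by (simp add: field_simps)
    moreover have "\<epsilon> * (s2 \<epsilon>)\<^sup>2 / R \<ge> 0" using \<epsilon> R by simp
    moreover have "\<gamma> * s2 \<epsilon> \<le> \<bar>\<gamma>\<bar> * \<bar>s2 \<epsilon>\<bar>"
      using abs_ge_self[of "\<gamma> * s2 \<epsilon>"] unfolding abs_mult .
    ultimately have "- 2 * \<delta> * s3 \<epsilon> \<le> Y + 2 * (\<bar>\<gamma>\<bar> * \<bar>s2 \<epsilon>\<bar>)" unfolding r3[OF \<epsilon>] by simp
    also have "\<dots> \<le> (Y + 2 * \<bar>\<gamma>\<bar>) * (1 + \<bar>s2 \<epsilon>\<bar>)" using Y by (simp add: distrib_left distrib_right)
    finally have "s3 \<epsilon> * (- 2 * \<delta>) \<le> (Y + 2 * \<bar>\<gamma>\<bar>) * (1 + \<bar>s2 \<epsilon>\<bar>)" by (simp add: mult_ac)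
    then have "s3 \<epsilon> \<le> (Y + 2 * \<bar>\<gamma>\<bar>) * (1 + \<bar>s2 \<epsilon>\<bar>) / (- 2 * \<delta>)"
      using \<delta> by (subst pos_le_divide_eq) auto
    then show ?thesis by (simp add: C1_def)
  qed
  define K where "K = 1 + 8 * (C2 * C1\<^sup>2)"
  have 2: "\<bar>s2 \<epsilon>\<bar> \<le> K" if "\<epsilon> > 0" for \<epsilon>
    unfolding K_def by (rule off_diagonal_bound[OF psd(1,2)[OF that] C 1[OF that] 3[OF that] psd(3)[OF that]])
  then show "bounded_at_0 s2" by (rule bounded_at_0I)
  show "bounded_at_0 s3"
  proof (rule bounded_at_0I[where c = "C1 * (1 + K)"])
    fix \<epsilon> :: real assume \<epsilon>: "\<epsilon> > 0"
    have "C1 * (1 + \<bar>s2 \<epsilon>\<bar>) \<le> C1 * (1 + K)" using C 2[OF \<epsilon>] by (intro mult_left_mono) auto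
    then show "\<bar>s3 \<epsilon>\<bar> \<le> C1 * (1 + K)" using 3[OF \<epsilon>] psd(2)[OF \<epsilon>] by linarith
  qed
  show "bounded_at_0 s1"
  proof (rule bounded_at_0I[where c = "1 + C2 * (1 + K)"])
    fix \<epsilon> :: real assume \<epsilon>: "\<epsilon> > 0"
    have "C2 * (1 + \<bar>s2 \<epsilon>\<bar>) \<le> C2 * (1 + K)" using C 2[OF \<epsilon>] by (intro mult_left_mono) auto
    moreover have "s1 \<epsilon> \<le> 1 + (s1 \<epsilon>)\<^sup>2"
      using zero_le_power2[of "s1 \<epsilon> - 1 / 2"] by (simp add: power2_eq_square algebra_simps)
    ultimately show "\<bar>s1 \<epsilon>\<bar> \<le> 1 + C2 * (1 + K)" using 1[OF \<epsilon>] psd(1)[OF \<epsilon>] by linarith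
  qed
qed

lemma bounded_expansion_terms:
  "bounded_at_0 U" "bounded_at_0 a2" "bounded_at_0 residual" "bounded_at_0 gap" "bounded_at_0 s" "bounded_at_0 a"
proof -
  note b = bounded_covariance
  show U: "bounded_at_0 U" unfolding U_def by (intro bounded_at_0_intros b)
  have U1: "bounded_at_0 U1" unfolding U1_def by (intro bounded_at_0_intros b U)
  have nt: "eventually (\<lambda>\<epsilon>. X \<le> noise_level \<epsilon> * relaxation \<epsilon> ^ k) (at_right 0)" for k
  proof (rule eventually_mono[OF eventually_at_right_less[of 0]])
    fix \<epsilon> :: real assume "0 < \<epsilon>"
    then have "X * 1 \<le> noise_level \<epsilon> * relaxation \<epsilon> ^ k"
      using noise_level_pos[of \<epsilon>] relaxation_pos[of \<epsilon>] X by (intro mult_mono one_le_power) auto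
    then show "X \<le> noise_level \<epsilon> * relaxation \<epsilon> ^ k" by simp
  qed
  show a2: "bounded_at_0 a2" unfolding a2_def noise_level_def[abs_def]
    by (rule bounded_at_0_divide[OF _ X])
       (intro bounded_at_0_intros, use nt[of 1] in \<open>simp add: noise_level_def\<close>)
  have sX2: "bounded_at_0 sX2" unfolding sX2_def
    by (rule bounded_at_0_divide[OF _ X nt]) (intro bounded_at_0_intros)
  show residual: "bounded_at_0 residual" unfolding residual_def by (intro bounded_at_0_intros b U1 a2 sX2)
  show a: "bounded_at_0 a" by (rule bounded_at_0_tendsto[OF tendsto_a])
  have "eventually (\<lambda>\<epsilon>. a \<epsilon> < a0 / 2) (at_right 0)"
    using a0_neg by (intro order_tendstoD(2)[OF tendsto_a]) simp
  then have "eventually (\<lambda>\<epsilon>. - a0 \<le> (s \<epsilon> + s1 \<epsilon>) / R - 2 * a \<epsilon>) (at_right 0)"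
    using eventually_at_right_less[of 0]
  proof eventually_elim
    case (elim \<epsilon>)
    have "(s \<epsilon> + s1 \<epsilon>) / R \<ge> 0" using s(1)[OF elim(2)] psd(1)[OF elim(2)] R by simp
    then show ?case using elim(1) by linarith
  qed
  then show gap: "bounded_at_0 gap" unfolding gap_def using a0_neg
    by (intro bounded_at_0_divide[OF residual, of "- a0"]) auto
  have "bounded_at_0 (\<lambda>\<epsilon>. s1 \<epsilon> + \<epsilon>\<^sup>2 * gap \<epsilon>)" by (intro bounded_at_0_intros b gap)
  then show "bounded_at_0 s" by (rule bounded_at_0_cong) (use s_difference in \<open>simp add: algebra_simps\<close>)
qed

lemma covariance_difference: "(\<lambda>\<epsilon>. s \<epsilon> - s1 \<epsilon>) \<in> O[at_right 0](\<lambda>\<epsilon>. \<epsilon>\<^sup>2)"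
proof -
  have "eventually (\<lambda>\<epsilon>. s \<epsilon> - s1 \<epsilon> = \<epsilon>\<^sup>2 * gap \<epsilon>) (at_right 0)"
    by (rule eventually_mono[OF eventually_at_right_less]) (rule s_difference)
  then show ?thesis
    using power_at_0_mult[OF bounded_expansion_terms(4), of 2] by (simp add: landau_o.big.in_cong)
qed

text \<open>
Gains, damping of the reduced filter, and the data of the kernel \<open>g\<close> after the powers of \<open>\<epsilon>\<close> are
removed: \<open>g 0 = \<epsilon>\<^sup>2 gain_gap\<close>, \<open>g' 0 = \<epsilon> slope\<close>, the forcing is \<open>\<epsilon> forcing \<mu> exp (- \<kappa> t)\<close>, and
\<open>Th0 / \<epsilon>\<close> and \<open>Dh0 / \<epsilon>\<close> are minus the trace and the determinant of the filter matrix.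
\<close>

definition "k \<epsilon> = s1 \<epsilon> / R"
definition "l \<epsilon> = s2 \<epsilon> / R"
definition "\<mu> \<epsilon> = s \<epsilon> / R"
definition "\<kappa> \<epsilon> = \<mu> \<epsilon> - a \<epsilon>"
definition "a1 \<epsilon> = - a0 * a_corr + \<epsilon> * a2 \<epsilon>"
definition "gain_gap \<epsilon> = gap \<epsilon> / R"
definition "slope \<epsilon> = a1 \<epsilon> * k \<epsilon> - \<beta> * U \<epsilon> / R + \<epsilon> * (gain_gap \<epsilon> * (a \<epsilon> - 2 * k \<epsilon>)) - \<epsilon> ^ 3 * (gain_gap \<epsilon>)\<^sup>2"
definition "forcing \<epsilon> = \<delta> * gain_gap \<epsilon> - \<delta> * a2 \<epsilon> + (k \<epsilon> - a0) * (- a1 \<epsilon> + \<epsilon> * gain_gap \<epsilon>)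
  + (- a1 \<epsilon> + \<epsilon> * gain_gap \<epsilon>) * (\<beta> * \<rho> - \<epsilon> * a1 \<epsilon> + \<epsilon>\<^sup>2 * gain_gap \<epsilon>) + \<beta> * U \<epsilon> / R"
definition "Th0 \<epsilon> = - (\<epsilon> * (\<alpha> - k \<epsilon>) + \<delta>)"
definition "Dh0 \<epsilon> = \<delta> * (a0 - k \<epsilon>) + \<epsilon> * (\<beta> * l \<epsilon>)"

lemma a_first_order: "\<epsilon> > 0 \<Longrightarrow> a \<epsilon> = a0 + \<epsilon> * a1 \<epsilon>"
  using a_expansion(1)[of \<epsilon>] by (simp add: a1_def algebra_simps power2_eq_square)

lemma gain_eqs:
  assumes \<epsilon>: "\<epsilon> > 0"
  shows "\<mu> \<epsilon> = k \<epsilon> + \<epsilon>\<^sup>2 * gain_gap \<epsilon>" and "l \<epsilon> = - \<rho> * k \<epsilon> + \<epsilon> * (U \<epsilon> / R)"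
proof -
  have "\<mu> \<epsilon> - k \<epsilon> = (s \<epsilon> - s1 \<epsilon>) / R" by (simp add: \<mu>_def k_def diff_divide_distrib)
  then show "\<mu> \<epsilon> = k \<epsilon> + \<epsilon>\<^sup>2 * gain_gap \<epsilon>" unfolding s_difference[OF \<epsilon>] gain_gap_def by simp
  show "l \<epsilon> = - \<rho> * k \<epsilon> + \<epsilon> * (U \<epsilon> / R)"
    unfolding l_def s2_eq[OF \<epsilon>] k_def by (simp add: diff_divide_distrib)
qed

lemma kernel_initial_value: "\<epsilon> > 0 \<Longrightarrow> \<mu> \<epsilon> - k \<epsilon> = \<epsilon>\<^sup>2 * gain_gap \<epsilon>"
  using gain_eqs(1) by simp

lemma kernel_initial_slope:
  assumes \<epsilon>: "\<epsilon> > 0"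
  shows "k \<epsilon> * (k \<epsilon> - \<alpha>) - \<beta> * l \<epsilon> - \<kappa> \<epsilon> * \<mu> \<epsilon> = \<epsilon> * slope \<epsilon>"
proof -
  have "k \<epsilon> * (k \<epsilon> - \<alpha>) - \<beta> * l \<epsilon> = k \<epsilon> * (k \<epsilon> - a0) - \<epsilon> * (\<beta> * U \<epsilon> / R)"
    unfolding gain_eqs(2)[OF \<epsilon>] by (simp add: a0_def algebra_simps)
  moreover have "k \<epsilon> * (k \<epsilon> - a0) - \<epsilon> * (\<beta> * U \<epsilon> / R) - \<kappa> \<epsilon> * \<mu> \<epsilon> = \<epsilon> * slope \<epsilon>"
    unfolding \<kappa>_def slope_def gain_eqs(1)[OF \<epsilon>] a_first_order[OF \<epsilon>]
    by (simp add: algebra_simps power2_eq_square power3_eq_cube)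
  ultimately show ?thesis by simp
qed

text \<open>
The third identity states that \<open>- \<kappa>\<close> is nearly the slow eigenvalue of the true filter.  At order
\<open>1 / \<epsilon>\<close> this is \<open>a = a0\<close>, at order \<open>1\<close> it is the first order coefficient of \<open>a\<close>.
\<close>

lemma kernel_characteristic:
  assumes \<epsilon>: "\<epsilon> > 0"
  shows "- ((\<alpha> - k \<epsilon>) + \<delta> / \<epsilon>) = Th0 \<epsilon> / \<epsilon>"
    and "(\<alpha> - k \<epsilon>) * (\<delta> / \<epsilon>) - \<beta> * (\<gamma> / \<epsilon> - l \<epsilon>) = Dh0 \<epsilon> / \<epsilon>"
    and "(\<kappa> \<epsilon>)\<^sup>2 - Th0 \<epsilon> / \<epsilon> * \<kappa> \<epsilon> + Dh0 \<epsilon> / \<epsilon> = \<epsilon> * forcing \<epsilon>"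
proof -
  show "- ((\<alpha> - k \<epsilon>) + \<delta> / \<epsilon>) = Th0 \<epsilon> / \<epsilon>" using \<epsilon> by (simp add: Th0_def field_simps)
  show "(\<alpha> - k \<epsilon>) * (\<delta> / \<epsilon>) - \<beta> * (\<gamma> / \<epsilon> - l \<epsilon>) = Dh0 \<epsilon> / \<epsilon>"
  proof -
    have "(\<alpha> - k \<epsilon>) * (\<delta> / \<epsilon>) - \<beta> * (\<gamma> / \<epsilon> - l \<epsilon>) = ((\<alpha> * \<delta> - \<beta> * \<gamma>) - \<delta> * k \<epsilon> + \<epsilon> * (\<beta> * l \<epsilon>)) / \<epsilon>"
      using \<epsilon> by (simp add: field_simps)
    also have "\<dots> = Dh0 \<epsilon> / \<epsilon>" unfolding det_eq Dh0_def by (simp add: algebra_simps)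
    finally show ?thesis .
  qed
  have da_corr: "\<delta> * a_corr = \<beta> * \<rho>" using \<delta> by (simp add: a_corr_def)
  have \<kappa>: "\<kappa> \<epsilon> = k \<epsilon> - a0 - \<epsilon> * a1 \<epsilon> + \<epsilon>\<^sup>2 * gain_gap \<epsilon>"
    unfolding \<kappa>_def gain_eqs(1)[OF \<epsilon>] a_first_order[OF \<epsilon>] by simp
  define A1 K1 g u p r where "A1 = a1 \<epsilon>" and "K1 = k \<epsilon>" and "g = gain_gap \<epsilon>" and "u = U \<epsilon>"
    and "p = \<rho>" and "r = a0"
  note fold = A1_def[symmetric] K1_def[symmetric] g_def[symmetric] u_def[symmetric] p_def[symmetric] r_def[symmetric]
  have al: "\<alpha> = r + \<beta> * p" by (simp add: a0_def p_def r_def)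
  have a2: "\<epsilon> * (\<delta> * a2 \<epsilon>) = \<delta> * A1 + r * (\<beta> * p)"
    unfolding A1_def a1_def p_def r_def da_corr[symmetric] by (simp add: algebra_simps)
  have "\<epsilon> * forcing \<epsilon> = \<delta> * (\<epsilon> * g) - (\<delta> * A1 + r * (\<beta> * p)) + \<epsilon> * ((K1 - r) * (- A1 + \<epsilon> * g)
     + (- A1 + \<epsilon> * g) * (\<beta> * p - \<epsilon> * A1 + \<epsilon>\<^sup>2 * g) + \<beta> * u / R)"
    unfolding a2[symmetric] forcing_def fold by (simp add: algebra_simps)
  moreover have "\<epsilon> * ((\<kappa> \<epsilon>)\<^sup>2 - Th0 \<epsilon> / \<epsilon> * \<kappa> \<epsilon> + Dh0 \<epsilon> / \<epsilon>) = \<epsilon> * (\<kappa> \<epsilon>)\<^sup>2 - Th0 \<epsilon> * \<kappa> \<epsilon> + Dh0 \<epsilon>"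
    using \<epsilon> by (simp add: field_simps)
  moreover have "\<epsilon> * (\<kappa> \<epsilon>)\<^sup>2 - Th0 \<epsilon> * \<kappa> \<epsilon> + Dh0 \<epsilon> = \<epsilon> * (\<delta> * (\<epsilon> * g) - (\<delta> * A1 + r * (\<beta> * p)) + \<epsilon> * ((K1 - r) * (- A1 + \<epsilon> * g)
     + (- A1 + \<epsilon> * g) * (\<beta> * p - \<epsilon> * A1 + \<epsilon>\<^sup>2 * g) + \<beta> * u / R))"
    unfolding Th0_def Dh0_def \<kappa> gain_eqs(2)[OF \<epsilon>] fold
    by (simp add: al algebra_simps power2_eq_square)
  ultimately have "\<epsilon> * ((\<kappa> \<epsilon>)\<^sup>2 - Th0 \<epsilon> / \<epsilon> * \<kappa> \<epsilon> + Dh0 \<epsilon> / \<epsilon>) = \<epsilon> * (\<epsilon> * forcing \<epsilon>)" by simp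
  then show "(\<kappa> \<epsilon>)\<^sup>2 - Th0 \<epsilon> / \<epsilon> * \<kappa> \<epsilon> + Dh0 \<epsilon> / \<epsilon> = \<epsilon> * forcing \<epsilon>" using \<epsilon> by simp
qed

text \<open>
The bound of \<open>filter_difference_limit\<close> along the family of filters.
\<close>

definition err_bound :: "real \<Rightarrow> real" where
  "err_bound \<epsilon> =
    (let T = - (\<alpha> + \<delta> / \<epsilon>); D = \<alpha> * (\<delta> / \<epsilon>) - \<beta> * (\<gamma> / \<epsilon>);
         Th = - ((\<alpha> - k \<epsilon>) + \<delta> / \<epsilon>); Dh = (\<alpha> - k \<epsilon>) * (\<delta> / \<epsilon>) - \<beta> * (\<gamma> / \<epsilon> - l \<epsilon>);
         g0 = \<mu> \<epsilon> - k \<epsilon>; g1 = k \<epsilon> * (k \<epsilon> - \<alpha>) - \<beta> * l \<epsilon> - \<kappa> \<epsilon> * \<mu> \<epsilon>;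
         F = (((\<kappa> \<epsilon>)\<^sup>2 - Th * \<kappa> \<epsilon> + Dh) * \<mu> \<epsilon>)\<^sup>2 / (2 * \<kappa> \<epsilon>)
     in (2 * X / T\<^sup>2 + (2 * X * (\<delta> / \<epsilon>)\<^sup>2 + Y / \<epsilon> * \<beta>\<^sup>2) * (2 / (D * T\<^sup>2) + 1 / D\<^sup>2) + R)
        * ((2 * \<bar>g0 * g1\<bar> + 2 * ((g1\<^sup>2 + Dh * g0\<^sup>2) / Th + F / Th\<^sup>2) + Th * g0\<^sup>2) / Dh + F / Dh\<^sup>2))"

definition "T0 \<epsilon> = - (\<epsilon> * \<alpha> + \<delta>)"
definition "D0 = \<alpha> * \<delta> - \<beta> * \<gamma>"
definition "forcing_energy \<epsilon> = (forcing \<epsilon> * \<mu> \<epsilon>)\<^sup>2 / (2 * \<kappa> \<epsilon>)"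
definition "gain_factor \<epsilon> = 2 * X * \<epsilon>\<^sup>2 / (T0 \<epsilon>)\<^sup>2 + (2 * X * \<delta>\<^sup>2 + \<epsilon> * Y * \<beta>\<^sup>2) * (2 * \<epsilon> / (D0 * (T0 \<epsilon>)\<^sup>2) + 1 / D0\<^sup>2) + R"
definition "kernel_factor \<epsilon> = (2 * \<bar>gain_gap \<epsilon> * slope \<epsilon>\<bar> + 2 * (((slope \<epsilon>)\<^sup>2 + \<epsilon> * (Dh0 \<epsilon> * (gain_gap \<epsilon>)\<^sup>2)) / Th0 \<epsilon> + \<epsilon> * forcing_energy \<epsilon> / (Th0 \<epsilon>)\<^sup>2)
   + Th0 \<epsilon> * (gain_gap \<epsilon>)\<^sup>2) / Dh0 \<epsilon> + forcing_energy \<epsilon> / (Dh0 \<epsilon>)\<^sup>2"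

lemma err_bound_eq:
  assumes \<epsilon>: "\<epsilon> > 0"
  shows "err_bound \<epsilon> = \<epsilon> ^ 4 * (gain_factor \<epsilon> * kernel_factor \<epsilon>)"
proof -
  have T: "- (\<alpha> + \<delta> / \<epsilon>) = T0 \<epsilon> / \<epsilon>" and D: "\<alpha> * (\<delta> / \<epsilon>) - \<beta> * (\<gamma> / \<epsilon>) = D0 / \<epsilon>"
    using \<epsilon> by (simp_all add: T0_def D0_def field_simps)
  have 1: "2 * X / (T0 \<epsilon> / \<epsilon>)\<^sup>2 + (2 * X * (\<delta> / \<epsilon>)\<^sup>2 + Y / \<epsilon> * \<beta>\<^sup>2) * (2 / (D0 / \<epsilon> * (T0 \<epsilon> / \<epsilon>)\<^sup>2) + 1 / (D0 / \<epsilon>)\<^sup>2) + R = gain_factor \<epsilon>"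
  proof -
    have "2 * X * (\<delta> / \<epsilon>)\<^sup>2 + Y / \<epsilon> * \<beta>\<^sup>2 = (2 * X * \<delta>\<^sup>2 + \<epsilon> * Y * \<beta>\<^sup>2) / \<epsilon>\<^sup>2"
      using \<epsilon> by (simp add: field_simps power2_eq_square)
    moreover have "2 / (D0 / \<epsilon> * (T0 \<epsilon> / \<epsilon>)\<^sup>2) + 1 / (D0 / \<epsilon>)\<^sup>2 = \<epsilon>\<^sup>2 * (2 * \<epsilon> / (D0 * (T0 \<epsilon>)\<^sup>2) + 1 / D0\<^sup>2)"
      using \<epsilon> by (simp add: power_divide distrib_left power2_eq_square)
    ultimately show ?thesis unfolding gain_factor_def using \<epsilon> by (simp add: power_divide)
  qed
  have forcing_energy: "(\<epsilon> * forcing \<epsilon> * \<mu> \<epsilon>)\<^sup>2 / (2 * \<kappa> \<epsilon>) = \<epsilon>\<^sup>2 * forcing_energy \<epsilon>"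
    by (simp add: forcing_energy_def power_mult_distrib)
  define h e g0 g1 f where "h = Th0 \<epsilon>" and "e = Dh0 \<epsilon>" and "g0 = gain_gap \<epsilon>" and "g1 = slope \<epsilon>" and "f = forcing_energy \<epsilon>"
  have abs: "\<bar>\<epsilon>\<^sup>2 * g0 * (\<epsilon> * g1)\<bar> = \<epsilon> ^ 3 * \<bar>g0 * g1\<bar>"
    using \<epsilon> by (simp add: abs_mult power2_eq_square power3_eq_cube)
  have "((\<epsilon> * g1)\<^sup>2 + e / \<epsilon> * (\<epsilon>\<^sup>2 * g0)\<^sup>2) / (h / \<epsilon>) = \<epsilon> ^ 3 * ((g1\<^sup>2 + \<epsilon> * (e * g0\<^sup>2)) / h)"
    using \<epsilon> by (simp add: power2_eq_square power3_eq_cube algebra_simps)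
  moreover have "\<epsilon>\<^sup>2 * f / (h / \<epsilon>)\<^sup>2 = \<epsilon> ^ 3 * (\<epsilon> * f / h\<^sup>2)"
    using \<epsilon> by (simp add: power_divide power2_eq_square power3_eq_cube)
  moreover have "h / \<epsilon> * (\<epsilon>\<^sup>2 * g0)\<^sup>2 = \<epsilon> ^ 3 * (h * g0\<^sup>2)"
    using \<epsilon> by (simp add: power2_eq_square power3_eq_cube)
  moreover have "\<epsilon>\<^sup>2 * f / (e / \<epsilon>)\<^sup>2 = \<epsilon> ^ 4 * (f / e\<^sup>2)"
    using \<epsilon> by (simp add: power_divide power2_eq_square power4_eq_xxxx)
  ultimately have 2: "(2 * \<bar>\<epsilon>\<^sup>2 * g0 * (\<epsilon> * g1)\<bar> + 2 * (((\<epsilon> * g1)\<^sup>2 + e / \<epsilon> * (\<epsilon>\<^sup>2 * g0)\<^sup>2) / (h / \<epsilon>) + \<epsilon>\<^sup>2 * f / (h / \<epsilon>)\<^sup>2)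
      + h / \<epsilon> * (\<epsilon>\<^sup>2 * g0)\<^sup>2) / (e / \<epsilon>) + \<epsilon>\<^sup>2 * f / (e / \<epsilon>)\<^sup>2
    = (\<epsilon> ^ 3 * (2 * \<bar>g0 * g1\<bar> + 2 * ((g1\<^sup>2 + \<epsilon> * (e * g0\<^sup>2)) / h + \<epsilon> * f / h\<^sup>2) + h * g0\<^sup>2)) / (e / \<epsilon>) + \<epsilon> ^ 4 * (f / e\<^sup>2)"
    unfolding abs by (simp only: distrib_left mult.left_commute)
  also have "\<dots> = \<epsilon> ^ 4 * kernel_factor \<epsilon>"
  proof -
    have cancel: "\<epsilon> ^ 3 * v / (Dh0 \<epsilon> / \<epsilon>) = \<epsilon> ^ 4 * (v / Dh0 \<epsilon>)" for v
      using \<epsilon> by (simp add: power4_eq_xxxx power3_eq_cube)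
    show ?thesis
      unfolding kernel_factor_def h_def e_def g0_def g1_def f_def cancel by (rule distrib_left[symmetric])
  qed
  finally show ?thesis
    unfolding err_bound_def Let_def T D kernel_characteristic[OF \<epsilon>] kernel_initial_value[OF \<epsilon>]
      kernel_initial_slope[OF \<epsilon>] forcing_energy 1 h_def e_def g0_def g1_def f_def by simp
qed

lemma tendsto_ident_mult_bounded:
  assumes "bounded_at_0 f"
  shows "((\<lambda>\<epsilon>. \<epsilon> * f \<epsilon>) \<longlongrightarrow> 0) (at_right 0)"
proof -
  obtain c where c: "eventually (\<lambda>\<epsilon>. norm (f \<epsilon>) \<le> c * norm (1::real)) (at_right 0)"
    using landau_o.bigE[OF assms] by blast
  show ?thesis
  proof (rule Lim_null_comparison)
    show "eventually (\<lambda>\<epsilon>. norm (\<epsilon> * f \<epsilon>) \<le> \<epsilon> * c) (at_right 0)"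
      using c eventually_at_right_less[of 0]
      by eventually_elim (auto simp: abs_mult intro!: mult_left_mono)
    have "((\<lambda>\<epsilon>. \<epsilon> * c) \<longlongrightarrow> 0 * c) (at_right 0)" by (intro tendsto_intros)
    then show "((\<lambda>\<epsilon>. \<epsilon> * c) \<longlongrightarrow> 0) (at_right 0)" by simp
  qed
qed

lemma err_bound_bigo: "err_bound \<in> O[at_right 0](\<lambda>\<epsilon>. \<epsilon> ^ 4)"
proof -
  note b = bounded_covariance bounded_expansion_terms
  have kb: "bounded_at_0 k" "bounded_at_0 l" "bounded_at_0 \<mu>" "bounded_at_0 gain_gap"
    unfolding k_def l_def \<mu>_def gain_gap_def by (intro bounded_at_0_intros b)+
  have \<kappa>b: "bounded_at_0 \<kappa>" and a1b: "bounded_at_0 a1" unfolding \<kappa>_def a1_def by (intro bounded_at_0_intros b kb)+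
  have G1b: "bounded_at_0 slope" unfolding slope_def by (intro bounded_at_0_intros b kb a1b)
  have Pb: "bounded_at_0 forcing" unfolding forcing_def by (intro bounded_at_0_intros b kb a1b)
  have Hb: "bounded_at_0 Th0" and Eb: "bounded_at_0 Dh0" unfolding Th0_def Dh0_def by (intro bounded_at_0_intros kb)+
  have D0: "D0 > 0" using det by (simp add: D0_def)
  have \<delta>2: "\<delta>\<^sup>2 > 0" using \<delta> by simp
  have ev: "eventually (\<lambda>\<epsilon>. 0 < \<epsilon>) (at_right (0::real))" by (rule eventually_at_right_less)
  have sq: "\<delta>\<^sup>2 \<le> x\<^sup>2" if "- \<delta> \<le> x" for x
    using power_mono[OF that, of 2] \<delta> by simp
  have T0: "eventually (\<lambda>\<epsilon>. \<delta>\<^sup>2 \<le> (T0 \<epsilon>)\<^sup>2) (at_right 0)"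
  proof (rule eventually_mono[OF ev])
    fix \<epsilon> :: real assume "0 < \<epsilon>"
    then show "\<delta>\<^sup>2 \<le> (T0 \<epsilon>)\<^sup>2" using \<alpha> by (intro sq) (simp add: T0_def mult_pos_neg less_imp_le)
  qed
  have Th0: "eventually (\<lambda>\<epsilon>. - \<delta> \<le> Th0 \<epsilon>) (at_right 0)"
  proof (rule eventually_mono[OF ev])
    fix \<epsilon> :: real assume \<epsilon>: "0 < \<epsilon>"
    have "k \<epsilon> \<ge> 0" using psd(1)[OF \<epsilon>] R by (simp add: k_def)
    then have "\<epsilon> * (\<alpha> - k \<epsilon>) \<le> 0" using \<epsilon> \<alpha> by (intro mult_nonneg_nonpos) auto
    then show "- \<delta> \<le> Th0 \<epsilon>" by (simp add: Th0_def)
  qed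
  have Dh0: "eventually (\<lambda>\<epsilon>. D0 / 2 \<le> Dh0 \<epsilon>) (at_right 0)"
  proof -
    have "((\<lambda>\<epsilon>. \<epsilon> * (\<beta> * l \<epsilon>)) \<longlongrightarrow> 0) (at_right 0)"
      by (intro tendsto_ident_mult_bounded bounded_at_0_intros kb)
    then have "eventually (\<lambda>\<epsilon>. - (D0 / 2) < \<epsilon> * (\<beta> * l \<epsilon>)) (at_right 0)"
      by (rule order_tendstoD(1)) (use D0 in simp)
    then show ?thesis using ev
    proof eventually_elim
      case (elim \<epsilon>)
      have "k \<epsilon> \<ge> 0" using psd(1)[OF elim(2)] R by (simp add: k_def)
      then have "\<delta> * k \<epsilon> \<le> 0" using \<delta> by (intro mult_nonpos_nonneg) auto
      moreover have "Dh0 \<epsilon> = D0 - \<delta> * k \<epsilon> + \<epsilon> * (\<beta> * l \<epsilon>)"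
        unfolding Dh0_def D0_def det_eq by (simp add: algebra_simps)
      ultimately show ?case using elim(1) by linarith
    qed
  qed
  have H2: "eventually (\<lambda>\<epsilon>. \<delta>\<^sup>2 \<le> (Th0 \<epsilon>)\<^sup>2) (at_right 0)"
    using Th0 by eventually_elim (rule sq)
  have E2: "eventually (\<lambda>\<epsilon>. (D0 / 2)\<^sup>2 \<le> (Dh0 \<epsilon>)\<^sup>2) (at_right 0)"
    using Dh0 by eventually_elim (use D0 in \<open>intro power_mono, auto\<close>)
  have \<kappa>: "eventually (\<lambda>\<epsilon>. - a0 \<le> 2 * \<kappa> \<epsilon>) (at_right 0)"
  proof -
    have "eventually (\<lambda>\<epsilon>. a \<epsilon> < a0 / 2) (at_right 0)"
      using a0_neg by (intro order_tendstoD(2)[OF tendsto_a]) simp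
    then show ?thesis using ev
    proof eventually_elim
      case (elim \<epsilon>)
      have "\<mu> \<epsilon> \<ge> 0" using s(1)[OF elim(2)] R by (simp add: \<mu>_def)
      then show ?case using elim(1) by (simp add: \<kappa>_def)
    qed
  qed
  have Fb: "bounded_at_0 forcing_energy" unfolding forcing_energy_def
    by (rule bounded_at_0_divide[OF _ _ \<kappa>]) (intro bounded_at_0_intros Pb kb, use a0_neg in simp)
  have "bounded_at_0 (\<lambda>\<epsilon>. 2 * X * \<epsilon>\<^sup>2 / (T0 \<epsilon>)\<^sup>2)"
    by (rule bounded_at_0_divide[OF _ \<delta>2 T0]) (intro bounded_at_0_intros)
  moreover have "bounded_at_0 (\<lambda>\<epsilon>. 2 * \<epsilon> / D0 / (T0 \<epsilon>)\<^sup>2)"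
    by (rule bounded_at_0_divide[OF _ \<delta>2 T0]) (intro bounded_at_0_intros)
  ultimately have gain: "bounded_at_0 gain_factor"
    unfolding gain_factor_def divide_divide_eq_left[symmetric] by (intro bounded_at_0_intros)
  have h1: "bounded_at_0 (\<lambda>\<epsilon>. ((slope \<epsilon>)\<^sup>2 + \<epsilon> * (Dh0 \<epsilon> * (gain_gap \<epsilon>)\<^sup>2)) / Th0 \<epsilon>)"
    by (rule bounded_at_0_divide[OF _ _ Th0]) (intro bounded_at_0_intros G1b Eb kb, use \<delta> in simp)
  have h2: "bounded_at_0 (\<lambda>\<epsilon>. \<epsilon> * forcing_energy \<epsilon> / (Th0 \<epsilon>)\<^sup>2)"
    by (rule bounded_at_0_divide[OF _ \<delta>2 H2]) (intro bounded_at_0_intros Fb)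
  have "bounded_at_0 (\<lambda>\<epsilon>. (2 * \<bar>gain_gap \<epsilon> * slope \<epsilon>\<bar> + 2 * (((slope \<epsilon>)\<^sup>2 + \<epsilon> * (Dh0 \<epsilon> * (gain_gap \<epsilon>)\<^sup>2)) / Th0 \<epsilon> + \<epsilon> * forcing_energy \<epsilon> / (Th0 \<epsilon>)\<^sup>2)
     + Th0 \<epsilon> * (gain_gap \<epsilon>)\<^sup>2) / Dh0 \<epsilon>)"
    by (rule bounded_at_0_divide[OF _ _ Dh0]) (intro bounded_at_0_intros kb G1b Hb h1 h2, use D0 in simp)
  moreover have "bounded_at_0 (\<lambda>\<epsilon>. forcing_energy \<epsilon> / (Dh0 \<epsilon>)\<^sup>2)"
    by (rule bounded_at_0_divide[OF Fb _ E2]) (use D0 in simp)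
  ultimately have kernel: "bounded_at_0 kernel_factor" unfolding kernel_factor_def by (rule bounded_at_0_add)
  have "eventually (\<lambda>\<epsilon>. err_bound \<epsilon> = \<epsilon> ^ 4 * (gain_factor \<epsilon> * kernel_factor \<epsilon>)) (at_right 0)"
    by (rule eventually_mono[OF ev]) (rule err_bound_eq)
  then show ?thesis
    using power_at_0_mult[OF bounded_at_0_mult[OF gain kernel], of 4] by (simp add: landau_o.big.in_cong)
qed

end

section \<open>Optimality of the MSM filter\<close>

lemma filter_difference_full_model:
  assumes model: "full_model M A \<sigma>x \<sigma>y R \<epsilon> Wx Wy V x y z" and \<epsilon>: "\<epsilon> > 0"
    and A: "negative_definite A" and \<sigma>: "\<sigma>x > 0" "\<sigma>y > 0" and R: "R > 0"
    and S: "steady_state_covariance A \<sigma>x \<sigma>y R \<epsilon> S"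
    and filter: "true_filter_mean M A R \<epsilon> S z m"
    and s: "s \<ge> 0" and ar: "ar < 0"
    and reduced: "reduced_filter_mean M ar R s z xt"
  defines "\<alpha> \<equiv> A $ 1 $ 1" and "\<beta> \<equiv> A $ 1 $ 2" and "\<gamma> \<equiv> A $ 2 $ 1" and "\<delta> \<equiv> A $ 2 $ 2"
    and "k \<equiv> S $ 1 $ 1 / R" and "l \<equiv> S $ 1 $ 2 / R" and "\<mu> \<equiv> s / R"
  defines "\<kappa> \<equiv> \<mu> - ar"
  defines "T \<equiv> - (\<alpha> + \<delta> / \<epsilon>)" and "D \<equiv> \<alpha> * (\<delta> / \<epsilon>) - \<beta> * (\<gamma> / \<epsilon>)"
    and "Th \<equiv> - ((\<alpha> - k) + \<delta> / \<epsilon>)" and "Dh \<equiv> (\<alpha> - k) * (\<delta> / \<epsilon>) - \<beta> * (\<gamma> / \<epsilon> - l)"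
  defines "g0 \<equiv> \<mu> - k" and "g1 \<equiv> k * (k - \<alpha>) - \<beta> * l - \<kappa> * \<mu>"
    and "F \<equiv> ((\<kappa>\<^sup>2 - Th * \<kappa> + Dh) * \<mu>)\<^sup>2 / (2 * \<kappa>)"
  shows "(\<forall>t\<ge>0. integrable M (\<lambda>\<omega>. (xt t \<omega> - m t \<omega> $ 1)\<^sup>2)) \<and>
    (\<exists>L. ((\<lambda>t. \<integral>\<omega>. (xt t \<omega> - m t \<omega> $ 1)\<^sup>2 \<partial>M) \<longlongrightarrow> L) at_top \<and> 0 \<le> L \<and>
      L \<le> (2 * \<sigma>x\<^sup>2 / T\<^sup>2 + (2 * \<sigma>x\<^sup>2 * (\<delta> / \<epsilon>)\<^sup>2 + \<sigma>y\<^sup>2 / \<epsilon> * \<beta>\<^sup>2) * (2 / (D * T\<^sup>2) + 1 / D\<^sup>2) + R)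
        * ((2 * \<bar>g0 * g1\<bar> + 2 * ((g1\<^sup>2 + Dh * g0\<^sup>2) / Th + F / Th\<^sup>2) + Th * g0\<^sup>2) / Dh + F / Dh\<^sup>2))"
proof -
  note eqs = steady_state_covariance_equations[OF S]
  obtain B where B: "wiener_noise M 3 B"
    and Y: "wiener_noise.linear_sde M 3 B 5
      (filter_system \<alpha> \<beta> (\<gamma> / \<epsilon>) (\<delta> / \<epsilon>) k l \<mu> \<kappa>) (filter_noise \<sigma>x (\<sigma>y / sqrt \<epsilon>) (sqrt R) k l \<mu>)
      (\<lambda>k. [x, y, \<lambda>t \<omega>. m t \<omega> $ 1, \<lambda>t \<omega>. m t \<omega> $ 2, xt] ! k)"
    unfolding \<alpha>_def \<beta>_def \<gamma>_def \<delta>_def k_def l_def \<mu>_def \<kappa>_def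
    by (rule filters_linear_sde[OF model filter reduced eqs(1)])
  have neg: "\<alpha> < 0" "\<delta> < 0" "\<alpha> * \<delta> - \<beta> * \<gamma> > 0"
    unfolding \<alpha>_def \<beta>_def \<gamma>_def \<delta>_def by (rule negative_definite_22[OF A])+
  have \<delta>\<epsilon>: "\<delta> / \<epsilon> < 0" using neg \<epsilon> by (simp add: divide_neg_pos)
  have k0: "k \<ge> 0" using eqs(5) R by (simp add: k_def)
  have tr: "\<alpha> + \<delta> / \<epsilon> < 0" "(\<alpha> - k) + \<delta> / \<epsilon> < 0" using neg(1) \<delta>\<epsilon> k0 by linarith+
  have "\<alpha> * (\<delta> / \<epsilon>) - \<beta> * (\<gamma> / \<epsilon>) = (\<alpha> * \<delta> - \<beta> * \<gamma>) / \<epsilon>" by (simp add: diff_divide_distrib)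
  then have D: "\<alpha> * (\<delta> / \<epsilon>) - \<beta> * (\<gamma> / \<epsilon>) > 0" using neg \<epsilon> by simp
  have Dh: "(\<alpha> - k) * (\<delta> / \<epsilon>) - \<beta> * (\<gamma> / \<epsilon> - l) > 0"
    unfolding \<alpha>_def \<beta>_def \<gamma>_def \<delta>_def k_def l_def
    by (rule filter_determinant_pos[OF R _ _ eqs(2,3,4,7)]) (use \<sigma> \<epsilon> in simp_all)
  have \<kappa>: "\<kappa> > 0" using s R ar unfolding \<kappa>_def \<mu>_def by (smt (verit) divide_nonneg_pos)
  have p: "(\<sigma>y / sqrt \<epsilon>)\<^sup>2 = \<sigma>y\<^sup>2 / \<epsilon>" "(sqrt R)\<^sup>2 = R" using \<epsilon> R by (simp_all add: power_divide)
  show ?thesis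
    using wiener_noise.filter_difference_limit[OF B refl Y tr(1) D tr(2) Dh \<kappa>]
    unfolding p T_def D_def Th_def Dh_def g0_def g1_def F_def by (simp add: square_integrable_def)
qed

theorem corollary2p3:
  fixes A :: "real^2^2" and \<sigma>x \<sigma>y R :: real
    and M :: "real \<Rightarrow> 'w measure"
    and Wx Wy V x y z :: "real \<Rightarrow> real \<Rightarrow> 'w \<Rightarrow> real"
    and S :: "real \<Rightarrow> real^2^2" and xy_hat :: "real \<Rightarrow> real \<Rightarrow> 'w \<Rightarrow> real^2"
    and a \<sigma>X s :: "real \<Rightarrow> real" and x_tilde :: "real \<Rightarrow> real \<Rightarrow> 'w \<Rightarrow> real"
  assumes "negative_definite A"
    and "A $ 1 $ 1 - A $ 1 $ 2 * A $ 2 $ 1 / A $ 2 $ 2 < 0"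
    and "\<sigma>x > 0" and "\<sigma>y > 0" and "R > 0"
    and "\<And>\<epsilon>. \<epsilon> > 0 \<Longrightarrow>
      full_model (M \<epsilon>) A \<sigma>x \<sigma>y R \<epsilon> (Wx \<epsilon>) (Wy \<epsilon>) (V \<epsilon>) (x \<epsilon>) (y \<epsilon>) (z \<epsilon>)"
    and "\<And>\<epsilon>. \<epsilon> > 0 \<Longrightarrow> steady_state_covariance A \<sigma>x \<sigma>y R \<epsilon> (S \<epsilon>)"
    and "\<And>\<epsilon>. \<epsilon> > 0 \<Longrightarrow> true_filter_mean (M \<epsilon>) A R \<epsilon> (S \<epsilon>) (z \<epsilon>) (xy_hat \<epsilon>)"
    and "\<And>\<epsilon>. \<epsilon> > 0 \<Longrightarrow> msm_parameters (M \<epsilon>) (x \<epsilon>) (a \<epsilon>) (\<sigma>X \<epsilon>)"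
    and "\<And>\<epsilon>. \<epsilon> > 0 \<Longrightarrow> reduced_covariance (a \<epsilon>) (\<sigma>X \<epsilon>) R (s \<epsilon>)"
    and "\<And>\<epsilon>. \<epsilon> > 0 \<Longrightarrow> reduced_filter_mean (M \<epsilon>) (a \<epsilon>) R (s \<epsilon>) (z \<epsilon>) (x_tilde \<epsilon>)"
  shows "(\<lambda>\<epsilon>. s \<epsilon> - S \<epsilon> $ 1 $ 1) \<in> O[at_right 0](\<lambda>\<epsilon>. \<epsilon>\<^sup>2) \<and>
    (\<exists>D. (\<forall>\<epsilon>>0.
            (\<forall>t\<ge>0. integrable (M \<epsilon>) (\<lambda>\<omega>. (x_tilde \<epsilon> t \<omega> - xy_hat \<epsilon> t \<omega> $ 1)\<^sup>2)) \<and>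
            ((\<lambda>t. sqrt (\<integral>\<omega>. (x_tilde \<epsilon> t \<omega> - xy_hat \<epsilon> t \<omega> $ 1)\<^sup>2 \<partial>M \<epsilon>)) \<longlongrightarrow> D \<epsilon>) at_top) \<and>
         D \<in> O[at_right 0](\<lambda>\<epsilon>. \<epsilon>\<^sup>2))"
proof -
  note A = assms(1) and \<sigma> = assms(3,4) and R = assms(5) and model = assms(6) and ric = assms(7)
    and filter = assms(8) and msm = assms(9) and red = assms(10) and reduced = assms(11)
  interpret asym: slow_fast_riccati "A $ 1 $ 1" "A $ 1 $ 2" "A $ 2 $ 1" "A $ 2 $ 2" "\<sigma>x\<^sup>2" "\<sigma>y\<^sup>2" R
    "\<lambda>\<epsilon>. S \<epsilon> $ 1 $ 1" "\<lambda>\<epsilon>. S \<epsilon> $ 1 $ 2" "\<lambda>\<epsilon>. S \<epsilon> $ 2 $ 2" s a "\<lambda>\<epsilon>. (\<sigma>X \<epsilon>)\<^sup>2"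
  proof
    show "A $ 1 $ 1 < 0" "A $ 2 $ 2 < 0" "A $ 1 $ 1 * A $ 2 $ 2 - A $ 1 $ 2 * A $ 2 $ 1 > 0"
      by (rule negative_definite_22[OF A])+
    show "\<sigma>x\<^sup>2 > 0" "\<sigma>y\<^sup>2 > 0" "R > 0" using \<sigma> R by simp_all
    fix \<epsilon> :: real assume \<epsilon>: "\<epsilon> > 0"
    show "0 \<le> s \<epsilon>" "- ((s \<epsilon>)\<^sup>2 / R) + 2 * a \<epsilon> * s \<epsilon> + (\<sigma>X \<epsilon>)\<^sup>2 = 0"
      using red[OF \<epsilon>] unfolding reduced_covariance_def by auto
    note riccati = steady_state_covariance_equations[OF ric[OF \<epsilon>]]
    show "2 * (A $ 1 $ 1 * S \<epsilon> $ 1 $ 1 + A $ 1 $ 2 * S \<epsilon> $ 1 $ 2) - (S \<epsilon> $ 1 $ 1)\<^sup>2 / R + \<sigma>x\<^sup>2 = 0"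
      by (rule riccati(2))
    show "A $ 1 $ 1 * S \<epsilon> $ 1 $ 2 + A $ 1 $ 2 * S \<epsilon> $ 2 $ 2 + A $ 2 $ 1 / \<epsilon> * S \<epsilon> $ 1 $ 1 + A $ 2 $ 2 / \<epsilon> * S \<epsilon> $ 1 $ 2
      - S \<epsilon> $ 1 $ 1 * S \<epsilon> $ 1 $ 2 / R = 0"
      by (rule riccati(3))
    show "2 * (A $ 2 $ 1 / \<epsilon> * S \<epsilon> $ 1 $ 2 + A $ 2 $ 2 / \<epsilon> * S \<epsilon> $ 2 $ 2) - (S \<epsilon> $ 1 $ 2)\<^sup>2 / R + \<sigma>y\<^sup>2 / \<epsilon> = 0"
      by (rule riccati(4))
    show "0 \<le> S \<epsilon> $ 1 $ 1" "0 \<le> S \<epsilon> $ 2 $ 2" "(S \<epsilon> $ 1 $ 2)\<^sup>2 \<le> S \<epsilon> $ 1 $ 1 * S \<epsilon> $ 2 $ 2"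
      by (rule riccati(5-7))+
  qed (rule msm_parameters_full_model[OF model msm A _ \<sigma>(1)]; assumption)+
  define limit where "limit = (\<lambda>\<epsilon> L.
    ((\<lambda>t. \<integral>\<omega>. (x_tilde \<epsilon> t \<omega> - xy_hat \<epsilon> t \<omega> $ 1)\<^sup>2 \<partial>M \<epsilon>) \<longlongrightarrow> L) at_top \<and> 0 \<le> L \<and> L \<le> asym.err_bound \<epsilon>)"
  note difference = filter_difference_full_model[OF model _ A \<sigma> R ric filter asym.s(1) asym.a_negative reduced,
      folded asym.k_def asym.l_def asym.\<mu>_def, folded asym.\<kappa>_def]
  have int: "\<forall>t\<ge>0. integrable (M \<epsilon>) (\<lambda>\<omega>. (x_tilde \<epsilon> t \<omega> - xy_hat \<epsilon> t \<omega> $ 1)\<^sup>2)" if "\<epsilon> > 0" for \<epsilon>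
    by (rule difference[THEN conjunct1]) (rule that)+
  have "\<exists>L. limit \<epsilon> L" if "\<epsilon> > 0" for \<epsilon>
    unfolding limit_def asym.err_bound_def Let_def
    by (rule difference[THEN conjunct2]) (rule that)+
  then have "\<forall>\<epsilon>. \<exists>L. \<epsilon> > 0 \<longrightarrow> limit \<epsilon> L" by blast
  then obtain L where "\<forall>\<epsilon>. \<epsilon> > 0 \<longrightarrow> limit \<epsilon> (L \<epsilon>)" using choice[of "\<lambda>\<epsilon> L. \<epsilon> > 0 \<longrightarrow> limit \<epsilon> L"] by blast
  then have L: "((\<lambda>t. \<integral>\<omega>. (x_tilde \<epsilon> t \<omega> - xy_hat \<epsilon> t \<omega> $ 1)\<^sup>2 \<partial>M \<epsilon>) \<longlongrightarrow> L \<epsilon>) at_top"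
      "0 \<le> L \<epsilon>" "L \<epsilon> \<le> asym.err_bound \<epsilon>" if "\<epsilon> > 0" for \<epsilon>
    using that unfolding limit_def by blast+
  have D: "(\<lambda>\<epsilon>. sqrt (L \<epsilon>)) \<in> O[at_right 0](\<lambda>\<epsilon>. \<epsilon>\<^sup>2)"
  proof -
    obtain c where c: "c > 0" "eventually (\<lambda>\<epsilon>. norm (asym.err_bound \<epsilon>) \<le> c * norm (\<epsilon> ^ 4)) (at_right 0)"
      using landau_o.bigE[OF asym.err_bound_bigo] by blast
    show ?thesis
    proof (rule bigoI[where c = "sqrt c"])
      show "eventually (\<lambda>\<epsilon>. norm (sqrt (L \<epsilon>)) \<le> sqrt c * norm (\<epsilon>\<^sup>2)) (at_right 0)"
        using c(2) eventually_at_right_less[of 0]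
      proof eventually_elim
        case (elim \<epsilon>)
        have "L \<epsilon> \<le> c * \<epsilon> ^ 4" using L(3)[OF elim(2)] elim by auto
        also have "\<dots> = c * (\<epsilon>\<^sup>2)\<^sup>2" by simp
        finally have "sqrt (L \<epsilon>) \<le> sqrt (c * (\<epsilon>\<^sup>2)\<^sup>2)" by (rule real_sqrt_le_mono)
        also have "\<dots> = sqrt c * \<epsilon>\<^sup>2" by (simp only: real_sqrt_mult real_sqrt_abs abs_power2)
        finally show ?case using L(2)[OF elim(2)] by simp
      qed
    qed
  qed
  have lim: "((\<lambda>t. sqrt (\<integral>\<omega>. (x_tilde \<epsilon> t \<omega> - xy_hat \<epsilon> t \<omega> $ 1)\<^sup>2 \<partial>M \<epsilon>)) \<longlongrightarrow> sqrt (L \<epsilon>)) at_top"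
    if "\<epsilon> > 0" for \<epsilon>
    by (intro tendsto_real_sqrt L(1) that)
  show ?thesis
    by (intro conjI exI[of _ "\<lambda>\<epsilon>. sqrt (L \<epsilon>)"] allI impI asym.covariance_difference D lim)
       (use int in blast)+
qed

end
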